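(* Let $m\le n$ be positive integers satisfying one of the following: (a) $m+n \equiv 1 \pmod 3$ and $n \le 2m-5$; (b) $m+n \equiv 0 \pmod 3$ and $n \le 2m-9$; (c) $m+n \equiv 2 \pmod 3$ and $n \le 2m-13$. Then the exponent of $\tilde H_{\nu_{m,n}}(M_{m,n})$ divides the exponent of $\tilde H_{\nu_{9,9}}(M_{9,9})$. Consequently, if $\tilde H_{\nu_{9,9}}(M_{9,9})$ is an elementary $3$-group, then so is $\tilde H_{\nu_{m,n}}(M_{m,n})$ for all $m\le n$ satisfying (a), (b) or (c).
   Context: For positive integers $m,n$, let $[m]=\{1,\dots,m\}$ and $[n]'=\{1',\dots,n'\}$. The chessboard complex $M_{m,n}$ is the abstract simplicial complex whose vertices are the edges of the complete bipartite graph with parts $[m]$ and $[n]'$ and whose faces are the sets of pairwise disjoint edges (matchings). $\nu_{m,n} = \min\{m,n,\lfloor \frac{m+n+1}{3}\rfloor\}-1$. $\tilde H_*$ denotes reduced simplicial homology with integer coefficients. An elementary $3$-group is an abelian group in which every element $x$ satisfies $3x=0$. *)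

theory Defs
  imports "HOL-Algebra.Free_Abelian_Groups"
begin

text \<open>
  An abstract simplicial complex is given by its set \<open>K\<close> of faces, the empty face included.
  As the empty face spans the chain group in degree -1, the complex below is the augmented
  simplicial chain complex, so its homology is reduced homology.
\<close>

definition simplicial_chain_group :: "'a set set \<Rightarrow> int \<Rightarrow> ('a set \<Rightarrow>\<^sub>0 int) monoid" where
  "simplicial_chain_group K p =
     free_Abelian_group {\<sigma> \<in> K. finite \<sigma> \<and> int (card \<sigma>) = p + 1}"

text \<open>
  The relation \<open>r\<close> is a strict linear order on the vertices; it orients every simplex. In a
  simplex \<open>v\<^sub>0 < \<dots> < v\<^sub>p\<close> the vertex \<open>v\<^sub>i\<close> has exactly \<open>i\<close> predecessors, so the formula below is
  the usual \<open>\<Sum>i\<le>p. (-1)^i [v\<^sub>0, \<dots>, v\<^sub>i omitted, \<dots>, v\<^sub>p]\<close>.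
\<close>

definition simplicial_boundary :: "'a rel \<Rightarrow> ('a set \<Rightarrow>\<^sub>0 int) \<Rightarrow> ('a set \<Rightarrow>\<^sub>0 int)" where
  "simplicial_boundary r =
     frag_extend (\<lambda>\<sigma>. \<Sum>v\<in>\<sigma>. frag_cmul ((-1) ^ card {w \<in> \<sigma>. (w, v) \<in> r}) (frag_of (\<sigma> - {v})))"

definition simplicial_cycles :: "'a rel \<Rightarrow> 'a set set \<Rightarrow> int \<Rightarrow> ('a set \<Rightarrow>\<^sub>0 int) set" where
  "simplicial_cycles r K p =
     kernel (simplicial_chain_group K p) (simplicial_chain_group K (p - 1)) (simplicial_boundary r)"

definition simplicial_boundaries :: "'a rel \<Rightarrow> 'a set set \<Rightarrow> int \<Rightarrow> ('a set \<Rightarrow>\<^sub>0 int) set" where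
  "simplicial_boundaries r K p =
     simplicial_boundary r ` carrier (simplicial_chain_group K (p + 1))"

definition reduced_simplicial_homology ::
    "'a rel \<Rightarrow> 'a set set \<Rightarrow> int \<Rightarrow> ('a set \<Rightarrow>\<^sub>0 int) set monoid" where
  "reduced_simplicial_homology r K p =
     subgroup_generated (simplicial_chain_group K p) (simplicial_cycles r K p)
       Mod simplicial_boundaries r K p"

text \<open>The pair \<open>(i, j)\<close> stands for the edge \<open>{i, j'}\<close> of the complete bipartite graph.\<close>

definition chessboard_complex :: "nat \<Rightarrow> nat \<Rightarrow> (nat \<times> nat) set set" where
  "chessboard_complex m n =
     {\<sigma>. \<sigma> \<subseteq> {1..m} \<times> {1..n} \<and>
         (\<forall>e\<in>\<sigma>. \<forall>f\<in>\<sigma>. e \<noteq> f \<longrightarrow> fst e \<noteq> fst f \<and> snd e \<noteq> snd f)}"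

text \<open>The vertices are ordered lexicographically; any other linear order gives an isomorphic group.\<close>

definition chessboard_homology :: "nat \<Rightarrow> nat \<Rightarrow> int \<Rightarrow> ((nat \<times> nat) set \<Rightarrow>\<^sub>0 int) set monoid" where
  "chessboard_homology m n p =
     reduced_simplicial_homology (less_than <*lex*> less_than) (chessboard_complex m n) p"

definition chessboard_nu :: "nat \<Rightarrow> nat \<Rightarrow> int" where
  "chessboard_nu m n = min (int m) (min (int n) ((int m + int n + 1) div 3)) - 1"

text \<open>
  The exponent is 0 if no positive exponent exists, so that, as usual for an infinite exponent,
  it is then a multiple of every exponent and divides only itself.
\<close>

definition group_exponent :: "('a, 'b) monoid_scheme \<Rightarrow> nat" where
  "group_exponent G =
     (if \<exists>e::nat. e > 0 \<and> (\<forall>x\<in>carrier G. x [^]\<^bsub>G\<^esub> e = \<one>\<^bsub>G\<^esub>)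
      then LEAST e::nat. e > 0 \<and> (\<forall>x\<in>carrier G. x [^]\<^bsub>G\<^esub> e = \<one>\<^bsub>G\<^esub>)
      else 0)"

definition elementary_3_group :: "('a, 'b) monoid_scheme \<Rightarrow> bool" where
  "elementary_3_group G \<longleftrightarrow> comm_group G \<and> (\<forall>x\<in>carrier G. x [^]\<^bsub>G\<^esub> (3::nat) = \<one>\<^bsub>G\<^esub>)"

definition admissible :: "nat \<Rightarrow> nat \<Rightarrow> bool" where
  "admissible m n \<longleftrightarrow> 1 \<le> m \<and> m \<le> n \<and>
     ((m + n) mod 3 = 1 \<and> int n \<le> 2 * int m - 5 \<or>
      (m + n) mod 3 = 0 \<and> int n \<le> 2 * int m - 9 \<or>
      (m + n) mod 3 = 2 \<and> int n \<le> 2 * int m - 13)"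

end

theory Submission
  imports Defs "HOL-Library.Numeral_Type"
begin

text \<open>
A face of the complex is a placement of non-attacking rooks on a board, so the statement is about
cycles of such placements. The simplest cycles are joins of 0-spheres: a 0-sphere consists of two
positions in one row, or of two positions in one column, and \<open>p\<close> spheres of the first kind and \<open>q\<close>
of the second use up \<open>p + 2q\<close> rows and \<open>2p + q\<close> columns. The idea of the proof is that such joins
generate the homology in the degree in question, up to a small correction, and that an annihilator
of the \<open>9 \<times> 9\<close> board, which carries the joins of 3 + 3 spheres, annihilates every join with at least
three spheres of each kind.

\<^bold>\<open>Generation.\<close> Fix a corner \<open>(i\<^sub>0, j\<^sub>0)\<close>. Modulo the cone over the corner only those placements matter
that have a rook elsewhere in row \<open>i\<^sub>0\<close>, elsewhere in column \<open>j\<^sub>0\<close>, or both. The part of the last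
kind has coefficients that are cycles on a board with two rows and two columns fewer. If these
coefficients bound, a boundary removes that part (\<open>star_reduction\<close>, \<open>star_generation\<close>), and what is left is a
sum of 0-spheres through the corner joined with cycles of boards with one row and two columns
fewer, or two rows and one column fewer. Induction gives the vanishing of the homology in low degrees (\<open>vanishing\<close>),
then generation by joins of 0-spheres if the number of lines is divisible by 3 (\<open>cycles_gen_products\<close>), and
by such joins with one spare line if it is 1 modulo 3 (\<open>cycles_gen_near_products\<close>). If it is 2
modulo 3, the coefficients just mentioned do not bound, but they are joins with a spare line; one of their
spheres, the spare line and the two rooks extend to a cycle on a \<open>4 \<times> 4\<close> board. So the generators
are joins of 0-spheres with one cycle on a \<open>2 \<times> 3\<close>, \<open>3 \<times> 2\<close> or \<open>4 \<times> 4\<close> board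
(\<open>cycles_gen_op_products\<close>). The inductions end at boards about twice as long as wide, where all
shorter lines are occupied and the cycles can be determined directly (\<open>top_cycles\<close>).

\<^bold>\<open>Annihilators.\<close> The bounds on \<open>n\<close> say that enough spheres of both kinds occur. In the cases (b) and (c)
every generator contains a join of 3 + 3 spheres (\<open>kills_product_range\<close>, \<open>kills_op_product_range\<close>). In
case (a) every generator contains a join on a \<open>5 \<times> 5\<close> board with a spare line. Exchanging the spare
line with lines of the join shows that three classes whose sum is zero are equal, so that
multiplication by 3 kills the homology (\<open>three_kills\<close>).

\<^bold>\<open>The exponent on the \<open>9 \<times> 9\<close> board is divisible by 3.\<close> This is what remains for case (a), and it follows from
a functional on the homology with values in \<open>\<int>/3\<close> that sends every join of 0-spheres to its
sign (\<open>sign_functional_exists\<close>). It is built by recursion along the decomposition at a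
corner, together with an analogous functional for joins with a spare line. Both are well defined
because, whenever different decompositions have to be compared, either their signs agree or three equal
values add up.
\<close>

section \<open>Exterior multiplication and contraction of chains\<close>

abbreviation lexord_pairs :: "(nat \<times> nat) rel"
  where "lexord_pairs \<equiv> less_than <*lex*> less_than"

type_synonym chain = "(nat \<times> nat) set \<Rightarrow>\<^sub>0 int"

abbreviation bd :: "chain \<Rightarrow> chain"
  where "bd \<equiv> simplicial_boundary lexord_pairs"

text \<open>
  The number of vertices of \<open>\<sigma>\<close> below \<open>v\<close> is the position of \<open>v\<close> in the ordered simplex
  \<open>insert v \<sigma>\<close>, so this is the sign with which \<open>v\<close> is moved to the front; it is also the
  incidence sign in \<open>bd\<close>.
\<close>

definition insertion_sign :: "(nat \<times> nat) set \<Rightarrow> nat \<times> nat \<Rightarrow> int"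
  where "insertion_sign \<sigma> v = (-1) ^ card {w \<in> \<sigma>. (w, v) \<in> lexord_pairs}"

text \<open>
  Left exterior multiplication by a vertex; together with the contraction below it turns all
  computations with boundaries into computations in a Clifford algebra, where no simplex has to be
  mentioned. The infinite simplices are sent to 0, as their insertion signs are meaningless.
\<close>

definition wedge :: "nat \<times> nat \<Rightarrow> chain \<Rightarrow> chain"
  where "wedge v = frag_extend (\<lambda>\<sigma>. if finite \<sigma> \<and> v \<notin> \<sigma>
    then frag_cmul (insertion_sign \<sigma> v) (frag_of (insert v \<sigma>)) else 0)"

definition contract :: "nat \<times> nat \<Rightarrow> chain \<Rightarrow> chain"
  where "contract v = frag_extend (\<lambda>\<sigma>. if finite \<sigma> \<and> v \<in> \<sigma>
    then frag_cmul (insertion_sign \<sigma> v) (frag_of (\<sigma> - {v})) else 0)"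

lemma wedge_linear [simp]:
  "wedge v 0 = 0" "wedge v (a + b) = wedge v a + wedge v b" "wedge v (a - b) = wedge v a - wedge v b"
  "wedge v (- a) = - wedge v a" "wedge v (frag_cmul k a) = frag_cmul k (wedge v a)"
  by (simp_all add: wedge_def frag_extend_add frag_extend_diff frag_extend_minus frag_extend_cmul)

lemma contract_linear [simp]:
  "contract v 0 = 0" "contract v (a + b) = contract v a + contract v b"
  "contract v (a - b) = contract v a - contract v b"
  "contract v (- a) = - contract v a" "contract v (frag_cmul k a) = frag_cmul k (contract v a)"
  by (simp_all add: contract_def frag_extend_add frag_extend_diff frag_extend_minus frag_extend_cmul)

lemma bd_linear [simp]:
  "bd 0 = 0" "bd (a + b) = bd a + bd b" "bd (a - b) = bd a - bd b"
  "bd (- a) = - bd a" "bd (frag_cmul k a) = frag_cmul k (bd a)"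
  by (simp_all add: simplicial_boundary_def frag_extend_add frag_extend_diff frag_extend_minus frag_extend_cmul)

lemma additive_sum:
  fixes f :: "'a::ab_group_add \<Rightarrow> 'b::ab_group_add"
  assumes "\<And>x y. f (x + y) = f x + f y"
  shows "f (sum g S) = (\<Sum>i\<in>S. f (g i))"
proof -
  have f0: "f 0 = 0"
    using assms [of 0 0] by simp
  show ?thesis
    by (induction S rule: infinite_finite_induct) (simp_all add: f0 assms)
qed

lemmas wedge_sum = additive_sum [of "wedge v" for v, OF wedge_linear(2)]
lemmas contract_sum = additive_sum [of "contract v" for v, OF contract_linear(2)]
lemmas bd_sum = additive_sum [of bd, OF bd_linear(2)]

lemma insertion_sign_insert:
  assumes "finite \<sigma>" "w \<notin> \<sigma>"
  shows "insertion_sign (insert w \<sigma>) v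
    = (if (w, v) \<in> lexord_pairs then - 1 else 1) * insertion_sign \<sigma> v"
proof -
  have "{u \<in> insert w \<sigma>. (u, v) \<in> lexord_pairs}
     = (if (w, v) \<in> lexord_pairs then insert w {u \<in> \<sigma>. (u, v) \<in> lexord_pairs}
        else {u \<in> \<sigma>. (u, v) \<in> lexord_pairs})"
    by auto
  then show ?thesis
    using assms by (simp add: insertion_sign_def)
qed

lemma insertion_sign_Diff:
  assumes "finite \<sigma>" "w \<in> \<sigma>"
  shows "insertion_sign (\<sigma> - {w}) v
    = (if (w, v) \<in> lexord_pairs then - 1 else 1) * insertion_sign \<sigma> v"
  using insertion_sign_insert [of "\<sigma> - {w}" w v] assms by (simp add: insert_absorb)

lemma insertion_sign_square [simp]: "insertion_sign \<sigma> v * insertion_sign \<sigma> v = 1"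
  by (simp add: insertion_sign_def flip: power_add mult_2)

lemma lexord_pairs_cases:
  assumes "v \<noteq> w"
  obtains "(v, w) \<in> lexord_pairs" "(w, v) \<notin> lexord_pairs"
    | "(v, w) \<notin> lexord_pairs" "(w, v) \<in> lexord_pairs"
proof -
  have "(v, w) \<in> lexord_pairs \<and> (w, v) \<notin> lexord_pairs
    \<or> (v, w) \<notin> lexord_pairs \<and> (w, v) \<in> lexord_pairs"
    using assms by (cases v; cases w) auto
  then show ?thesis
    using that by blast
qed

lemma lexord_pairs_irrefl [simp]: "(v, v) \<notin> lexord_pairs"
  by (cases v) auto

lemma wedge_frag_of:
  "wedge v (frag_of \<sigma>) = (if finite \<sigma> \<and> v \<notin> \<sigma>
    then frag_cmul (insertion_sign \<sigma> v) (frag_of (insert v \<sigma>)) else 0)"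
  by (simp add: wedge_def)

lemma contract_frag_of:
  "contract v (frag_of \<sigma>) = (if finite \<sigma> \<and> v \<in> \<sigma>
    then frag_cmul (insertion_sign \<sigma> v) (frag_of (\<sigma> - {v})) else 0)"
  by (simp add: contract_def)

lemma wedge_wedge: "wedge v (wedge w c) = - wedge w (wedge v c)"
  using subset_UNIV
proof (induction c rule: frag_induction)
  case (one \<sigma>)
  consider "v = w" | "infinite \<sigma>" | "v \<in> \<sigma>" | "w \<in> \<sigma>"
    | "v \<noteq> w" "finite \<sigma>" "v \<notin> \<sigma>" "w \<notin> \<sigma>"
    by blast
  then show ?case
  proof cases
    case 5
    then show ?thesis
      by (cases v w rule: lexord_pairs_cases)
        (simp_all add: wedge_frag_of insertion_sign_insert insert_commute mult.commute)
  qed (auto simp: wedge_frag_of)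
qed auto

lemma wedge_wedge_self [simp]: "wedge v (wedge v c) = 0"
  using subset_UNIV
  by (induction c rule: frag_induction) (auto simp: wedge_frag_of)

lemma contract_contract: "contract v (contract w c) = - contract w (contract v c)"
  using subset_UNIV
proof (induction c rule: frag_induction)
  case (one \<sigma>)
  consider "v = w" | "infinite \<sigma>" | "v \<notin> \<sigma>" | "w \<notin> \<sigma>"
    | "v \<noteq> w" "finite \<sigma>" "v \<in> \<sigma>" "w \<in> \<sigma>"
    by blast
  then show ?case
  proof cases
    case 5
    then have "\<sigma> - {v} - {w} = \<sigma> - {w} - {v}"
      by auto
    with 5 show ?thesis
      by (cases v w rule: lexord_pairs_cases)
        (simp_all add: contract_frag_of insertion_sign_Diff mult.commute)
  qed (auto simp: contract_frag_of)
qed auto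

lemma contract_wedge:
  assumes "v \<noteq> w"
  shows "contract v (wedge w c) = - wedge w (contract v c)"
  using subset_UNIV
proof (induction c rule: frag_induction)
  case (one \<sigma>)
  consider "infinite \<sigma>" | "v \<notin> \<sigma>" | "w \<in> \<sigma>" | "finite \<sigma>" "v \<in> \<sigma>" "w \<notin> \<sigma>"
    by blast
  then show ?case
  proof cases
    case 4
    then have "insert w \<sigma> - {v} = insert w (\<sigma> - {v})"
      using assms by auto
    from assms show ?thesis
      by (cases v w rule: lexord_pairs_cases)
        (use 4 assms \<open>insert w \<sigma> - {v} = _\<close> in \<open>simp_all add: contract_frag_of wedge_frag_of insertion_sign_Diff insertion_sign_insert mult.commute\<close>)
  qed (use assms in \<open>auto simp: contract_frag_of wedge_frag_of\<close>)
qed auto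

definition finitary :: "chain \<Rightarrow> bool"
  where "finitary c \<longleftrightarrow> Poly_Mapping.keys c \<subseteq> Collect finite"

text \<open>
  The Clifford relation fails only on infinite simplices, which \<open>wedge\<close> and \<open>contract\<close> annihilate.
\<close>

lemma contract_wedge_self:
  assumes "finitary c"
  shows "contract v (wedge v c) = c - wedge v (contract v c)"
  using assms unfolding finitary_def
proof (induction c rule: frag_induction)
  case (one \<sigma>)
  then show ?case
    by (cases "v \<in> \<sigma>")
      (auto simp: contract_frag_of wedge_frag_of insertion_sign_Diff insertion_sign_insert insert_absorb)
qed auto

text \<open>
  The boundary is the sum of all contractions; this is what reduces the behaviour of \<open>bd\<close> to the
  Clifford relations.
\<close>

lemma bd_frag_of_eq_sum_contract:
  assumes "finite V" "\<sigma> \<subseteq> V"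
  shows "bd (frag_of \<sigma>) = (\<Sum>v\<in>V. contract v (frag_of \<sigma>))"
proof -
  have fin: "finite \<sigma>"
    using assms finite_subset by blast
  have "bd (frag_of \<sigma>) = (\<Sum>v\<in>\<sigma>. contract v (frag_of \<sigma>))"
    using fin by (auto simp: simplicial_boundary_def contract_frag_of insertion_sign_def intro!: sum.cong)
  also have "\<dots> = (\<Sum>v\<in>V. contract v (frag_of \<sigma>))"
    using assms by (intro sum.mono_neutral_left) (auto simp: contract_frag_of)
  finally show ?thesis .
qed

lemma bd_eq_sum_contract:
  assumes "finite V" "\<And>\<sigma>. \<sigma> \<in> Poly_Mapping.keys c \<Longrightarrow> \<sigma> \<subseteq> V"
  shows "bd c = (\<Sum>v\<in>V. contract v c)"
proof -
  have "Poly_Mapping.keys c \<subseteq> Pow V"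
    using assms by blast
  then show ?thesis
  proof (induction c rule: frag_induction)
    case (one \<sigma>)
    then show ?case
      using assms(1) bd_frag_of_eq_sum_contract by blast
  qed (auto simp: sum_subtractf)
qed

lemma bd_contract: "bd (contract w c) = - contract w (bd c)"
  using subset_UNIV
proof (induction c rule: frag_induction)
  case (one \<sigma>)
  show ?case
  proof (cases "finite \<sigma>")
    case True
    have "Poly_Mapping.keys (contract w (frag_of \<sigma>)) \<subseteq> Pow \<sigma>"
      by (auto simp: contract_frag_of split: if_splits)
    then have "bd (contract w (frag_of \<sigma>)) = (\<Sum>v\<in>\<sigma>. contract v (contract w (frag_of \<sigma>)))"
      using True by (intro bd_eq_sum_contract) auto
    also have "\<dots> = (\<Sum>v\<in>\<sigma>. - contract w (contract v (frag_of \<sigma>)))"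
      by (rule sum.cong [OF refl], rule contract_contract)
    also have "\<dots> = - contract w (bd (frag_of \<sigma>))"
      using True by (simp add: sum_negf contract_sum bd_frag_of_eq_sum_contract [of \<sigma>])
    finally show ?thesis .
  qed (simp add: contract_frag_of simplicial_boundary_def)
qed auto

text \<open>
  The vertex \<open>w\<close> is a cone point: \<open>wedge w\<close> is a chain homotopy from the identity to zero.
\<close>

lemma bd_wedge:
  assumes "finitary c"
  shows "bd (wedge w c) = c - wedge w (bd c)"
  using assms unfolding finitary_def
proof (induction c rule: frag_induction)
  case (one \<sigma>)
  then have fin: "finite \<sigma>"
    by simp
  let ?V = "insert w \<sigma>"
  have f: "finitary (frag_of \<sigma>)"
    using fin by (simp add: finitary_def)
  have "Poly_Mapping.keys (wedge w (frag_of \<sigma>)) \<subseteq> Pow ?V"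
    by (auto simp: wedge_frag_of split: if_splits)
  then have "bd (wedge w (frag_of \<sigma>)) = (\<Sum>v\<in>?V. contract v (wedge w (frag_of \<sigma>)))"
    using fin by (intro bd_eq_sum_contract) auto
  also have "\<dots> = contract w (wedge w (frag_of \<sigma>))
      + (\<Sum>v\<in>?V - {w}. contract v (wedge w (frag_of \<sigma>)))"
    using fin by (subst sum.remove [of _ w]) auto
  also have "(\<Sum>v\<in>?V - {w}. contract v (wedge w (frag_of \<sigma>)))
     = (\<Sum>v\<in>?V - {w}. - wedge w (contract v (frag_of \<sigma>)))"
    by (intro sum.cong refl) (simp add: contract_wedge)
  also have "contract w (wedge w (frag_of \<sigma>)) = frag_of \<sigma> - wedge w (contract w (frag_of \<sigma>))"
    using f by (rule contract_wedge_self)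
  also have "frag_of \<sigma> - wedge w (contract w (frag_of \<sigma>))
      + (\<Sum>v\<in>?V - {w}. - wedge w (contract v (frag_of \<sigma>)))
    = frag_of \<sigma> - (\<Sum>v\<in>?V. wedge w (contract v (frag_of \<sigma>)))"
    using fin by (subst (2) sum.remove [of _ w]) (auto simp: sum_negf)
  also have "\<dots> = frag_of \<sigma> - wedge w (bd (frag_of \<sigma>))"
    using fin by (subst bd_frag_of_eq_sum_contract [of ?V \<sigma>]) (auto simp: wedge_sum)
  finally show ?case .
qed auto

section \<open>Chains, cycles and boundaries of rook placements\<close>

text \<open>
  The subgroup generated by \<open>S\<close>, presented so that induction adds or subtracts one generator at a
  time.
\<close>

inductive_set gen :: "'a::ab_group_add set \<Rightarrow> 'a set" for S where
  gen_zero [simp]: "0 \<in> gen S"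
| gen_add_base: "x \<in> gen S \<Longrightarrow> y \<in> S \<Longrightarrow> x + y \<in> gen S"
| gen_diff_base: "x \<in> gen S \<Longrightarrow> y \<in> S \<Longrightarrow> x - y \<in> gen S"

lemma gen_base: "x \<in> S \<Longrightarrow> x \<in> gen S"
  using gen_add_base [OF gen_zero] by fastforce

lemma gen_add:
  assumes "x \<in> gen S" "y \<in> gen S"
  shows "x + y \<in> gen S"
  using assms(2,1)
proof (induction y)
  case (gen_add_base y z)
  then show ?case
    using gen.gen_add_base [of "x + y" S z] by (simp add: add.assoc)
next
  case (gen_diff_base y z)
  then show ?case
    using gen.gen_diff_base [of "x + y" S z] by (simp add: algebra_simps)
qed simp

lemma gen_diff:
  assumes "x \<in> gen S" "y \<in> gen S"
  shows "x - y \<in> gen S"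
  using assms(2,1)
proof (induction y)
  case (gen_add_base y z)
  then show ?case
    using gen.gen_diff_base [of "x - y" S z] by (simp add: algebra_simps)
next
  case (gen_diff_base y z)
  then show ?case
    using gen.gen_add_base [of "x - y" S z] by (simp add: algebra_simps)
qed simp

lemma gen_minus: "x \<in> gen S \<Longrightarrow> - x \<in> gen S"
  using gen_diff [OF gen_zero] by force

lemma gen_sum: "(\<And>i. i \<in> I \<Longrightarrow> f i \<in> gen S) \<Longrightarrow> sum f I \<in> gen S"
  by (induction I rule: infinite_finite_induct) (auto intro: gen_add)

lemma gen_induct_subgroup [consumes 1, case_names base zero add minus]:
  assumes "x \<in> gen S"
    and "\<And>x. x \<in> S \<Longrightarrow> P x" "P 0" "\<And>x y. P x \<Longrightarrow> P y \<Longrightarrow> P (x + y)" "\<And>x. P x \<Longrightarrow> P (- x)"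
  shows "P x"
  using assms(1)
proof (induction x)
  case (gen_diff_base x y)
  then show ?case
    using assms(2,4,5) by (metis add_uminus_conv_diff)
qed (use assms in auto)

lemma gen_image:
  fixes f :: "'a::ab_group_add \<Rightarrow> 'b::ab_group_add"
  assumes "x \<in> gen S" and add: "\<And>x y. f (x + y) = f x + f y"
    and base: "\<And>x. x \<in> S \<Longrightarrow> f x \<in> gen T"
  shows "f x \<in> gen T"
proof -
  have f0: "f 0 = 0"
    using add [of 0 0] by simp
  have fm: "f (- x) = - f x" for x
    using add [of x "- x"] f0 by (simp add: eq_neg_iff_add_eq_0 add.commute)
  have "f y \<in> gen T" if "y \<in> gen S" for y
    using that by (induction y rule: gen_induct_subgroup) (simp_all add: f0 fm add base gen_add gen_minus)
  then show ?thesis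
    using assms(1) .
qed

lemma gen_mono_gen:
  assumes "x \<in> gen S" "\<And>x. x \<in> S \<Longrightarrow> x \<in> gen T"
  shows "x \<in> gen T"
  using gen_image [of x S "\<lambda>x. x" T] assms by simp

text \<open>
  The position in row \<open>i\<close> and column \<open>j\<close>. The flag \<open>b\<close> transposes the board: flipping it exchanges
  the roles of rows and columns without moving any rook, so every statement about rows, proved for
  all \<open>b\<close>, is at the same time one about columns.
\<close>

definition pt :: "bool \<Rightarrow> nat \<Rightarrow> nat \<Rightarrow> nat \<times> nat"
  where "pt b i j = (if b then (j, i) else (i, j))"

lemma pt_eq_iff [simp]: "pt b i j = pt b i' j' \<longleftrightarrow> i = i' \<and> j = j'"
  by (auto simp: pt_def)

lemma pt_transpose [simp]: "pt (\<not> b) i j = pt b j i"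
  by (auto simp: pt_def)

lemma pt_cases:
  obtains i j where "v = pt b i j"
  using that [of "fst v" "snd v"] that [of "snd v" "fst v"] by (cases b) (auto simp: pt_def)

definition rooks :: "bool \<Rightarrow> nat set \<Rightarrow> nat set \<Rightarrow> nat \<Rightarrow> (nat \<times> nat) set set"
  where "rooks b A B s = {\<sigma>. finite \<sigma> \<and> card \<sigma> = s \<and> (\<forall>v\<in>\<sigma>. \<exists>i\<in>A. \<exists>j\<in>B. v = pt b i j) \<and>
    (\<forall>v\<in>\<sigma>. \<forall>w\<in>\<sigma>. v \<noteq> w \<longrightarrow> fst v \<noteq> fst w \<and> snd v \<noteq> snd w)}"

lemma rooks_iff:
  "\<sigma> \<in> rooks b A B s \<longleftrightarrow> finite \<sigma> \<and> card \<sigma> = s \<and> (\<forall>i j. pt b i j \<in> \<sigma> \<longrightarrow> i \<in> A \<and> j \<in> B) \<and>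
    (\<forall>i j i' j'. pt b i j \<in> \<sigma> \<longrightarrow> pt b i' j' \<in> \<sigma> \<longrightarrow> (i = i' \<longleftrightarrow> j = j'))"
proof (cases b)
  case True
  then show ?thesis
    by (simp add: rooks_def pt_def Ball_def split_paired_all) blast
next
  case False
  then show ?thesis
    by (simp add: rooks_def pt_def Ball_def split_paired_all) blast
qed

text \<open>
  Chains, cycles and boundaries are indexed by the number \<open>s\<close> of rooks, which is the dimension
  plus one, so that the empty placement is in degree 0. The rows \<open>A\<close> and columns \<open>B\<close> are arbitrary
  sets since the inductions delete arbitrary lines.
\<close>

definition Ch :: "bool \<Rightarrow> nat set \<Rightarrow> nat set \<Rightarrow> nat \<Rightarrow> chain set"
  where "Ch b A B s = {c. Poly_Mapping.keys c \<subseteq> rooks b A B s}"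

definition Zc :: "bool \<Rightarrow> nat set \<Rightarrow> nat set \<Rightarrow> nat \<Rightarrow> chain set"
  where "Zc b A B s = {c \<in> Ch b A B s. bd c = 0}"

definition Bd :: "bool \<Rightarrow> nat set \<Rightarrow> nat set \<Rightarrow> nat \<Rightarrow> chain set"
  where "Bd b A B s = bd ` Ch b A B (Suc s)"

lemma rooks_transpose: "rooks (\<not> b) B A s = rooks b A B s"
  unfolding rooks_def by (simp only: pt_transpose) blast

lemma Ch_transpose: "Ch (\<not> b) B A s = Ch b A B s"
  by (simp add: Ch_def rooks_transpose)

lemma Zc_transpose: "Zc (\<not> b) B A s = Zc b A B s"
  by (simp add: Zc_def Ch_transpose)

lemma Bd_transpose: "Bd (\<not> b) B A s = Bd b A B s"
  by (simp add: Bd_def Ch_transpose)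

lemma Ch_zero [simp]: "0 \<in> Ch b A B s"
  and Ch_add: "x \<in> Ch b A B s \<Longrightarrow> y \<in> Ch b A B s \<Longrightarrow> x + y \<in> Ch b A B s"
  and Ch_diff: "x \<in> Ch b A B s \<Longrightarrow> y \<in> Ch b A B s \<Longrightarrow> x - y \<in> Ch b A B s"
  and Ch_minus: "x \<in> Ch b A B s \<Longrightarrow> - x \<in> Ch b A B s"
  and Ch_cmul: "x \<in> Ch b A B s \<Longrightarrow> frag_cmul k x \<in> Ch b A B s"
  using keys_add [of x y] keys_diff [of x y] keys_cmul [of k x] by (auto simp: Ch_def)

lemma Ch_sum: "(\<And>i. i \<in> I \<Longrightarrow> f i \<in> Ch b A B s) \<Longrightarrow> sum f I \<in> Ch b A B s"
  by (induction I rule: infinite_finite_induct) (auto intro: Ch_add)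

lemma rooks_mono: "A \<subseteq> A' \<Longrightarrow> B \<subseteq> B' \<Longrightarrow> rooks b A B s \<subseteq> rooks b A' B' s"
  unfolding rooks_def by blast

lemma Ch_mono: "c \<in> Ch b A B s \<Longrightarrow> A \<subseteq> A' \<Longrightarrow> B \<subseteq> B' \<Longrightarrow> c \<in> Ch b A' B' s"
  using rooks_mono unfolding Ch_def by blast

lemma Ch_finitary: "c \<in> Ch b A B s \<Longrightarrow> finitary c"
  by (auto simp: Ch_def finitary_def rooks_def)

lemma frag_image_in_Ch:
  assumes "c \<in> Ch b A B s" "\<And>\<sigma>. \<sigma> \<in> rooks b A B s \<Longrightarrow> f (frag_of \<sigma>) \<in> Ch b A' B' s'"
    and "f 0 = 0" "\<And>x y. f (x - y) = f x - f y"
  shows "f c \<in> Ch b A' B' s'"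
proof -
  have "Poly_Mapping.keys c \<subseteq> rooks b A B s"
    using assms(1) by (simp add: Ch_def)
  then show ?thesis
    by (induction c rule: frag_induction) (auto simp: assms(2-4) intro: Ch_diff)
qed

lemma cmul_frag_of_in_Ch: "\<sigma> \<in> rooks b A B s \<Longrightarrow> frag_cmul k (frag_of \<sigma>) \<in> Ch b A B s"
  by (auto simp: Ch_def)

lemma wedge_in_Ch:
  assumes "c \<in> Ch b A B s" "i \<notin> A" "j \<notin> B"
  shows "wedge (pt b i j) c \<in> Ch b (insert i A) (insert j B) (Suc s)"
proof (rule frag_image_in_Ch [OF assms(1), where f = "wedge (pt b i j)"])
  fix \<sigma> assume s: "\<sigma> \<in> rooks b A B s"
  then have "insert (pt b i j) \<sigma> \<in> rooks b (insert i A) (insert j B) (Suc s)" if "pt b i j \<notin> \<sigma>"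
    using that assms(2,3) by (auto simp: rooks_iff)
  then show "wedge (pt b i j) (frag_of \<sigma>) \<in> Ch b (insert i A) (insert j B) (Suc s)"
    by (simp add: wedge_frag_of cmul_frag_of_in_Ch)
qed auto

lemma contract_in_Ch:
  assumes "c \<in> Ch b A B (Suc s)"
  shows "contract (pt b i j) c \<in> Ch b (A - {i}) (B - {j}) s"
proof (rule frag_image_in_Ch [OF assms(1), where f = "contract (pt b i j)"])
  fix \<sigma> assume s: "\<sigma> \<in> rooks b A B (Suc s)"
  have "\<sigma> - {pt b i j} \<in> rooks b (A - {i}) (B - {j}) s" if v: "pt b i j \<in> \<sigma>"
  proof -
    have "i = i' \<longleftrightarrow> j = j'" if "pt b i' j' \<in> \<sigma>" for i' j'
      using s v that unfolding rooks_iff by blast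
    moreover have "(\<forall>i' j'. pt b i' j' \<in> \<sigma> - {pt b i j} \<longrightarrow> i' \<in> A \<and> j' \<in> B)"
      "\<forall>i' j' i'' j''. pt b i' j' \<in> \<sigma> - {pt b i j} \<longrightarrow> pt b i'' j'' \<in> \<sigma> - {pt b i j} \<longrightarrow>
        (i' = i'' \<longleftrightarrow> j' = j'')"
      "finite (\<sigma> - {pt b i j})" "card (\<sigma> - {pt b i j}) = s"
      using s v unfolding rooks_iff by auto
    ultimately show ?thesis
      unfolding rooks_iff by (metis DiffD1 DiffD2 Diff_iff pt_eq_iff singletonD singletonI)
  qed
  then show "contract (pt b i j) (frag_of \<sigma>) \<in> Ch b (A - {i}) (B - {j}) s"
    by (simp add: contract_frag_of cmul_frag_of_in_Ch)
qed auto

lemma contract_eq_0: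
  assumes "c \<in> Ch b A B s" "i \<notin> A \<or> j \<notin> B"
  shows "contract (pt b i j) c = 0"
  unfolding contract_def using assms
  by (intro frag_extend_eq_0) (auto simp: Ch_def rooks_iff)

lemma bd_in_Ch:
  assumes "c \<in> Ch b A B (Suc s)"
  shows "bd c \<in> Ch b A B s"
proof (rule frag_image_in_Ch [OF assms(1), where f = bd])
  fix \<sigma> assume s: "\<sigma> \<in> rooks b A B (Suc s)"
  have "contract v (frag_of \<sigma>) \<in> Ch b A B s" if "v \<in> \<sigma>" for v
  proof -
    obtain i j where "v = pt b i j"
      by (rule pt_cases)
    moreover have "frag_of \<sigma> \<in> Ch b A B (Suc s)"
      using s by (simp add: Ch_def)
    ultimately show ?thesis
      using contract_in_Ch Ch_mono by (metis Diff_subset)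
  qed
  then show "bd (frag_of \<sigma>) \<in> Ch b A B s"
    using s by (auto simp: bd_frag_of_eq_sum_contract [of \<sigma>] rooks_def intro: Ch_sum)
qed auto

lemma rooks_0: "rooks b A B 0 = {{}}"
  by (auto simp: rooks_def)

lemma Ch_0E:
  assumes "c \<in> Ch b A B 0"
  obtains k where "c = frag_cmul k (frag_of {})"
proof -
  have "Poly_Mapping.keys c \<subseteq> {{}}"
    using assms by (simp add: Ch_def rooks_0)
  then have "\<exists>k. c = frag_cmul k (frag_of {})"
  proof (induction c rule: frag_induction)
    case zero
    then show ?case
      by (metis frag_cmul_zero)
  next
    case (one \<sigma>)
    then show ?case
      by (metis frag_cmul_one singletonD)
  next
    case (diff a b)
    then show ?case
      by (metis frag_cmul_diff_distrib)
  qed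
  with that show ?thesis
    by blast
qed

lemma unit_in_Ch [simp]: "frag_of {} \<in> Ch b A B 0"
  by (simp add: Ch_def rooks_0)

lemma bd_unit [simp]: "bd (frag_of {}) = 0"
  by (simp add: simplicial_boundary_def)

lemma contract_Ch_0:
  assumes "c \<in> Ch b A B 0"
  shows "contract v c = 0"
  unfolding contract_def using assms
  by (intro frag_extend_eq_0) (auto simp: Ch_def rooks_0)

lemma bd_bd:
  assumes "finitary c"
  shows "bd (bd c) = 0"
  using assms unfolding finitary_def
proof (induction c rule: frag_induction)
  case (one \<sigma>)
  then have fin: "finite \<sigma>"
    by simp
  have "Poly_Mapping.keys (bd (frag_of \<sigma>)) \<subseteq> Pow \<sigma>"
  proof -
    have "Poly_Mapping.keys (bd (frag_of \<sigma>)) \<subseteq> (\<Union>v\<in>\<sigma>. Poly_Mapping.keys (contract v (frag_of \<sigma>)))"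
      using fin by (simp add: bd_frag_of_eq_sum_contract [of \<sigma>] keys_sum)
    also have "\<dots> \<subseteq> Pow \<sigma>"
      by (auto simp: contract_frag_of split: if_splits)
    finally show ?thesis .
  qed
  then have "bd (bd (frag_of \<sigma>)) = (\<Sum>v\<in>\<sigma>. contract v (bd (frag_of \<sigma>)))"
    using fin by (intro bd_eq_sum_contract) auto
  also have "\<dots> = - bd (\<Sum>v\<in>\<sigma>. contract v (frag_of \<sigma>))"
    by (simp add: bd_sum bd_contract sum_negf)
  also have "\<dots> = - bd (bd (frag_of \<sigma>))"
    using fin by (simp add: bd_frag_of_eq_sum_contract [of \<sigma>])
  finally have "bd (bd (frag_of \<sigma>)) + bd (bd (frag_of \<sigma>)) = 0"
    by (metis add.left_inverse)
  then have "frag_cmul 2 (bd (bd (frag_of \<sigma>))) = 0"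
    using frag_cmul_distrib [of 1 1 "bd (bd (frag_of \<sigma>))"] by simp
  then show ?case
    by simp
qed auto

lemma wedge_contract:
  assumes "finitary c" "contract v c = 0"
  shows "contract v (wedge v c) = c"
  using assms by (simp add: contract_wedge_self)

lemma keys_contract: "\<sigma> \<in> Poly_Mapping.keys (contract v c) \<Longrightarrow> v \<notin> \<sigma>"
  using keys_frag_extend [of _ c] unfolding contract_def by (fastforce split: if_splits)

lemma Ch_delete_column:
  assumes "c \<in> Ch b A B s" "\<And>i. i \<in> A \<Longrightarrow> contract (pt b i j) c = 0"
  shows "c \<in> Ch b A (B - {j}) s"
proof -
  have "pt b i j \<notin> \<sigma>" if i: "i \<in> A" and \<sigma>: "\<sigma> \<in> Poly_Mapping.keys c" for i \<sigma>
  proof -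
    have "c = contract (pt b i j) (wedge (pt b i j) c)"
      using wedge_contract [OF Ch_finitary [OF assms(1)] assms(2)] i by simp
    then show ?thesis
      using keys_contract \<sigma> by metis
  qed
  then show ?thesis
    using assms(1) unfolding Ch_def rooks_iff mem_Collect_eq subset_iff by (metis Diff_iff singletonD)
qed

lemma Ch_delete_row:
  assumes "c \<in> Ch b A B s" "\<And>j. j \<in> B \<Longrightarrow> contract (pt b i j) c = 0"
  shows "c \<in> Ch b (A - {i}) B s"
  using Ch_delete_column [of c "\<not> b" B A s i] assms by (simp add: Ch_transpose)

lemma contract_contract_row:
  assumes "c \<in> Ch b A B s"
  shows "contract (pt b i j) (contract (pt b i k) c) = 0"
proof (cases s)
  case 0
  then have "contract (pt b i k) c = 0"
    unfolding contract_def using assms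
    by (intro frag_extend_eq_0) (auto simp: Ch_def rooks_def)
  then show ?thesis
    by simp
next
  case (Suc s')
  then show ?thesis
    using contract_in_Ch [of c b A B s' i k] contract_eq_0 assms by blast
qed

lemma contract_wedge_pt:
  assumes "(i, j) \<noteq> (i', j')"
  shows "contract (pt b i j) (wedge (pt b i' j') c) = - wedge (pt b i' j') (contract (pt b i j) c)"
  using assms by (intro contract_wedge) auto

text \<open>
  The subtracted sum consists of the placements with a rook in row \<open>i\<close>, sorted by its column.
\<close>

lemma row_expansion:
  assumes "c \<in> Ch b A B s" "finite B"
  shows "c - (\<Sum>j\<in>B. wedge (pt b i j) (contract (pt b i j) c)) \<in> Ch b (A - {i}) B s"
proof (rule Ch_delete_row)
  have "wedge (pt b i j) (contract (pt b i j) c) \<in> Ch b A B s" if "j \<in> B" for j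
  proof (cases "i \<in> A \<and> s > 0")
    case True
    then obtain s' where s: "s = Suc s'"
      by (cases s) auto
    have "wedge (pt b i j) (contract (pt b i j) c) \<in> Ch b (insert i (A - {i})) (insert j (B - {j})) (Suc s')"
      using assms s by (intro wedge_in_Ch contract_in_Ch) auto
    then show ?thesis
      using True that s by (simp add: insert_absorb)
  next
    case False
    then have "contract (pt b i j) c = 0"
      using assms contract_eq_0 contract_Ch_0 that by (cases "s = 0") blast+
    then show ?thesis
      by simp
  qed
  then show "c - (\<Sum>j\<in>B. wedge (pt b i j) (contract (pt b i j) c)) \<in> Ch b A B s"
    using assms by (intro Ch_diff Ch_sum) auto
next
  fix k assume k: "k \<in> B"
  have cc: "finitary (contract (pt b i k) c)"
  proof (cases s)
    case 0
    then have "contract (pt b i k) c = 0"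
      using assms contract_Ch_0 by blast
    then show ?thesis
      by (simp add: finitary_def)
  next
    case (Suc s')
    then show ?thesis
      using contract_in_Ch assms Ch_finitary by blast
  qed
  have "contract (pt b i k) (wedge (pt b i j) (contract (pt b i j) c))
    = (if j = k then contract (pt b i k) c else 0)" for j
    using contract_contract_row [OF assms(1)] cc
    by (auto simp: contract_wedge_pt contract_wedge_self)
  then show "contract (pt b i k) (c - (\<Sum>j\<in>B. wedge (pt b i j) (contract (pt b i j) c))) = 0"
    using k assms(2) by (simp add: contract_sum)
qed

lemma Ch_eq_0_if_few_rows:
  assumes "c \<in> Ch b A B s" "finite A" "card A < s"
  shows "c = 0"
proof -
  have False if \<sigma>: "\<sigma> \<in> rooks b A B s" for \<sigma>
  proof -
    have "inj_on (\<lambda>v. if b then snd v else fst v) \<sigma>"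
      using \<sigma> unfolding inj_on_def rooks_def by auto
    moreover have "(\<lambda>v. if b then snd v else fst v) ` \<sigma> \<subseteq> A"
      using \<sigma> by (auto simp: rooks_def pt_def split: if_splits)
    ultimately have "card \<sigma> \<le> card A"
      using assms(2) card_inj_on_le by blast
    then show False
      using \<sigma> assms(3) by (simp add: rooks_def)
  qed
  then have "Poly_Mapping.keys c \<subseteq> {}"
    using assms(1) unfolding Ch_def by blast
  then show ?thesis
    by simp
qed

lemma Zc_Ch: "z \<in> Zc b A B s \<Longrightarrow> z \<in> Ch b A B s"
  and Zc_bd: "z \<in> Zc b A B s \<Longrightarrow> bd z = 0"
  and Zc_finitary: "z \<in> Zc b A B s \<Longrightarrow> finitary z"
  by (auto simp: Zc_def intro: Ch_finitary)

lemma Zc_zero [simp]: "0 \<in> Zc b A B s"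
  and Zc_add: "x \<in> Zc b A B s \<Longrightarrow> y \<in> Zc b A B s \<Longrightarrow> x + y \<in> Zc b A B s"
  and Zc_diff: "x \<in> Zc b A B s \<Longrightarrow> y \<in> Zc b A B s \<Longrightarrow> x - y \<in> Zc b A B s"
  and Zc_minus: "x \<in> Zc b A B s \<Longrightarrow> - x \<in> Zc b A B s"
  and Zc_cmul: "x \<in> Zc b A B s \<Longrightarrow> frag_cmul k x \<in> Zc b A B s"
  by (auto simp: Zc_def intro: Ch_add Ch_diff Ch_minus Ch_cmul)

lemma Zc_sum: "(\<And>i. i \<in> I \<Longrightarrow> f i \<in> Zc b A B s) \<Longrightarrow> sum f I \<in> Zc b A B s"
  by (induction I rule: infinite_finite_induct) (auto intro: Zc_add)

lemma gen_subset_Zc: "x \<in> gen S \<Longrightarrow> S \<subseteq> Zc b A B s \<Longrightarrow> x \<in> Zc b A B s"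
  by (induction x rule: gen_induct_subgroup) (auto intro: Zc_add Zc_minus)

lemma Zc_mono: "z \<in> Zc b A B s \<Longrightarrow> A \<subseteq> A' \<Longrightarrow> B \<subseteq> B' \<Longrightarrow> z \<in> Zc b A' B' s"
  by (auto simp: Zc_def intro: Ch_mono)

lemma Bd_mono: "z \<in> Bd b A B s \<Longrightarrow> A \<subseteq> A' \<Longrightarrow> B \<subseteq> B' \<Longrightarrow> z \<in> Bd b A' B' s"
  unfolding Bd_def using Ch_mono by blast

lemma contract_in_Zc:
  "z \<in> Zc b A B (Suc s) \<Longrightarrow> contract (pt b i j) z \<in> Zc b (A - {i}) (B - {j}) s"
  by (auto simp: Zc_def bd_contract intro: contract_in_Ch)

lemma Bd_subset_Zc: "z \<in> Bd b A B s \<Longrightarrow> z \<in> Zc b A B s"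
  unfolding Bd_def Zc_def using bd_in_Ch bd_bd Ch_finitary by blast

lemma Bd_zero [simp]: "0 \<in> Bd b A B s"
  unfolding Bd_def by (rule image_eqI [of _ _ 0]) auto

lemma Bd_add: "x \<in> Bd b A B s \<Longrightarrow> y \<in> Bd b A B s \<Longrightarrow> x + y \<in> Bd b A B s"
  unfolding Bd_def by (auto simp del: bd_linear simp flip: bd_linear(2) intro!: imageI Ch_add)

lemma Bd_minus: "x \<in> Bd b A B s \<Longrightarrow> - x \<in> Bd b A B s"
  unfolding Bd_def by (auto simp del: bd_linear simp flip: bd_linear(4) intro!: imageI Ch_minus)

lemma Bd_diff: "x \<in> Bd b A B s \<Longrightarrow> y \<in> Bd b A B s \<Longrightarrow> x - y \<in> Bd b A B s"
  using Bd_add [of x b A B s "- y"] Bd_minus by fastforce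

lemma Bd_cmul: "x \<in> Bd b A B s \<Longrightarrow> frag_cmul k x \<in> Bd b A B s"
  unfolding Bd_def by (auto simp del: bd_linear simp flip: bd_linear(5) intro!: imageI Ch_cmul)

lemma gen_subset_Bd: "x \<in> gen S \<Longrightarrow> S \<subseteq> Bd b A B s \<Longrightarrow> x \<in> Bd b A B s"
  by (induction x rule: gen_induct_subgroup) (auto intro: Bd_add Bd_minus)

lemma BdI: "c \<in> Ch b A B (Suc s) \<Longrightarrow> bd c \<in> Bd b A B s"
  by (simp add: Bd_def)

lemma frag_cmul_diff_distrib2: "frag_cmul k (a - b) = frag_cmul k a - frag_cmul k b"
  using frag_cmul_distrib2 [of k a "- b"] by (metis add_uminus_conv_diff frag_cmul_cmul frag_cmul_minus_one minus_frag_cmul mult.commute)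

lemma frag_cmul_minus: "frag_cmul k (- x) = - frag_cmul k x"
  using frag_cmul_diff_distrib2 [of k 0 x] by simp

text \<open>
  The join with the 0-sphere formed by the positions \<open>j\<close> and \<open>k\<close> in row \<open>i\<close>. The join with two
  positions \<open>i\<close> and \<open>i'\<close> in column \<open>j\<close> is \<open>pair (\<not> b) j i i'\<close>.
\<close>

definition pair :: "bool \<Rightarrow> nat \<Rightarrow> nat \<Rightarrow> nat \<Rightarrow> chain \<Rightarrow> chain"
  where "pair b i j k x = wedge (pt b i j) x - wedge (pt b i k) x"

lemma pair_linear [simp]:
  "pair b i j k 0 = 0" "pair b i j k (x + y) = pair b i j k x + pair b i j k y"
  "pair b i j k (x - y) = pair b i j k x - pair b i j k y"
  "pair b i j k (- x) = - pair b i j k x"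
  "pair b i j k (frag_cmul n x) = frag_cmul n (pair b i j k x)"
  by (simp_all add: pair_def frag_cmul_diff_distrib2)

lemma pair_swap: "pair b i j k x = - pair b i k j x"
  by (simp add: pair_def)

lemma wedge_pair: "wedge v (pair b i j k x) = - pair b i j k (wedge v x)"
  by (simp add: pair_def wedge_wedge [of v])

text \<open>
  A 0-sphere is an element of degree one, so two joins anticommute. This is used constantly to
  bring a particular sphere to the front.
\<close>

lemma pair_pair: "pair b i j k (pair b' i' j' k' x) = - pair b' i' j' k' (pair b i j k x)"
  by (simp add: pair_def [of b i] wedge_pair)

lemma bd_pair: "finitary x \<Longrightarrow> bd (pair b i j k x) = - pair b i j k (bd x)"
  by (simp add: pair_def bd_wedge)

lemma finitary_wedge: "finitary c \<Longrightarrow> finitary (wedge v c)"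
proof -
  show ?thesis
    unfolding finitary_def wedge_def by (rule order_trans [OF keys_frag_extend]) (auto split: if_splits)
qed

lemma finitary_add: "finitary x \<Longrightarrow> finitary y \<Longrightarrow> finitary (x + y)"
  using keys_add [of x y] unfolding finitary_def by blast

lemma finitary_pair: "finitary c \<Longrightarrow> finitary (pair b i j k c)"
  using finitary_wedge [of c] keys_diff [of "wedge (pt b i j) c" "wedge (pt b i k) c"]
  unfolding pair_def finitary_def by blast

lemma pair_in_Ch:
  assumes "x \<in> Ch b A B s" "i \<notin> A" "j \<notin> B" "k \<notin> B"
  shows "pair b i j k x \<in> Ch b (insert i A) (insert j (insert k B)) (Suc s)"
  unfolding pair_def using assms wedge_in_Ch
  by (intro Ch_diff) (blast intro: Ch_mono)+

lemma pair_in_Zc: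
  assumes "x \<in> Zc b A B s" "i \<notin> A" "j \<notin> B" "k \<notin> B"
  shows "pair b i j k x \<in> Zc b (insert i A) (insert j (insert k B)) (Suc s)"
  using assms by (auto simp: Zc_def bd_pair Ch_finitary intro: pair_in_Ch)

lemma pair_in_Bd:
  assumes "x \<in> Bd b A B s" "i \<notin> A" "j \<notin> B" "k \<notin> B"
  shows "pair b i j k x \<in> Bd b (insert i A) (insert j (insert k B)) (Suc s)"
proof -
  obtain c where c: "c \<in> Ch b A B (Suc s)" "x = bd c"
    using assms(1) by (auto simp: Bd_def)
  then have "pair b i j k x = bd (- pair b i j k c)"
    by (simp add: bd_pair Ch_finitary)
  then show ?thesis
    using BdI [OF Ch_minus [OF pair_in_Ch [OF c(1) assms(2-4)]]] by simp
qed

section \<open>Joins of 0-spheres and their signs\<close>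

text \<open>
  The sign that sorts \<open>i\<close> into the list of the elements of \<open>A\<close>: lines are treated as odd
  generators of an exterior algebra, just as the vertices in \<open>insertion_sign\<close>.
\<close>

definition psign :: "nat \<Rightarrow> nat set \<Rightarrow> int"
  where "psign i A = (-1) ^ card {a \<in> A. a < i}"

lemma psign_insert:
  assumes "finite A" "k \<notin> A"
  shows "psign i (insert k A) = (if k < i then - 1 else 1) * psign i A"
proof -
  have "{a \<in> insert k A. a < i} = (if k < i then insert k {a \<in> A. a < i} else {a \<in> A. a < i})"
    by auto
  then show ?thesis
    using assms by (simp add: psign_def)
qed

lemma psign_swap:
  assumes "finite A" "j \<notin> A" "k \<notin> A" "j \<noteq> k"
  shows "psign j (insert k A) * psign k A = - (psign k (insert j A) * psign j A)"
  using assms by (auto simp: psign_insert)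

lemma psign_square [simp]: "psign i A * psign i A = 1"
  by (simp add: psign_def flip: power_add mult_2)

definition psign2 :: "nat \<Rightarrow> nat \<Rightarrow> nat set \<Rightarrow> int"
  where "psign2 j k A = psign j (insert k A) * psign k A"

lemma psign2_swap:
  "finite A \<Longrightarrow> j \<notin> A \<Longrightarrow> k \<notin> A \<Longrightarrow> j \<noteq> k \<Longrightarrow> psign2 j k A = - psign2 k j A"
  unfolding psign2_def by (rule psign_swap)

lemma psign_psign2:
  assumes "finite A" "i \<notin> A" "j \<notin> A" "k \<notin> A" "i \<noteq> j" "i \<noteq> k" "j \<noteq> k"
  shows "psign i (insert j (insert k A)) * psign2 j k A = psign2 j k (insert i A) * psign i A"
proof -
  have 1: "psign i (insert j (insert k A)) * psign j (insert k A)
      = - (psign j (insert i (insert k A)) * psign i (insert k A))"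
    using assms by (intro psign_swap) auto
  have 2: "psign i (insert k A) * psign k A = - (psign k (insert i A) * psign i A)"
    using assms by (intro psign_swap) auto
  have "psign i (insert j (insert k A)) * psign2 j k A
      = (psign i (insert j (insert k A)) * psign j (insert k A)) * psign k A"
    by (simp add: psign2_def)
  also have "\<dots> = - (psign j (insert i (insert k A)) * (psign i (insert k A) * psign k A))"
    unfolding 1 by simp
  also have "\<dots> = psign j (insert i (insert k A)) * psign k (insert i A) * psign i A"
    unfolding 2 by simp
  finally show ?thesis
    by (simp add: psign2_def insert_commute)
qed

lemma psign2_psign2:
  assumes "finite A" "i \<notin> A" "i' \<notin> A" "j \<notin> A" "k \<notin> A" "distinct [i, i', j, k]"
  shows "psign2 i i' (insert j (insert k A)) * psign2 j k A
    = psign2 j k (insert i (insert i' A)) * psign2 i i' A"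
proof -
  have "psign2 i i' (insert j (insert k A)) * psign2 j k A
      = psign i (insert i' (insert j (insert k A))) * (psign i' (insert j (insert k A)) * psign2 j k A)"
    by (simp add: psign2_def)
  also have "\<dots> = psign i (insert j (insert k (insert i' A))) * psign2 j k (insert i' A) * psign i' A"
    using assms by (subst psign_psign2) (auto simp: insert_commute)
  also have "\<dots> = psign2 j k (insert i (insert i' A)) * (psign i (insert i' A) * psign i' A)"
    using assms by (subst psign_psign2) auto
  finally show ?thesis
    by (simp add: psign2_def)
qed

text \<open>
  The cycle \<open>x\<close> is a join of \<open>p\<close> row spheres and \<open>q\<close> column spheres which uses every line of the
  board once. Its sign \<open>v\<close> compares the order in which the spheres occupy rows and columns with
  the natural orders of \<open>A\<close> and \<open>B\<close>. It must not depend on the order of the spheres beyond the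
  sign of \<open>x\<close> itself. Two row spheres anticommute as they should: they exchange one row each, and
  two columns each. A row sphere and a column sphere would commute, since one row moves past two
  rows and two columns past one; the factor \<open>(-1)^q\<close> corrects this.
\<close>

inductive ssph :: "bool \<Rightarrow> nat \<Rightarrow> nat \<Rightarrow> nat set \<Rightarrow> nat set \<Rightarrow> chain \<Rightarrow> int \<Rightarrow> bool" for b where
  unit: "ssph b 0 0 {} {} (frag_of {}) 1"
| row: "ssph b p q A B x v \<Longrightarrow> i \<notin> A \<Longrightarrow> j \<notin> B \<Longrightarrow> k \<notin> B \<Longrightarrow> j \<noteq> k \<Longrightarrow>
    ssph b (Suc p) q (insert i A) (insert j (insert k B)) (pair b i j k x)
      (psign i A * psign2 j k B * (-1) ^ q * v)"
| col: "ssph b p q A B x v \<Longrightarrow> j \<notin> B \<Longrightarrow> i \<notin> A \<Longrightarrow> i' \<notin> A \<Longrightarrow> i \<noteq> i' \<Longrightarrow>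
    ssph b p (Suc q) (insert i (insert i' A)) (insert j B) (pair (\<not> b) j i i' x)
      (psign j B * psign2 i i' A * v)"
| neg: "ssph b p q A B x v \<Longrightarrow> ssph b p q A B (- x) (- v)"

lemma ssph_card:
  assumes "ssph b p q A B x v"
  shows "finite A" "finite B" "card A = p + 2 * q" "card B = 2 * p + q"
  using assms by (induction) auto

lemma ssph_Zc:
  assumes "ssph b p q A B x v"
  shows "x \<in> Zc b A B (p + q)"
  using assms
proof induction
  case unit
  then show ?case
    by (simp add: Zc_def)
next
  case (row p q A B x v i j k)
  then show ?case
    using pair_in_Zc by simp
next
  case (col p q A B x v j i i')
  then show ?case
    using pair_in_Zc [of x "\<not> b" B A "p + q" j i i'] Zc_transpose [of b] by simp
next
  case (neg p q A B x v)
  then show ?case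
    by (auto intro: Zc_minus)
qed

lemma ssph_transpose:
  assumes "ssph b p q A B x v"
  shows "ssph (\<not> b) q p B A x ((-1) ^ (p * q) * v)"
  using assms
proof induction
  case (row p q A B x v i j k)
  from ssph.col [OF row.IH row.hyps(2-5)] show ?case
    by (simp add: power_add mult_ac)
next
  case (col p q A B x v j i i')
  from ssph.row [OF col.IH col.hyps(2-5)] show ?case
    by (simp add: power_add mult_ac)
next
  case (neg p q A B x v)
  from ssph.neg [OF neg.IH] show ?case
    by simp
qed (use ssph.unit in auto)

text \<open>
  Row \<open>i\<close> carries one of the spheres of the join \<open>x\<close>, and this sphere can be written as the
  outermost factor.
\<close>

definition row_factor :: "bool \<Rightarrow> nat \<Rightarrow> nat \<Rightarrow> nat set \<Rightarrow> nat set \<Rightarrow> chain \<Rightarrow> int \<Rightarrow> nat \<Rightarrow> nat \<Rightarrow> nat \<Rightarrow> bool"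
  where "row_factor b p q A B x v i j k \<longleftrightarrow> i \<in> A \<and> j \<in> B \<and> k \<in> B \<and> j \<noteq> k \<and>
    (\<exists>p' x0 v0. p = Suc p' \<and> ssph b p' q (A - {i}) (B - {j, k}) x0 v0 \<and> x = pair b i j k x0 \<and>
      v = psign i (A - {i}) * psign2 j k (B - {j, k}) * (-1) ^ q * v0)"

lemma row_factorE:
  assumes "row_factor b p q A B x v i j k"
  obtains p' A0 B0 x0 v0 where "p = Suc p'" "A = insert i A0" "B = insert j (insert k B0)"
    "i \<notin> A0" "j \<notin> B0" "k \<notin> B0" "j \<noteq> k" "ssph b p' q A0 B0 x0 v0" "x = pair b i j k x0"
    "v = psign i A0 * psign2 j k B0 * (-1) ^ q * v0"
proof -
  have "A = insert i (A - {i})" "B = insert j (insert k (B - {j, k}))" "j \<noteq> k"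
    using assms unfolding row_factor_def by auto
  with that [of _ "A - {i}" "B - {j, k}"] show ?thesis
    using assms unfolding row_factor_def by blast
qed

lemma row_factorI:
  assumes "p = Suc p'" "A = insert i A0" "B = insert j (insert k B0)"
    "i \<notin> A0" "j \<notin> B0" "k \<notin> B0" "j \<noteq> k" "ssph b p' q A0 B0 x0 v0" "x = pair b i j k x0"
    "v = psign i A0 * psign2 j k B0 * (-1) ^ q * v0"
  shows "row_factor b p q A B x v i j k"
proof -
  have "A - {i} = A0" "B - {j, k} = B0"
    using assms by auto
  then show ?thesis
    unfolding row_factor_def using assms by (intro conjI exI [of _ p'] exI [of _ x0] exI [of _ v0]) simp_all
qed

text \<open>
  An inner factor stays a factor when another sphere is joined from outside, because the two
  spheres anticommute, as do the corresponding signs.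
\<close>

lemma row_factor_row:
  assumes "row_factor b p q A B x v i j k" "i' \<notin> A" "j' \<notin> B" "k' \<notin> B" "j' \<noteq> k'"
  shows "row_factor b (Suc p) q (insert i' A) (insert j' (insert k' B)) (pair b i' j' k' x)
      (psign i' A * psign2 j' k' B * (-1) ^ q * v) i j k"
  using assms(1)
proof (rule row_factorE)
  fix p' A0 B0 x0 v0
  assume p: "p = Suc p'" and A: "A = insert i A0" and B: "B = insert j (insert k B0)"
    and new: "i \<notin> A0" "j \<notin> B0" "k \<notin> B0" "j \<noteq> k" and s: "ssph b p' q A0 B0 x0 v0"
    and x: "x = pair b i j k x0" and v: "v = psign i A0 * psign2 j k B0 * (-1) ^ q * v0"
  have new': "i' \<notin> A0" "j' \<notin> B0" "k' \<notin> B0" "i \<noteq> i'" "j \<noteq> j'" "j \<noteq> k'" "k \<noteq> j'" "k \<noteq> k'"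
    using assms A B by auto
  note fin = ssph_card(1,2) [OF s]
  \<comment> \<open>the new remainder: the other factors, with the sign from anticommuting\<close>
  let ?x = "- pair b i' j' k' x0" and ?v = "- (psign i' A0 * psign2 j' k' B0 * (-1) ^ q * v0)"
  have s': "ssph b p q (insert i' A0) (insert j' (insert k' B0)) ?x ?v"
    unfolding p using s new' assms by (intro ssph.neg ssph.row) auto
  have e1: "psign i' (insert i A0) * psign i A0 = - (psign i (insert i' A0) * psign i' A0)"
    using new new' fin by (intro psign_swap) auto
  have e2: "psign2 j' k' (insert j (insert k B0)) * psign2 j k B0
    = psign2 j k (insert j' (insert k' B0)) * psign2 j' k' B0"
    using new new' fin assms by (intro psign2_psign2) auto
  have "psign i' A * psign2 j' k' B * (-1) ^ q * v
      = (psign i' (insert i A0) * psign i A0) * (psign2 j' k' (insert j (insert k B0)) * psign2 j k B0)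
        * (-1) ^ q * (-1) ^ q * v0"
    by (simp add: v A B mult_ac)
  also have "\<dots> = psign i (insert i' A0) * psign2 j k (insert j' (insert k' B0)) * (-1) ^ q * ?v"
    unfolding e1 e2 by (simp add: mult_ac)
  finally have v': "psign i' A * psign2 j' k' B * (-1) ^ q * v = \<dots>" .
  show ?thesis
  proof (rule row_factorI [OF refl _ _ _ _ _ new(4) s' _ v'])
    show "pair b i' j' k' x = pair b i j k ?x"
      unfolding x by (subst pair_pair) simp
  qed (use A B new new' in auto)
qed

lemma row_factor_col:
  assumes "row_factor b p q A B x v i j k" "l \<notin> A" "l' \<notin> A" "j' \<notin> B" "l \<noteq> l'"
  shows "row_factor b p (Suc q) (insert l (insert l' A)) (insert j' B) (pair (\<not> b) j' l l' x)
      (psign j' B * psign2 l l' A * v) i j k"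
  using assms(1)
proof (rule row_factorE)
  fix p' A0 B0 x0 v0
  assume p: "p = Suc p'" and A: "A = insert i A0" and B: "B = insert j (insert k B0)"
    and new: "i \<notin> A0" "j \<notin> B0" "k \<notin> B0" "j \<noteq> k" and s: "ssph b p' q A0 B0 x0 v0"
    and x: "x = pair b i j k x0" and v: "v = psign i A0 * psign2 j k B0 * (-1) ^ q * v0"
  have new': "l \<notin> A0" "l' \<notin> A0" "j' \<notin> B0" "i \<noteq> l" "i \<noteq> l'" "j \<noteq> j'" "k \<noteq> j'"
    using assms A B by auto
  note fin = ssph_card(1,2) [OF s]
  let ?x = "- pair (\<not> b) j' l l' x0" and ?v = "- (psign j' B0 * psign2 l l' A0 * v0)"
  have s': "ssph b p' (Suc q) (insert l (insert l' A0)) (insert j' B0) ?x ?v"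
    using s new' assms by (intro ssph.neg ssph.col) auto
  have e1: "psign i (insert l (insert l' A0)) * psign2 l l' A0 = psign2 l l' (insert i A0) * psign i A0"
    using new new' fin assms by (intro psign_psign2) auto
  have e2: "psign j' (insert j (insert k B0)) * psign2 j k B0
    = psign2 j k (insert j' B0) * psign j' B0"
    using new new' fin assms by (intro psign_psign2) auto
  have "psign j' B * psign2 l l' A * v
      = (psign2 l l' (insert i A0) * psign i A0) * (psign j' (insert j (insert k B0)) * psign2 j k B0)
        * (-1) ^ q * v0"
    by (simp add: v A B mult_ac)
  also have "\<dots> = psign i (insert l (insert l' A0)) * psign2 j k (insert j' B0) * (-1) ^ Suc q * ?v"
    unfolding e1 [symmetric] e2 by (simp add: mult_ac)
  finally have v': "psign j' B * psign2 l l' A * v = \<dots>" .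
  show ?thesis
  proof (rule row_factorI [OF p _ _ _ _ _ new(4) s' _ v'])
    show "pair (\<not> b) j' l l' x = pair b i j k ?x"
      unfolding x by (subst pair_pair) simp
  qed (use A B new new' in auto)
qed

lemma row_factor_neg:
  assumes "row_factor b p q A B x v i j k"
  shows "row_factor b p q A B (- x) (- v) i j k"
  using assms
proof (rule row_factorE)
  fix p' A0 B0 x0 v0
  assume *: "p = Suc p'" "A = insert i A0" "B = insert j (insert k B0)" "i \<notin> A0" "j \<notin> B0" "k \<notin> B0" "j \<noteq> k"
    and s: "ssph b p' q A0 B0 x0 v0"
    and x: "x = pair b i j k x0" and v: "v = psign i A0 * psign2 j k B0 * (-1) ^ q * v0"
  show ?thesis
    by (rule row_factorI [OF * ssph.neg [OF s]]) (simp_all add: x v)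
qed

lemma row_factor_swap:
  assumes "row_factor b p q A B x v i j k"
  shows "row_factor b p q A B x v i k j"
  using assms
proof (rule row_factorE)
  fix p' A0 B0 x0 v0
  assume *: "p = Suc p'" "A = insert i A0" "B = insert j (insert k B0)" "i \<notin> A0" "j \<notin> B0" "k \<notin> B0" "j \<noteq> k"
    and s: "ssph b p' q A0 B0 x0 v0"
    and x: "x = pair b i j k x0" and v: "v = psign i A0 * psign2 j k B0 * (-1) ^ q * v0"
  have "psign2 j k B0 = - psign2 k j B0"
    using * ssph_card(2) [OF s] by (intro psign2_swap) auto
  then show ?thesis
    using * by (intro row_factorI [OF *(1,2) _ *(4) _ _ _ ssph.neg [OF s]])
      (auto simp: x v pair_swap [of b i j k])
qed

text \<open>
  The sign of the transposed join differs by \<open>(-1)^(p q)\<close>, see \<open>ssph_transpose\<close>.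
\<close>

definition col_factor :: "bool \<Rightarrow> nat \<Rightarrow> nat \<Rightarrow> nat set \<Rightarrow> nat set \<Rightarrow> chain \<Rightarrow> int \<Rightarrow> nat \<Rightarrow> nat \<Rightarrow> nat \<Rightarrow> bool"
  where "col_factor b p q A B x v j i i' = row_factor (\<not> b) q p B A x ((-1) ^ (p * q) * v) j i i'"

lemma col_factor_row:
  assumes "col_factor b p q A B x v j i i'" "l \<notin> A" "j' \<notin> B" "k' \<notin> B" "j' \<noteq> k'"
  shows "col_factor b (Suc p) q (insert l A) (insert j' (insert k' B)) (pair b l j' k' x)
      (psign l A * psign2 j' k' B * (-1) ^ q * v) j i i'"
  using row_factor_col [OF assms(1) [unfolded col_factor_def] assms(3,4,2,5)]
  unfolding col_factor_def by (simp add: power_add mult_ac)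

lemma col_factor_col:
  assumes "col_factor b p q A B x v j i i'" "l \<notin> A" "l' \<notin> A" "j' \<notin> B" "l \<noteq> l'"
  shows "col_factor b p (Suc q) (insert l (insert l' A)) (insert j' B) (pair (\<not> b) j' l l' x)
      (psign j' B * psign2 l l' A * v) j i i'"
  using row_factor_row [OF assms(1) [unfolded col_factor_def] assms(4,2,3,5)]
  unfolding col_factor_def by (simp add: power_add mult_ac)

lemma col_factor_neg:
  "col_factor b p q A B x v j i i' \<Longrightarrow> col_factor b p q A B (- x) (- v) j i i'"
  unfolding col_factor_def using row_factor_neg by fastforce

lemma col_factor_swap:
  "col_factor b p q A B x v j i i' \<Longrightarrow> col_factor b p q A B x v j i' i"
  unfolding col_factor_def using row_factor_swap by blast

lemma row_factor_outer:
  assumes "ssph b p q A B x v" "i \<notin> A" "j \<notin> B" "k \<notin> B" "j \<noteq> k"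
  shows "row_factor b (Suc p) q (insert i A) (insert j (insert k B)) (pair b i j k x)
      (psign i A * psign2 j k B * (-1) ^ q * v) i j k"
  using assms by (intro row_factorI) auto

lemma col_factor_outer:
  assumes "ssph b p q A B x v" "j \<notin> B" "i \<notin> A" "i' \<notin> A" "i \<noteq> i'"
  shows "col_factor b p (Suc q) (insert i (insert i' A)) (insert j B) (pair (\<not> b) j i i' x)
      (psign j B * psign2 i i' A * v) j i i'"
  using row_factor_outer [OF ssph_transpose [OF assms(1)] assms(2-5)]
  unfolding col_factor_def by (simp add: power_add mult_ac)

text \<open>
  Every row of the board is used by exactly one sphere, and any sphere can be pulled to the front.
\<close>

lemma ssph_row_cases:
  assumes "ssph b p q A B x v" "i \<in> A"
  shows "(\<exists>j k. row_factor b p q A B x v i j k) \<or> (\<exists>j i'. col_factor b p q A B x v j i i')"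
  using assms
proof induction
  case (row p q A B x v i' j k)
  show ?case
  proof (cases "i = i'")
    case True
    then show ?thesis
      using row_factor_outer [OF row.hyps] by blast
  next
    case False
    then show ?thesis
      using row row_factor_row col_factor_row by (metis insertE)
  qed
next
  case (col p q A B x v j l l')
  show ?case
  proof (cases "i = l \<or> i = l'")
    case True
    then show ?thesis
      using col_factor_outer [OF col.hyps] col_factor_swap by blast
  next
    case False
    then show ?thesis
      using col row_factor_col col_factor_col by (metis insertE)
  qed
next
  case (neg p q A B x v)
  then show ?case
    using row_factor_neg col_factor_neg by metis
qed auto

lemma ssph_row_factor:
  assumes "ssph b p q A B x v" "p > 0"
  shows "\<exists>i j k. row_factor b p q A B x v i j k"
  using assms
proof induction
  case (row p q A B x v i j k)
  then show ?case
    using row_factor_outer by blast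
next
  case (col p q A B x v j i i')
  then show ?case
    using row_factor_col by metis
next
  case (neg p q A B x v)
  then show ?case
    using row_factor_neg by metis
qed auto

section \<open>Top-dimensional cycles of long boards\<close>

lemma gen_cmul: "x \<in> gen S \<Longrightarrow> frag_cmul k x \<in> gen S"
proof (induction k)
  case (nonneg n)
  then show ?case
    by (induction n) (auto simp: frag_cmul_distrib intro: gen_add)
next
  case (neg n)
  have "frag_cmul (int m) x \<in> gen S" for m
    using neg by (induction m) (auto simp: frag_cmul_distrib intro: gen_add)
  then have "- frag_cmul (int (Suc n)) x \<in> gen S"
    using gen_minus by blast
  then show ?case
    by (simp del: of_nat_Suc)
qed

definition sph :: "bool \<Rightarrow> nat \<Rightarrow> nat \<Rightarrow> nat set \<Rightarrow> nat set \<Rightarrow> chain set"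
  where "sph b p q A B = {x. \<exists>v. ssph b p q A B x v}"

lemma sph_transpose: "sph (\<not> b) q p B A = sph b p q A B"
proof -
  have "sph b p q A B \<subseteq> sph (\<not> b) q p B A" for b p q A B
    unfolding sph_def using ssph_transpose by blast
  from this [of b p q A B] this [of "\<not> b" q p B A] show ?thesis
    by auto
qed

lemma sph_card:
  assumes "x \<in> sph b p q A B"
  shows "finite A" "finite B" "card A = p + 2 * q" "card B = 2 * p + q"
proof -
  obtain v where "ssph b p q A B x v"
    using assms unfolding sph_def by blast
  from ssph_card [OF this] show "finite A" "finite B" "card A = p + 2 * q" "card B = 2 * p + q" .
qed

lemma sph_Zc: "x \<in> sph b p q A B \<Longrightarrow> x \<in> Zc b A B (p + q)"
  using ssph_Zc unfolding sph_def by blast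

lemma sph_pair:
  "x \<in> sph b p q A B \<Longrightarrow> i \<notin> A \<Longrightarrow> j \<notin> B \<Longrightarrow> k \<notin> B \<Longrightarrow> j \<noteq> k \<Longrightarrow>
    pair b i j k x \<in> sph b (Suc p) q (insert i A) (insert j (insert k B))"
  using ssph.row unfolding sph_def by blast

lemma sph_pair':
  "x \<in> sph b p q (A - {i}) (B - {j, k}) \<Longrightarrow> i \<in> A \<Longrightarrow> j \<in> B \<Longrightarrow> k \<in> B \<Longrightarrow> j \<noteq> k \<Longrightarrow>
    pair b i j k x \<in> sph b (Suc p) q A B"
proof -
  assume *: "x \<in> sph b p q (A - {i}) (B - {j, k})" "i \<in> A" "j \<in> B" "k \<in> B" "j \<noteq> k"
  then have "insert i (A - {i}) = A" "insert j (insert k (B - {j, k})) = B"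
    by auto
  then show ?thesis
    using sph_pair [OF *(1), of i j k] * by simp
qed

lemma sph_pairE:
  assumes "x \<in> sph b (Suc p) q A B"
  obtains i j k y where "i \<in> A" "j \<in> B" "k \<in> B" "j \<noteq> k" "y \<in> sph b p q (A - {i}) (B - {j, k})"
    "x = pair b i j k y"
  using assms ssph_row_factor unfolding sph_def row_factor_def by blast

lemma sph_pair_rowE:
  assumes "x \<in> sph b p 0 A B" "i \<in> A"
  obtains p' j k y where "p = Suc p'" "j \<in> B" "k \<in> B" "j \<noteq> k" "y \<in> sph b p' 0 (A - {i}) (B - {j, k})"
    "x = pair b i j k y"
proof -
  obtain v where v: "ssph b p 0 A B x v"
    using assms unfolding sph_def by blast
  have "\<not> col_factor b p 0 A B x v j i i'" for j i'
    unfolding col_factor_def row_factor_def by simp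
  then obtain j k where "row_factor b p 0 A B x v i j k"
    using ssph_row_cases [OF v assms(2)] by blast
  then show ?thesis
    using that unfolding row_factor_def sph_def by blast
qed

text \<open>
  The device behind all statements about generation: \<open>F u\<close> reads off a coefficient of \<open>z\<close>. If each
  of the elements \<open>y\<close> that generate the possible values of the coefficient \<open>u\<close> occurs as the only
  non-zero coefficient of some combination of \<open>G\<close>, then \<open>z\<close> can be corrected by a combination of
  \<open>G\<close> until all coefficients vanish.
\<close>

lemma gen_correct:
  fixes F :: "'u \<Rightarrow> chain \<Rightarrow> chain"
  assumes "finite U" and add: "\<And>u x y. u \<in> U \<Longrightarrow> F u (x + y) = F u x + F u y"
    and gen: "\<And>u. u \<in> U \<Longrightarrow> F u z \<in> gen (S u)"
    and base: "\<And>u y. u \<in> U \<Longrightarrow> y \<in> S u \<Longrightarrow> \<exists>w\<in>gen G. \<forall>u'\<in>U. F u' w = (if u' = u then y else 0)"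
  shows "\<exists>w\<in>gen G. \<forall>u\<in>U. F u (z - w) = 0"
proof -
  have F0: "F u 0 = 0" if "u \<in> U" for u
    using add [OF that, of 0 0] by simp
  have Fm: "F u (- x) = - F u x" if "u \<in> U" for u x
    using add [OF that, of x "- x"] F0 [OF that] by (simp add: eq_neg_iff_add_eq_0 add.commute)
  have "\<exists>w\<in>gen G. \<forall>u'\<in>U. F u' w = (if u' = u then y else 0)" if "u \<in> U" "y \<in> gen (S u)" for u y
    using that(2)
  proof (induction y rule: gen_induct_subgroup)
    case (base y)
    then show ?case
      using assms(4) that(1) by blast
  next
    case zero
    then show ?case
      using F0 by (intro bexI [of _ 0]) auto
  next
    case (add x y)
    then obtain w w' where "w \<in> gen G" "w' \<in> gen G" "\<forall>u'\<in>U. F u' w = (if u' = u then x else 0)"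
      "\<forall>u'\<in>U. F u' w' = (if u' = u then y else 0)"
      by blast
    then show ?case
      using assms(2) gen_add by (intro bexI [of _ "w + w'"]) auto
  next
    case (minus x)
    then obtain w where "w \<in> gen G" "\<forall>u'\<in>U. F u' w = (if u' = u then x else 0)"
      by blast
    then show ?case
      using Fm gen_minus by (intro bexI [of _ "- w"]) auto
  qed
  then have "\<forall>u\<in>U. \<exists>w. w \<in> gen G \<and> (\<forall>u'\<in>U. F u' w = (if u' = u then F u z else 0))"
    using gen by blast
  then obtain w where w: "\<And>u. u \<in> U \<Longrightarrow> w u \<in> gen G"
    "\<And>u u'. u \<in> U \<Longrightarrow> u' \<in> U \<Longrightarrow> F u' (w u) = (if u' = u then F u z else 0)"
    by metis
  have sum: "F u (sum w V) = (\<Sum>v\<in>V. F u (w v))" if "u \<in> U" for u V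
    by (intro additive_sum add that)
  have "F u (z - sum w U) = 0" if "u \<in> U" for u
  proof -
    have "F u (sum w U) = (\<Sum>v\<in>U. if v = u then F u z else 0)"
      unfolding sum [OF that] using that w(2) by (intro sum.cong) auto
    then show ?thesis
      using add [OF that, of z "- sum w U"] Fm that assms(1) by simp
  qed
  then show ?thesis
    using gen_sum w(1) by blast
qed

lemma contract_pair:
  assumes "i \<noteq> i' \<or> k \<noteq> j \<and> k \<noteq> j'"
  shows "contract (pt b i k) (pair b i' j j' x) = - pair b i' j j' (contract (pt b i k) x)"
  using assms by (auto simp: pair_def contract_wedge_pt)

lemma contract_pair_self:
  assumes "x \<in> Ch b A B s" "i \<notin> A \<or> j \<notin> B" "j \<noteq> k"
  shows "contract (pt b i j) (pair b i j k x) = x"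
  using contract_eq_0 [OF assms(1,2)] assms(3) Ch_finitary [OF assms(1)]
  by (simp add: pair_def contract_wedge_pt contract_wedge_self)

text \<open>
  The coefficients of \<open>z\<close> at the positions of a column \<open>c\<close> are cycles with one rook fewer on a
  board that is still long enough to use the induction hypothesis twice. So they are sums of
  cycles \<open>y\<close> that avoid two further columns \<open>k\<close> and \<open>l\<close>. The join of \<open>y\<close> with the sphere at \<open>c\<close>,
  \<open>k\<close> has coefficient \<open>y\<close> and avoids \<open>l\<close>; when all these joins are subtracted, the rest avoids
  \<open>c\<close>.
\<close>

lemma top_cycles_avoid_column:
  assumes "finite A" "finite B" "2 * card A < card B" "z \<in> Zc b A B (card A)"
  shows "z \<in> gen (\<Union>k\<in>B. Zc b A (B - {k}) (card A))"
  using assms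
proof (induction "card A" arbitrary: A B z)
  case 0
  then have "B \<noteq> {}" "A = {}"
    by auto
  then obtain k where k: "k \<in> B"
    by blast
  have "z \<in> Ch b A B 0"
    using 0 by (simp add: Zc_def)
  then obtain n where "z = frag_cmul n (frag_of {})"
    by (rule Ch_0E)
  then have "z \<in> Zc b A (B - {k}) (card A)"
    using \<open>A = {}\<close> by (auto simp: Zc_def intro: Ch_cmul)
  then show ?case
    using k by (intro gen_base) blast
next
  case (Suc m)
  note m = \<open>Suc m = card A\<close> [symmetric]
  have "B \<noteq> {}"
    using Suc by auto
  then obtain c where c: "c \<in> B"
    by blast
  let ?G = "\<Union>k\<in>B. Zc b A (B - {k}) (card A)"
  let ?S = "\<lambda>i. \<Union>k\<in>B-{c}. \<Union>l\<in>B-{c,k}. Zc b (A - {i}) (B - {c,k,l}) m"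
  have "\<exists>w\<in>gen ?G. \<forall>i\<in>A. contract (pt b i c) (z - w) = 0"
  proof (rule gen_correct [where S = ?S])
    fix i assume i: "i \<in> A"
    have cA: "card (A - {i}) = m" and fA: "finite (A - {i})"
      using i m Suc.prems by auto
    have IH: "y \<in> gen (\<Union>k\<in>B'. Zc b (A - {i}) (B' - {k}) m)"
      if "y \<in> Zc b (A - {i}) B' m" "finite B'" "2 * m < card B'" for y B'
      using Suc.hyps(1) [of "A - {i}" B' y] that cA fA by simp
    have cB: "card (B - {c}) = card B - 1"
      using c Suc.prems by simp
    have "contract (pt b i c) z \<in> Zc b (A - {i}) (B - {c}) m"
      using Suc.prems(4) unfolding m by (rule contract_in_Zc)
    then have 1: "contract (pt b i c) z \<in> gen (\<Union>k\<in>B-{c}. Zc b (A - {i}) (B - {c} - {k}) m)"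
      using cB Suc.prems m by (intro IH) auto
    show "contract (pt b i c) z \<in> gen (?S i)"
    proof (rule gen_mono_gen [OF 1])
      fix y assume "y \<in> (\<Union>k\<in>B-{c}. Zc b (A - {i}) (B - {c} - {k}) m)"
      then obtain k where k: "k \<in> B - {c}" "y \<in> Zc b (A - {i}) (B - {c,k}) m"
        by (auto simp: Diff_insert2 [symmetric] insert_commute)
      have "card (B - {c,k}) = card B - 2"
        using c k Suc.prems by (simp add: card_Diff_subset)
      then have "y \<in> gen (\<Union>l\<in>B-{c,k}. Zc b (A - {i}) (B - {c,k} - {l}) m)"
        using Suc.prems m by (intro IH k) auto
      moreover have "B - {c,k} - {l} = B - {c,k,l}" for l
        by auto
      ultimately have "y \<in> gen (\<Union>l\<in>B-{c,k}. Zc b (A - {i}) (B - {c,k,l}) m)"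
        by simp
      then show "y \<in> gen (?S i)"
        by (elim gen_mono_gen) (rule gen_base, rule UN_I [OF k(1)])
    qed
  next
    fix i y assume i: "i \<in> A" and "y \<in> ?S i"
    from this(2) obtain k where k: "k \<in> B - {c}" and "y \<in> (\<Union>l\<in>B-{c,k}. Zc b (A - {i}) (B - {c,k,l}) m)"
      by (rule UN_E)
    from this(2) obtain l where "l \<in> B - {c,k}" and y: "y \<in> Zc b (A - {i}) (B - {c,k,l}) m"
      by (rule UN_E)
    then have kl: "k \<in> B" "k \<noteq> c" "l \<in> B" "l \<noteq> c" "l \<noteq> k"
      using k by simp_all
    let ?w = "pair b i c k y"
    have "?w \<in> Zc b (insert i (A - {i})) (insert c (insert k (B - {c,k,l}))) (Suc m)"
      using y by (intro pair_in_Zc) auto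
    moreover have "insert i (A - {i}) = A" "insert c (insert k (B - {c,k,l})) = B - {l}"
      using i kl c by auto
    ultimately have "?w \<in> gen ?G"
      using kl m by (auto intro!: gen_base)
    moreover have "contract (pt b i' c) ?w = (if i' = i then y else 0)" for i'
    proof (cases "i' = i")
      case True
      then show ?thesis
        using contract_pair_self [OF Zc_Ch [OF y], of i c k] kl by auto
    next
      case False
      then show ?thesis
        using contract_eq_0 [OF Zc_Ch [OF y], of i' c] by (simp add: contract_pair)
    qed
    ultimately show "\<exists>w\<in>gen ?G. \<forall>i'\<in>A. contract (pt b i' c) w = (if i' = i then y else 0)"
      by blast
  qed (use Suc.prems in auto)
  then obtain w where w: "w \<in> gen ?G" "\<And>i. i \<in> A \<Longrightarrow> contract (pt b i c) (z - w) = 0"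
    by blast
  have "w \<in> Zc b A B (card A)"
    using w(1) by (rule gen_subset_Zc) (auto intro: Zc_mono)
  then have "z - w \<in> Zc b A B (card A)"
    using Suc.prems by (intro Zc_diff)
  then have "z - w \<in> Zc b A (B - {c}) (card A)"
    using w(2) by (auto simp: Zc_def intro: Ch_delete_column)
  then have "z - w \<in> gen ?G"
    using c by (intro gen_base) blast
  from gen_add [OF this w(1)] show ?case
    by simp
qed

text \<open>
  The placements of two rooks on a \<open>2 \<times> 3\<close> board form a hexagon. This is the join of \<open>x\<close>
  with its fundamental cycle, sorted by the position of the rook in row \<open>i\<close>.
\<close>

definition hexagon :: "bool \<Rightarrow> nat \<Rightarrow> nat \<Rightarrow> nat \<Rightarrow> nat \<Rightarrow> nat \<Rightarrow> chain \<Rightarrow> chain"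
  where "hexagon b i r j k l x = wedge (pt b i j) (pair b r k l x) + wedge (pt b i k) (pair b r l j x)
    + wedge (pt b i l) (pair b r j k x)"

text \<open>
  Inside the \<open>2 \<times> 4\<close> board with one more column \<open>c\<close> the hexagon is a sum of three joins of
  0-spheres, because the terms with a rook in column \<open>c\<close> cancel.
\<close>

lemma hexagon_eq_pairs:
  "hexagon b i r j k l x = pair b i j l (pair b r k c x) - pair b i j k (pair b r l c x)
    + pair b i k l (pair b r c j x)"
  by (simp add: hexagon_def pair_def)

lemma pair_hexagon:
  "pair b a c d (hexagon b i r j k l x) = hexagon b i r j k l (pair b a c d x)"
proof -
  have "pair b a c d (wedge v (pair b r k l x)) = wedge v (pair b r k l (pair b a c d x))" for v r k l
    by (subst pair_pair) (simp add: wedge_pair)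
  then show ?thesis
    by (simp add: hexagon_def)
qed

definition hexagon_products :: "bool \<Rightarrow> nat set \<Rightarrow> nat set \<Rightarrow> chain set"
  where "hexagon_products b A B = {hexagon b i r j k l x | i r j k l x p. i \<in> A \<and> r \<in> A \<and> i \<noteq> r \<and>
    j \<in> B \<and> k \<in> B \<and> l \<in> B \<and> j \<noteq> k \<and> j \<noteq> l \<and> k \<noteq> l \<and> x \<in> sph b p 0 (A - {i, r}) (B - {j, k, l})}"

lemma hexagon_products_in_gen_sph:
  assumes "y \<in> hexagon_products b A (B - {c})" "c \<in> B"
  shows "y \<in> gen (sph b (card A) 0 A B)"
proof -
  obtain i r j k l x p where ir: "i \<in> A" "r \<in> A" "i \<noteq> r"
    and jkl: "j \<in> B" "k \<in> B" "l \<in> B" "j \<noteq> c" "k \<noteq> c" "l \<noteq> c" "j \<noteq> k" "j \<noteq> l" "k \<noteq> l"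
    and x: "x \<in> sph b p 0 (A - {i, r}) (B - {c} - {j, k, l})" and y: "y = hexagon b i r j k l x"
    using assms unfolding hexagon_products_def by auto
  have sub: "pair b i j1 j2 (pair b r k1 k2 x) \<in> sph b (Suc (Suc p)) 0 A B"
    if "{j1, j2, k1, k2} = {c, j, k, l}" "distinct [j1, j2, k1, k2]" for j1 j2 k1 k2
  proof -
    have "B - {c} - {j, k, l} = B - {j1, j2} - {k1, k2}" "A - {i, r} = A - {i} - {r}"
      using that(1) by auto
    moreover have "{j1, j2, k1, k2} \<subseteq> B"
      using that(1) jkl assms(2) by auto
    ultimately show ?thesis
      using x ir that(2) by (intro sph_pair') auto
  qed
  have "finite A"
    using sph_card(1) [OF x] by auto
  then have "card {i, r} \<le> card A" "card (A - {i, r}) = card A - card {i, r}"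
    using ir by (intro card_mono card_Diff_subset; simp)+
  then have card: "card A = Suc (Suc p)"
    using sph_card(3) [OF x] ir by simp
  have "pair b i j l (pair b r k c x) \<in> sph b (card A) 0 A B"
    "pair b i j k (pair b r l c x) \<in> sph b (card A) 0 A B"
    "pair b i k l (pair b r c j x) \<in> sph b (card A) 0 A B"
    unfolding card using jkl by (intro sub; auto)+
  then show ?thesis
    unfolding y hexagon_eq_pairs [of _ _ _ _ _ _ _ c] by (intro gen_add gen_diff gen_base)
qed

lemma Zc_delete_column:
  "z \<in> Zc b A B s \<Longrightarrow> (\<And>i. i \<in> A \<Longrightarrow> contract (pt b i j) z = 0) \<Longrightarrow> z \<in> Zc b A (B - {j}) s"
  by (auto simp: Zc_def intro: Ch_delete_column)

lemma Zc_delete_row: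
  "z \<in> Zc b A B s \<Longrightarrow> (\<And>j. j \<in> B \<Longrightarrow> contract (pt b i j) z = 0) \<Longrightarrow> z \<in> Zc b (A - {i}) B s"
  by (auto simp: Zc_def intro: Ch_delete_row)

lemma sph_Zc_row_top: "x \<in> sph b p 0 A B \<Longrightarrow> x \<in> Zc b A B p"
  using sph_Zc [of x b p 0] by simp

lemma wedge_hexagon: "wedge v (hexagon b i r j k l x) = hexagon b i r j k l (wedge v x)"
proof -
  have "wedge v (wedge u (pair b r k l x)) = wedge u (pair b r k l (wedge v x))" for u k l
    by (subst wedge_wedge) (simp add: wedge_pair)
  then show ?thesis
    by (simp add: hexagon_def)
qed

lemma bd_hexagon: "finitary x \<Longrightarrow> bd (hexagon b i r j k l x) = hexagon b i r j k l (bd x)"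
  by (simp add: hexagon_def bd_wedge bd_pair finitary_pair) (simp add: pair_def)

lemma hexagon_in_Ch:
  assumes "x \<in> Ch b A B s" "i \<notin> A" "r \<notin> A" "i \<noteq> r" "j \<notin> B" "k \<notin> B" "l \<notin> B" "distinct [j, k, l]"
  shows "hexagon b i r j k l x \<in> Ch b ({i, r} \<union> A) ({j, k, l} \<union> B) (s + 2)"
proof -
  have "wedge (pt b i j') (pair b r k' l' x) \<in> Ch b ({i, r} \<union> A) ({j, k, l} \<union> B) (s + 2)"
    if "{j', k', l'} = {j, k, l}" "j' \<noteq> k'" "j' \<noteq> l'" for j' k' l'
  proof -
    have *: "j' \<notin> B" "k' \<notin> B" "l' \<notin> B"
      using that(1) assms(5-7) by auto
    have "insert j' (insert k' (insert l' B)) = {j', k', l'} \<union> B"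
      by auto
    moreover have "wedge (pt b i j') (pair b r k' l' x)
        \<in> Ch b (insert i (insert r A)) (insert j' (insert k' (insert l' B))) (Suc (Suc s))"
      using assms(1-4) that * by (intro wedge_in_Ch pair_in_Ch) auto
    ultimately show ?thesis
      using that(1) by simp
  qed
  then show ?thesis
    unfolding hexagon_def using assms(8) by (intro Ch_add) auto
qed

lemma hexagon_in_Zc:
  assumes "x \<in> Zc b A B s" "i \<notin> A" "r \<notin> A" "i \<noteq> r" "j \<notin> B" "k \<notin> B" "l \<notin> B" "distinct [j, k, l]"
  shows "hexagon b i r j k l x \<in> Zc b ({i, r} \<union> A) ({j, k, l} \<union> B) (s + 2)"
proof -
  have "bd (hexagon b i r j k l x) = 0"
    unfolding bd_hexagon [OF Zc_finitary [OF assms(1)]] Zc_bd [OF assms(1)] by (simp add: hexagon_def)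
  then show ?thesis
    using hexagon_in_Ch [OF Zc_Ch [OF assms(1)] assms(2-8)] by (simp add: Zc_def)
qed

lemma hexagon_products_Zc:
  assumes "y \<in> hexagon_products b A B"
  shows "y \<in> Zc b A B (card A)"
proof -
  obtain i r j k l x p where ir: "i \<in> A" "r \<in> A" "i \<noteq> r"
    and jkl: "j \<in> B" "k \<in> B" "l \<in> B" "j \<noteq> k" "j \<noteq> l" "k \<noteq> l"
    and x: "x \<in> sph b p 0 (A - {i, r}) (B - {j, k, l})" and y: "y = hexagon b i r j k l x"
    using assms unfolding hexagon_products_def by blast
  have "finite A"
    using sph_card(1) [OF x] by auto
  then have "card {i, r} \<le> card A" "card (A - {i, r}) = card A - card {i, r}"
    using ir by (intro card_mono card_Diff_subset; simp)+
  then have card: "card A = Suc (Suc p)"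
    using sph_card(3) [OF x] ir by simp
  have "y \<in> Zc b ({i, r} \<union> (A - {i, r})) ({j, k, l} \<union> (B - {j, k, l})) (p + 2)"
    unfolding y using ir jkl by (intro hexagon_in_Zc sph_Zc_row_top x) auto
  moreover have "{i, r} \<union> (A - {i, r}) = A" "{j, k, l} \<union> (B - {j, k, l}) = B"
    using ir jkl by auto
  ultimately show ?thesis
    by (simp add: card)
qed

text \<open>
  With \<open>m + 1\<close> rooks in as many rows every row is occupied. The coefficients at the positions of a
  column \<open>c\<close> are joins of 0-spheres by \<open>L0\<close>. Such a join has a sphere in row \<open>a\<close>, and replacing
  this sphere by a hexagon that involves \<open>c\<close> corrects the coefficient. After that, row \<open>a\<close> is the
  only one with a rook in column \<open>c\<close>, and the coefficients \<open>u j\<close> of row \<open>a\<close>, whose sum is zero,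
  exhibit \<open>z\<close> as a sum of 0-spheres \<open>{j, c}\<close> in row \<open>a\<close> joined with cycles that avoid both
  columns. Those are covered by \<open>L1\<close>.
\<close>

lemma top_cycles_hexagon_step:
  assumes L0: "\<And>A B z. finite A \<Longrightarrow> finite B \<Longrightarrow> card A = m \<Longrightarrow> card B = 2 * m \<Longrightarrow> z \<in> Zc b A B m \<Longrightarrow>
      z \<in> gen (sph b m 0 A B)"
    and L1: "\<And>A B z. finite A \<Longrightarrow> finite B \<Longrightarrow> card A = m \<Longrightarrow> Suc (card B) = 2 * m \<Longrightarrow> z \<in> Zc b A B m \<Longrightarrow>
      z \<in> gen (hexagon_products b A B)"
    and fin: "finite A" "finite B" and card: "card A = Suc m" "card B = Suc (2 * m)"
    and z: "z \<in> Zc b A B (Suc m)"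
  shows "z \<in> gen (hexagon_products b A B)"
proof -
  have "A \<noteq> {}" "B \<noteq> {}"
    using card by auto
  then obtain a c where a: "a \<in> A" and c: "c \<in> B"
    by blast
  let ?G = "hexagon_products b A B"
  \<comment> \<open>the position \<open>(a, c)\<close> is exempt: the correcting hexagon itself has rooks in row \<open>a\<close>\<close>
  have "\<exists>w\<in>gen ?G. \<forall>i\<in>A - {a}. contract (pt b i c) (z - w) = 0"
  proof (rule gen_correct [where S = "\<lambda>i. sph b m 0 (A - {i}) (B - {c})"])
    fix i assume "i \<in> A - {a}"
    then show "contract (pt b i c) z \<in> gen (sph b m 0 (A - {i}) (B - {c}))"
      using fin card c contract_in_Zc [OF z] by (intro L0) auto
  next
    fix i y assume i: "i \<in> A - {a}" and y: "y \<in> sph b m 0 (A - {i}) (B - {c})"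
    have "a \<in> A - {i}"
      using a i by auto
    with y obtain p' j k x where m: "m = Suc p'" and jk: "j \<in> B - {c}" "k \<in> B - {c}" "j \<noteq> k"
      and x: "x \<in> sph b p' 0 (A - {i} - {a}) (B - {c} - {j, k})" and y_eq: "y = pair b a j k x"
      by (rule sph_pair_rowE)
    have x': "x \<in> sph b p' 0 (A - {i, a}) (B - {c, j, k})"
      using x by (simp add: Diff_insert2 [symmetric] insert_commute)
    have cx: "contract (pt b i' c) x = 0" for i'
      using contract_eq_0 [OF Zc_Ch [OF sph_Zc [OF x']]] by simp
    have fx: "finitary (pair b a j k x)"
      using pair_in_Ch [OF Zc_Ch [OF sph_Zc [OF x']], of a j k] Ch_finitary by auto
    have "hexagon b i a c j k x \<in> ?G"
      unfolding hexagon_products_def using a c i jk x' by blast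
    moreover have "contract (pt b i' c) (hexagon b i a c j k x) = (if i' = i then y else 0)"
      if "i' \<in> A - {a}" for i'
      using that jk fx by (auto simp: hexagon_def contract_wedge_pt contract_wedge_self contract_pair cx y_eq)
    ultimately show "\<exists>w\<in>gen ?G. \<forall>i'\<in>A - {a}. contract (pt b i' c) w = (if i' = i then y else 0)"
      using gen_base by blast
  qed (use fin in auto)
  then obtain w where w: "w \<in> gen ?G" and cw: "\<And>i. i \<in> A - {a} \<Longrightarrow> contract (pt b i c) (z - w) = 0"
    by blast
  define z' where "z' = z - w"
  have "w \<in> Zc b A B (Suc m)"
    using gen_subset_Zc [OF w, of b A B "Suc m"] hexagon_products_Zc [of _ b A B] card by auto
  then have z': "z' \<in> Zc b A B (Suc m)"
    unfolding z'_def using z by (intro Zc_diff)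
  define u where "u = (\<lambda>j. contract (pt b a j) z')"
  have u: "u j \<in> Zc b (A - {a}) (B - {j}) m" for j
    unfolding u_def using z' by (rule contract_in_Zc)
  have "z' - (\<Sum>j\<in>B. wedge (pt b a j) (u j)) = 0"
    unfolding u_def using row_expansion [OF Zc_Ch [OF z'] fin(2), of a] fin card a
    by (intro Ch_eq_0_if_few_rows [of _ b "A - {a}" B "Suc m"]) auto
  then have z'_eq: "z' = (\<Sum>j\<in>B. wedge (pt b a j) (u j))"
    by simp
  have "bd z' = (\<Sum>j\<in>B. u j)"
    unfolding z'_eq using Zc_finitary [OF u] Zc_bd [OF u] by (simp add: bd_sum bd_wedge)
  then have "(\<Sum>j\<in>B. u j) = 0"
    using Zc_bd [OF z'] by simp
  then have "(\<Sum>j\<in>B. wedge (pt b a c) (u j)) = 0"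
    by (simp flip: wedge_sum)
  then have z'_pairs: "z' = (\<Sum>j\<in>B. pair b a j c (u j))"
    by (simp add: z'_eq pair_def sum_subtractf)
  have "pair b a j c (u j) \<in> gen ?G" if j: "j \<in> B" for j
  proof (cases "j = c")
    case True
    then show ?thesis
      by (simp add: pair_def)
  next
    case False
    have "contract (pt b i c) (u j) = 0" if "i \<in> A - {a}" for i
      unfolding u_def using cw [OF that] by (subst contract_contract) (simp add: z'_def)
    then have u': "u j \<in> Zc b (A - {a}) (B - {j} - {c}) m"
      using Zc_delete_column [OF u [of j]] by blast
    have "card {j, c} \<le> card B" "card (B - {j, c}) = card B - card {j, c}"
      using j c fin by (intro card_mono card_Diff_subset; simp)+
    then have "Suc (card (B - {j} - {c})) = 2 * m"
      using False card by (simp add: Diff_insert2 [symmetric] insert_commute)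
    then have "u j \<in> gen (hexagon_products b (A - {a}) (B - {j} - {c}))"
      using u' fin card a by (intro L1) auto
    then show ?thesis
    proof (rule gen_image)
      fix y assume "y \<in> hexagon_products b (A - {a}) (B - {j} - {c})"
      then obtain i r j' k' l' x p where ir: "i \<in> A - {a}" "r \<in> A - {a}" "i \<noteq> r"
        and jkl: "j' \<in> B - {j} - {c}" "k' \<in> B - {j} - {c}" "l' \<in> B - {j} - {c}" "j' \<noteq> k'" "j' \<noteq> l'" "k' \<noteq> l'"
        and x: "x \<in> sph b p 0 (A - {a} - {i, r}) (B - {j} - {c} - {j', k', l'})"
        and y: "y = hexagon b i r j' k' l' x"
        unfolding hexagon_products_def by blast
      have "A - {a} - {i, r} = A - {i, r} - {a}"
        "B - {j} - {c} - {j', k', l'} = B - {j', k', l'} - {j, c}"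
        by auto
      with x have x': "x \<in> sph b p 0 (A - {i, r} - {a}) (B - {j', k', l'} - {j, c})"
        by (simp only:)
      have "pair b a j c x \<in> sph b (Suc p) 0 (A - {i, r}) (B - {j', k', l'})"
        by (rule sph_pair' [OF x' _ _ _ False]) (use ir jkl a j c in blast)+
      then have "pair b a j c y \<in> ?G"
        unfolding y pair_hexagon hexagon_products_def using ir jkl by blast
      then show "pair b a j c y \<in> gen ?G"
        by (rule gen_base)
    qed simp
  qed
  then have "z' \<in> gen ?G"
    unfolding z'_pairs by (rule gen_sum)
  from gen_add [OF this w] show ?thesis
    by (simp add: z'_def)
qed

text \<open>
  Boards with twice as many columns as rows, and with one column less. The two statements need
  each other: coefficients along a column \<open>c\<close> of the larger board live on a board that is one
  column too long, so they split by \<open>top_cycles_avoid_column\<close>, and correcting them leaves a cycle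
  on the shorter board. Its hexagons become joins of 0-spheres as the column \<open>c\<close> is spare.
\<close>

lemma top_cycles:
  assumes "finite A" "finite B" "card A = m"
  shows "card B = 2 * m \<Longrightarrow> z \<in> Zc b A B m \<Longrightarrow> z \<in> gen (sph b m 0 A B)"
    and "Suc (card B) = 2 * m \<Longrightarrow> z \<in> Zc b A B m \<Longrightarrow> z \<in> gen (hexagon_products b A B)"
  using assms
proof (induction m arbitrary: A B z)
  case 0
  {
    case 1
    then have "z \<in> Ch b A B 0" and AB: "A = {}" "B = {}"
      by (auto simp: Zc_def)
    then obtain n where "z = frag_cmul n (frag_of {})"
      using Ch_0E by blast
    moreover have "frag_of {} \<in> sph b 0 0 A B"
      unfolding sph_def AB using ssph.unit by blast
    ultimately show ?case
      by (auto intro: gen_cmul gen_base)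
  next
    case 2
    then show ?case
      by simp
  }
next
  case (Suc m)
  have L1: "z \<in> gen (hexagon_products b A B)"
    if "Suc (card B) = 2 * Suc m" "z \<in> Zc b A B (Suc m)" "finite A" "finite B" "card A = Suc m" for A B z
    using Suc.IH that by (intro top_cycles_hexagon_step [of m b A B z]) auto
  {
    case 2
    then show ?case
      by (rule L1)
  next
    case 1
    note fin = \<open>finite A\<close> \<open>finite B\<close>
    have "B \<noteq> {}"
      using 1 by auto
    then obtain c where c: "c \<in> B"
      by blast
    let ?G = "sph b (Suc m) 0 A B"
    let ?S = "\<lambda>i. \<Union>k\<in>B-{c}. sph b m 0 (A - {i}) (B - {c} - {k})"
    have "\<exists>w\<in>gen ?G. \<forall>i\<in>A. contract (pt b i c) (z - w) = 0"
    proof (rule gen_correct [where S = ?S])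
      fix i assume i: "i \<in> A"
      have "contract (pt b i c) z \<in> Zc b (A - {i}) (B - {c}) (card (A - {i}))"
        using contract_in_Zc [OF 1(2)] i 1 by simp
      then have "contract (pt b i c) z \<in> gen (\<Union>k\<in>B-{c}. Zc b (A - {i}) (B - {c} - {k}) (card (A - {i})))"
        using i 1 c by (intro top_cycles_avoid_column) auto
      then show "contract (pt b i c) z \<in> gen (?S i)"
      proof (rule gen_mono_gen)
        fix y assume "y \<in> (\<Union>k\<in>B-{c}. Zc b (A - {i}) (B - {c} - {k}) (card (A - {i})))"
        then obtain k where k: "k \<in> B - {c}" and y: "y \<in> Zc b (A - {i}) (B - {c} - {k}) (card (A - {i}))"
          by (rule UN_E)
        have "y \<in> gen (sph b m 0 (A - {i}) (B - {c} - {k}))"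
          using k y i c 1 by (intro Suc.IH(1)) auto
        then show "y \<in> gen (?S i)"
          by (elim gen_mono_gen) (rule gen_base, rule UN_I [OF k])
      qed
    next
      fix i y assume i: "i \<in> A" and "y \<in> ?S i"
      from this(2) obtain k where k: "k \<in> B - {c}" and y: "y \<in> sph b m 0 (A - {i}) (B - {c} - {k})"
        by (rule UN_E)
      have y': "y \<in> sph b m 0 (A - {i}) (B - {c, k})"
        using y by (simp add: Diff_insert2 [symmetric] insert_commute)
      have "pair b i c k y \<in> ?G"
        using y' i k c by (intro sph_pair') auto
      moreover have "contract (pt b i' c) (pair b i c k y) = (if i' = i then y else 0)" for i'
      proof (cases "i' = i")
        case True
        then show ?thesis
          using contract_pair_self [OF Zc_Ch [OF sph_Zc [OF y]], of i c k] k by auto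
      next
        case False
        then show ?thesis
          using contract_eq_0 [OF Zc_Ch [OF sph_Zc [OF y]], of i' c] by (simp add: contract_pair)
      qed
      ultimately show "\<exists>w\<in>gen ?G. \<forall>i'\<in>A. contract (pt b i' c) w = (if i' = i then y else 0)"
        using gen_base by blast
    qed (use fin in auto)
    then obtain w where w: "w \<in> gen ?G" "\<And>i. i \<in> A \<Longrightarrow> contract (pt b i c) (z - w) = 0"
      by blast
    have "w \<in> Zc b A B (Suc m)"
      using w(1) by (rule gen_subset_Zc) (auto intro: sph_Zc_row_top)
    then have "z - w \<in> Zc b A (B - {c}) (Suc m)"
      using 1 w(2) by (intro Zc_delete_column Zc_diff) auto
    then have "z - w \<in> gen (hexagon_products b A (B - {c}))"
      using 1 c by (intro L1) auto
    then have "z - w \<in> gen ?G"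
      using hexagon_products_in_gen_sph [of _ b A B c] c 1 by (elim gen_mono_gen) simp
    from gen_add [OF this w(1)] show ?case
      by simp
  }
qed

section \<open>Splitting cycles at a corner\<close>

lemma gen_mono: "x \<in> gen S \<Longrightarrow> S \<subseteq> T \<Longrightarrow> x \<in> gen T"
  using gen_mono_gen gen_base by blast

lemma Ch_wedge_in:
  assumes "c \<in> Ch b (A - {i}) (B - {j}) s" "i \<in> A" "j \<in> B"
  shows "wedge (pt b i j) c \<in> Ch b A B (Suc s)"
  using wedge_in_Ch [OF assms(1), of i j] assms(2,3) by (simp add: insert_absorb)

lemma cone_in_Bd:
  assumes "z \<in> Zc b (A - {i}) (B - {j}) s" "i \<in> A" "j \<in> B"
  shows "z \<in> Bd b A B s"
proof -
  have "bd (wedge (pt b i j) z) = z"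
    using assms(1) by (simp add: bd_wedge Zc_finitary Zc_bd)
  moreover have "wedge (pt b i j) z \<in> Ch b A B (Suc s)"
    using assms by (intro Ch_wedge_in) (auto simp: Zc_def)
  ultimately show ?thesis
    using BdI by fastforce
qed

text \<open>
  Cycles of the form: 0-sphere through the corner \<open>(i0, j0)\<close>, in its row or in its column, joined
  with a cycle on the remaining lines.
\<close>

definition star_gens :: "bool \<Rightarrow> nat set \<Rightarrow> nat set \<Rightarrow> nat \<Rightarrow> nat \<Rightarrow> nat \<Rightarrow> chain set"
  where "star_gens b A B i0 j0 n =
    (\<Union>j\<in>B - {j0}. pair b i0 j j0 ` Zc b (A - {i0}) (B - {j0, j}) n) \<union>
    (\<Union>i\<in>A - {i0}. pair (\<not> b) j0 i i0 ` Zc b (A - {i0, i}) (B - {j0}) n)"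

lemma contract_col_pair:
  assumes "j \<noteq> j0 \<or> i \<noteq> i1 \<and> i \<noteq> i2"
  shows "contract (pt b i j) (pair (\<not> b) j0 i1 i2 x) = - pair (\<not> b) j0 i1 i2 (contract (pt b i j) x)"
  using contract_pair [of j j0 i i1 i2 "\<not> b" x] assms by auto

lemma contract_col_pair_self:
  assumes "x \<in> Ch b A B s" "i \<notin> A \<or> j \<notin> B" "i \<noteq> i0"
  shows "contract (pt b i j) (pair (\<not> b) j i i0 x) = x"
  using contract_pair_self [of x "\<not> b" B A s j i i0] assms by (auto simp: Ch_transpose)

definition star_sum :: "bool \<Rightarrow> nat set \<Rightarrow> nat set \<Rightarrow> nat \<Rightarrow> nat \<Rightarrow> (nat \<Rightarrow> chain) \<Rightarrow> (nat \<Rightarrow> chain) \<Rightarrow> chain"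
  where "star_sum b A B i0 j0 y u =
    (\<Sum>j\<in>B - {j0}. pair b i0 j j0 (y j)) + (\<Sum>i\<in>A - {i0}. pair (\<not> b) j0 i i0 (u i))"

text \<open>
  The summands have no common terms outside the corner, so the coefficients there recover them.
\<close>

lemma star_sum_contract:
  assumes fin: "finite A" "finite B"
    and y: "\<And>j. j \<in> B - {j0} \<Longrightarrow> y j \<in> Zc b (A - {i0}) (B - {j0, j}) n"
    and u: "\<And>i. i \<in> A - {i0} \<Longrightarrow> u i \<in> Zc b (A - {i0, i}) (B - {j0}) n"
  shows "j \<in> B - {j0} \<Longrightarrow> contract (pt b i0 j) (star_sum b A B i0 j0 y u) = y j"
    and "i \<in> A - {i0} \<Longrightarrow> contract (pt b i j0) (star_sum b A B i0 j0 y u) = u i"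
proof -
  show "contract (pt b i0 j) (star_sum b A B i0 j0 y u) = y j" if j: "j \<in> B - {j0}"
  proof -
    have "contract (pt b i0 j) (pair b i0 j' j0 (y j')) = (if j' = j then y j else 0)" if "j' \<in> B - {j0}" for j'
    proof (cases "j' = j")
      case True
      then show ?thesis
        using contract_pair_self [OF Zc_Ch [OF y [OF j]], of i0 j j0] j by simp
    next
      case False
      have "contract (pt b i0 j) (y j') = 0"
        using contract_eq_0 [OF Zc_Ch [OF y [OF that]], of i0 j] by simp
      then show ?thesis
        using False j by (subst contract_pair) auto
    qed
    then have "(\<Sum>j'\<in>B - {j0}. contract (pt b i0 j) (pair b i0 j' j0 (y j'))) = y j"
      using j fin by simp
    moreover have "contract (pt b i0 j) (pair (\<not> b) j0 i i0 (u i)) = 0" if "i \<in> A - {i0}" for i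
    proof -
      have "contract (pt b i0 j) (u i) = 0"
        using contract_eq_0 [OF Zc_Ch [OF u [OF that]], of i0 j] by simp
      then show ?thesis
        using j by (subst contract_col_pair) auto
    qed
    ultimately show ?thesis
      by (simp add: star_sum_def contract_sum)
  qed
  show "contract (pt b i j0) (star_sum b A B i0 j0 y u) = u i" if i: "i \<in> A - {i0}"
  proof -
    have "contract (pt b i j0) (pair (\<not> b) j0 i' i0 (u i')) = (if i' = i then u i else 0)" if "i' \<in> A - {i0}" for i'
    proof (cases "i' = i")
      case True
      then show ?thesis
        using contract_col_pair_self [OF Zc_Ch [OF u [OF i]], of i j0 i0] i by simp
    next
      case False
      have "contract (pt b i j0) (u i') = 0"
        using contract_eq_0 [OF Zc_Ch [OF u [OF that]], of i j0] by simp
      then show ?thesis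
        using False i by (subst contract_col_pair) auto
    qed
    then have "(\<Sum>i'\<in>A - {i0}. contract (pt b i j0) (pair (\<not> b) j0 i' i0 (u i'))) = u i"
      using i fin by simp
    moreover have "contract (pt b i j0) (pair b i0 j j0 (y j)) = 0" if "j \<in> B - {j0}" for j
    proof -
      have "contract (pt b i j0) (y j) = 0"
        using contract_eq_0 [OF Zc_Ch [OF y [OF that]], of i j0] by simp
      then show ?thesis
        using i by (subst contract_pair) auto
    qed
    ultimately show ?thesis
      by (simp add: star_sum_def contract_sum)
  qed
qed

text \<open>
  Without placements that have rooks both at some \<open>(i0, j)\<close> and at some \<open>(i, j0)\<close>, the
  coefficients \<open>y j\<close> and \<open>u i\<close> are cycles avoiding the row and the column of the corner.
  Subtracting the star sum that they define leaves a cycle in the star of the corner, which is a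
  boundary.
\<close>

lemma star_decomposition:
  assumes fin: "finite A" "finite B" and ij: "i0 \<in> A" "j0 \<in> B" and z: "z \<in> Zc b A B (Suc n)"
    and both: "\<And>i j. i \<in> A - {i0} \<Longrightarrow> j \<in> B - {j0} \<Longrightarrow> contract (pt b i j0) (contract (pt b i0 j) z) = 0"
  shows "z \<in> gen (star_gens b A B i0 j0 n \<union> Bd b A B (Suc n))"
proof -
  define y where "y = (\<lambda>j. contract (pt b i0 j) z)"
  define u where "u = (\<lambda>i. contract (pt b i j0) z)"
  have y: "y j \<in> Zc b (A - {i0}) (B - {j0, j}) n" if "j \<in> B - {j0}" for j
  proof -
    have "y j \<in> Zc b (A - {i0}) (B - {j} - {j0}) n"
      unfolding y_def using that both by (intro Zc_delete_column contract_in_Zc z) auto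
    then show ?thesis
      by (simp add: Diff_insert2 [symmetric] insert_commute)
  qed
  have u: "u i \<in> Zc b (A - {i0, i}) (B - {j0}) n" if i: "i \<in> A - {i0}" for i
  proof -
    have "contract (pt b i0 j) (contract (pt b i j0) z) = 0" if "j \<in> B - {j0}" for j
      using both [OF i that] by (subst contract_contract) simp
    then have "u i \<in> Zc b (A - {i} - {i0}) (B - {j0}) n"
      unfolding u_def by (intro Zc_delete_row contract_in_Zc z)
    then show ?thesis
      by (simp add: Diff_insert2 [symmetric] insert_commute)
  qed
  define w where "w = star_sum b A B i0 j0 y u"
  have w_gen: "w \<in> gen (star_gens b A B i0 j0 n)"
    unfolding w_def star_sum_def
  proof (intro gen_add gen_sum gen_base)
    show "pair b i0 j j0 (y j) \<in> star_gens b A B i0 j0 n" if "j \<in> B - {j0}" for j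
      unfolding star_gens_def by (intro UnI1 UN_I [OF that] imageI y that)
    show "pair (\<not> b) j0 i i0 (u i) \<in> star_gens b A B i0 j0 n" if "i \<in> A - {i0}" for i
      unfolding star_gens_def by (intro UnI2 UN_I [OF that] imageI u that)
  qed
  have "star_gens b A B i0 j0 n \<subseteq> Zc b A B (Suc n)"
  proof -
    have "pair b i0 j j0 x \<in> Zc b A B (Suc n)" if "j \<in> B - {j0}" "x \<in> Zc b (A - {i0}) (B - {j0, j}) n" for j x
    proof -
      have "insert i0 (A - {i0}) = A" "insert j (insert j0 (B - {j0, j})) = B"
        using that ij by auto
      then show ?thesis
        using pair_in_Zc [OF that(2), of i0 j j0] by simp
    qed
    moreover have "pair (\<not> b) j0 i i0 x \<in> Zc b A B (Suc n)"
      if "i \<in> A - {i0}" "x \<in> Zc b (A - {i0, i}) (B - {j0}) n" for i x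
    proof -
      have "insert j0 (B - {j0}) = B" "insert i (insert i0 (A - {i0, i})) = A"
        using that ij by auto
      then show ?thesis
        using pair_in_Zc [of x "\<not> b" "B - {j0}" "A - {i0, i}" n j0 i i0] that by (simp add: Zc_transpose)
    qed
    ultimately show ?thesis
      unfolding star_gens_def by blast
  qed
  then have wZ: "w \<in> Zc b A B (Suc n)"
    using w_gen gen_subset_Zc by blast
  define z' where "z' = z - w"
  have z'Z: "z' \<in> Zc b A B (Suc n)"
    unfolding z'_def using z wZ by (rule Zc_diff)
  have row: "contract (pt b i0 j) z' = 0" if "j \<in> B - {j0}" for j
    using star_sum_contract(1) [OF fin y u that] by (simp add: z'_def w_def y_def)
  have col: "contract (pt b i j0) z' = 0" if "i \<in> A - {i0}" for i
    using star_sum_contract(2) [OF fin y u that] by (simp add: z'_def w_def u_def)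
  define z0 where "z0 = z' - wedge (pt b i0 j0) (contract (pt b i0 j0) z')"
  \<comment> \<open>\<open>z0\<close> is free of row \<open>i0\<close> and column \<open>j0\<close>, and its cone over the corner has boundary the cycle left over\<close>
  have "(\<Sum>j\<in>B. wedge (pt b i0 j) (contract (pt b i0 j) z')) = wedge (pt b i0 j0) (contract (pt b i0 j0) z')"
    using row fin ij by (subst sum.remove [of _ j0]) auto
  then have "z0 \<in> Ch b (A - {i0}) B (Suc n)"
    unfolding z0_def using row_expansion [OF Zc_Ch [OF z'Z] fin(2), of i0] by simp
  moreover have "contract (pt b i j0) z0 = 0" if i: "i \<in> A - {i0}" for i
  proof -
    have "contract (pt b i j0) (contract (pt b i0 j0) z') = 0"
      using col [OF i] by (subst contract_contract) simp
    then show ?thesis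
      unfolding z0_def using i col [OF i] by (simp add: contract_wedge_pt)
  qed
  ultimately have "z0 \<in> Ch b (A - {i0}) (B - {j0}) (Suc n)"
    by (rule Ch_delete_column)
  then have "wedge (pt b i0 j0) z0 \<in> Ch b A B (Suc (Suc n))"
    using ij by (intro Ch_wedge_in)
  moreover have "bd (wedge (pt b i0 j0) z0) = z'"
    unfolding z0_def using Zc_finitary [OF z'Z] Zc_bd [OF z'Z] by (simp add: bd_wedge)
  ultimately have "z' \<in> Bd b A B (Suc n)"
    using BdI by blast
  then have "z' + w \<in> gen (star_gens b A B i0 j0 n \<union> Bd b A B (Suc n))"
    by (intro gen_add gen_mono [OF w_gen] gen_mono [OF gen_base]) auto
  then show ?thesis
    by (simp add: z'_def)
qed

text \<open>
  The hypothesis of \<open>star_decomposition\<close> is reached by correcting the coefficients at the pairs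
  \<open>(i0, j)\<close>, \<open>(i, j0)\<close> with the help of suitable cycles in \<open>G\<close>.
\<close>

lemma star_reduction:
  assumes fin: "finite A" "finite B" and ij: "i0 \<in> A" "j0 \<in> B" and z: "z \<in> Zc b A B (Suc n)"
    and gen: "\<And>i j. i \<in> A - {i0} \<Longrightarrow> j \<in> B - {j0} \<Longrightarrow>
      contract (pt b i j0) (contract (pt b i0 j) z) \<in> gen (S i j)"
    and lift: "\<And>i j x. i \<in> A - {i0} \<Longrightarrow> j \<in> B - {j0} \<Longrightarrow> x \<in> S i j \<Longrightarrow> \<exists>w\<in>gen G. \<forall>i'\<in>A - {i0}. \<forall>j'\<in>B - {j0}.
      contract (pt b i' j0) (contract (pt b i0 j') w) = (if i' = i \<and> j' = j then x else 0)"
    and G: "G \<subseteq> Zc b A B (Suc n)"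
  shows "z \<in> gen (G \<union> star_gens b A B i0 j0 n \<union> Bd b A B (Suc n))"
proof -
  let ?F = "\<lambda>(i, j) x. contract (pt b i j0) (contract (pt b i0 j) x)"
  have "\<exists>w\<in>gen G. \<forall>u\<in>(A - {i0}) \<times> (B - {j0}). ?F u (z - w) = 0"
  proof (rule gen_correct [where S = "\<lambda>(i, j). S i j"])
    fix u x assume "u \<in> (A - {i0}) \<times> (B - {j0})" and x: "x \<in> (case u of (i, j) \<Rightarrow> S i j)"
    then obtain i j where u: "u = (i, j)" "i \<in> A - {i0}" "j \<in> B - {j0}"
      by auto
    then obtain w where "w \<in> gen G" "\<forall>i'\<in>A - {i0}. \<forall>j'\<in>B - {j0}.
      contract (pt b i' j0) (contract (pt b i0 j') w) = (if i' = i \<and> j' = j then x else 0)"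
      using lift x by (metis case_prod_conv)
    then show "\<exists>w\<in>gen G. \<forall>u'\<in>(A - {i0}) \<times> (B - {j0}). ?F u' w = (if u' = u then x else 0)"
      using u(1) by (intro bexI [of _ w]) auto
  qed (use fin gen in auto)
  then obtain w where w: "w \<in> gen G"
    and "\<forall>u\<in>(A - {i0}) \<times> (B - {j0}). ?F u (z - w) = 0"
    by blast
  then have both: "contract (pt b i j0) (contract (pt b i0 j) (z - w)) = 0" if "i \<in> A - {i0}" "j \<in> B - {j0}" for i j
    using that by fastforce
  have "z - w \<in> Zc b A B (Suc n)"
    using z gen_subset_Zc [OF w G] by (rule Zc_diff)
  then have "z - w \<in> gen (star_gens b A B i0 j0 n \<union> Bd b A B (Suc n))"
    using both by (intro star_decomposition fin ij)
  then have "z - w + w \<in> gen (G \<union> star_gens b A B i0 j0 n \<union> Bd b A B (Suc n))"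
    using w by (intro gen_add; elim gen_mono) blast+
  then show ?thesis
    by simp
qed

text \<open>
  If the coefficient at the two rooks \<open>(i0, j)\<close>, \<open>(i, j0)\<close> is the boundary of \<open>q\<close>, then the
  boundary of the join of the two rooks with \<open>q\<close> has this coefficient, and it is null-homologous.
\<close>

lemma star_lift_boundary:
  assumes "x \<in> Bd b (A - {i0, i}) (B - {j0, j}) m" "i0 \<in> A" "j0 \<in> B" "i \<in> A - {i0}" "j \<in> B - {j0}"
  shows "\<exists>w\<in>Bd b A B (Suc (Suc m)). \<forall>i'\<in>A - {i0}. \<forall>j'\<in>B - {j0}.
      contract (pt b i' j0) (contract (pt b i0 j') w) = (if i' = i \<and> j' = j then x else 0)"
proof -
  obtain q where q: "q \<in> Ch b (A - {i0, i}) (B - {j0, j}) (Suc m)" "x = bd q"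
    using assms(1) by (auto simp: Bd_def)
  let ?W = "wedge (pt b i0 j) (wedge (pt b i j0) q)"
  have 1: "wedge (pt b i j0) q \<in> Ch b (A - {i0}) (B - {j}) (Suc (Suc m))"
  proof -
    have "insert i (A - {i0, i}) = A - {i0}" "insert j0 (B - {j0, j}) = B - {j}"
      using assms by auto
    then show ?thesis
      using wedge_in_Ch [OF q(1), of i j0] by simp
  qed
  have cq: "contract (pt b i0 j') q = 0" "contract (pt b i' j0) q = 0" for i' j'
    using contract_eq_0 [OF q(1)] by auto
  have "contract (pt b i' j0) (contract (pt b i0 j') ?W) = (if i' = i \<and> j' = j then q else 0)"
    if "j' \<noteq> j0" "i' \<noteq> i0" for i' j'
  proof -
    have "i \<noteq> i0" "i0 \<noteq> i"
      using assms(4) by auto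
    then show ?thesis
      using that Ch_finitary [OF q(1)] Ch_finitary [OF 1]
      by (cases "j' = j"; cases "i' = i") (simp_all add: contract_wedge_pt contract_wedge_self cq)
  qed
  moreover have "contract v (contract w (bd c)) = bd (contract v (contract w c))" for v w c
    by (simp add: bd_contract)
  moreover have "bd ?W \<in> Bd b A B (Suc (Suc m))"
    using assms by (intro BdI Ch_wedge_in 1) auto
  ultimately show ?thesis
    using q(2) by (intro bexI [of _ "bd ?W"]) auto
qed

lemma star_generation:
  assumes fin: "finite A" "finite B" and ij: "i0 \<in> A" "j0 \<in> B" and z: "z \<in> Zc b A B (Suc n)"
    and vanish: "\<And>i j n' x. n = Suc n' \<Longrightarrow> i \<in> A - {i0} \<Longrightarrow> j \<in> B - {j0} \<Longrightarrow>
      x \<in> Zc b (A - {i0, i}) (B - {j0, j}) n' \<Longrightarrow> x \<in> Bd b (A - {i0, i}) (B - {j0, j}) n'"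
  shows "z \<in> gen (star_gens b A B i0 j0 n \<union> Bd b A B (Suc n))"
proof (cases n)
  case 0
  have "contract (pt b i j0) (contract (pt b i0 j) z) = 0" for i j
    using contract_in_Ch [of z b A B 0] z by (intro contract_Ch_0) (auto simp: Zc_def 0)
  then show ?thesis
    using star_decomposition [OF fin ij z] by blast
next
  case (Suc n')
  have "z \<in> gen (Bd b A B (Suc n) \<union> star_gens b A B i0 j0 n \<union> Bd b A B (Suc n))"
  proof (rule star_reduction [OF fin ij z, where S = "\<lambda>i j. Bd b (A - {i0, i}) (B - {j0, j}) n'"])
    fix i j assume "i \<in> A - {i0}" "j \<in> B - {j0}"
    moreover have "contract (pt b i j0) (contract (pt b i0 j) z) \<in> Zc b (A - {i0} - {i}) (B - {j} - {j0}) n'"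
      using z by (intro contract_in_Zc) (simp add: Suc)
    then have "contract (pt b i j0) (contract (pt b i0 j) z) \<in> Zc b (A - {i0, i}) (B - {j0, j}) n'"
      by (simp add: Diff_insert2 [symmetric] insert_commute)
    ultimately show "contract (pt b i j0) (contract (pt b i0 j) z) \<in> gen (Bd b (A - {i0, i}) (B - {j0, j}) n')"
      using vanish [OF Suc] by (blast intro: gen_base)
  next
    fix i j x
    assume *: "i \<in> A - {i0}" "j \<in> B - {j0}" "x \<in> Bd b (A - {i0, i}) (B - {j0, j}) n'"
    show "\<exists>w\<in>gen (Bd b A B (Suc n)). \<forall>i'\<in>A - {i0}. \<forall>j'\<in>B - {j0}.
      contract (pt b i' j0) (contract (pt b i0 j') w) = (if i' = i \<and> j' = j then x else 0)"
      using star_lift_boundary [OF *(3) ij *(1,2)] unfolding Suc by (blast intro: gen_base)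
  qed (auto intro: Bd_subset_Zc)
  then show ?thesis
    by (rule gen_mono) blast
qed

lemma star_gens_cases:
  assumes "x \<in> star_gens b A B i0 j0 n"
  obtains (row) j y where "j \<in> B - {j0}" "y \<in> Zc b (A - {i0}) (B - {j0, j}) n" "x = pair b i0 j j0 y"
  | (col) i y where "i \<in> A - {i0}" "y \<in> Zc b (A - {i0, i}) (B - {j0}) n" "x = pair (\<not> b) j0 i i0 y"
  using assms unfolding star_gens_def by blast

lemma pair_in_Bd':
  assumes "y \<in> Bd b (A - {i}) (B - {k, j}) s" "i \<in> A" "j \<in> B" "k \<in> B"
  shows "pair b i j k y \<in> Bd b A B (Suc s)"
proof -
  have "insert i (A - {i}) = A" "insert j (insert k (B - {k, j})) = B"
    using assms by auto
  then show ?thesis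
    using pair_in_Bd [OF assms(1), of i j k] by simp
qed

lemma col_pair_in_Bd':
  assumes "y \<in> Bd b (A - {k, i}) (B - {j}) s" "i \<in> A" "j \<in> B" "k \<in> A"
  shows "pair (\<not> b) j i k y \<in> Bd b A B (Suc s)"
  using pair_in_Bd' [of y "\<not> b" B j A k i s] assms by (simp add: Bd_transpose)

text \<open>
  The range next to the top dimension, where only one row is unoccupied. The coefficients in a row
  \<open>a\<close> bound by induction; removing them leaves a cycle that occupies all rows except \<open>a\<close>. It is a
  sum of cycles avoiding a column \<open>k\<close>, and these bound as cones over \<open>(a, k)\<close>.
\<close>

lemma vanishing_few_rows:
  assumes "finite A" "finite B" "card A = Suc s" "2 * s < card B" "z \<in> Zc b A B s"
  shows "z \<in> Bd b A B s"
  using assms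
proof (induction s arbitrary: A B z)
  case 0
  then have "A \<noteq> {}" "B \<noteq> {}"
    by auto
  then obtain i j where ij: "i \<in> A" "j \<in> B"
    by blast
  have "z \<in> Ch b A B 0"
    using 0 by (simp add: Zc_def)
  then obtain n where "z = frag_cmul n (frag_of {})"
    by (rule Ch_0E)
  then have "z \<in> Zc b (A - {i}) (B - {j}) 0"
    by (auto simp: Zc_def intro: Ch_cmul)
  then show ?case
    using ij by (rule cone_in_Bd)
next
  case (Suc s)
  have "A \<noteq> {}"
    using Suc by auto
  then obtain a where a: "a \<in> A"
    by blast
  have "\<exists>w\<in>gen (Bd b A B (Suc s)). \<forall>j\<in>B. contract (pt b a j) (z - w) = 0"
  proof (rule gen_correct [where S = "\<lambda>j. Bd b (A - {a}) (B - {j}) s"])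
    fix j assume "j \<in> B"
    then have "contract (pt b a j) z \<in> Bd b (A - {a}) (B - {j}) s"
      using Suc.prems a by (intro Suc.IH contract_in_Zc) auto
    then show "contract (pt b a j) z \<in> gen (Bd b (A - {a}) (B - {j}) s)"
      by (rule gen_base)
  next
    fix j y assume j: "j \<in> B" and "y \<in> Bd b (A - {a}) (B - {j}) s"
    then obtain q where q: "q \<in> Ch b (A - {a}) (B - {j}) (Suc s)" "y = bd q"
      by (auto simp: Bd_def)
    have "contract (pt b a j') q = 0" for j'
      using contract_eq_0 [OF q(1)] by auto
    then have "contract (pt b a j') (wedge (pt b a j) q) = (if j' = j then q else 0)" for j'
      using Ch_finitary [OF q(1)] by (simp add: contract_wedge_pt contract_wedge_self)
    moreover have "contract v (bd c) = - bd (contract v c)" for v c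
      by (simp add: bd_contract)
    ultimately have "contract (pt b a j') (bd (- wedge (pt b a j) q)) = (if j' = j then y else 0)" for j'
      using q(2) by auto
    moreover have "bd (- wedge (pt b a j) q) \<in> Bd b A B (Suc s)"
      using a j by (intro BdI Ch_minus Ch_wedge_in q)
    ultimately show "\<exists>w\<in>gen (Bd b A B (Suc s)). \<forall>j'\<in>B. contract (pt b a j') w = (if j' = j then y else 0)"
      using gen_base by blast
  qed (use Suc.prems in auto)
  then obtain w where "w \<in> gen (Bd b A B (Suc s))" and w: "\<And>j. j \<in> B \<Longrightarrow> contract (pt b a j) (z - w) = 0"
    by blast
  then have wB: "w \<in> Bd b A B (Suc s)"
    using gen_subset_Bd by blast
  then have "z - w \<in> Zc b (A - {a}) B (Suc s)"
    using Suc.prems(5) w Bd_subset_Zc by (intro Zc_delete_row Zc_diff) blast+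
  then have "z - w \<in> gen (\<Union>k\<in>B. Zc b (A - {a}) (B - {k}) (card (A - {a})))"
    using Suc.prems a by (intro top_cycles_avoid_column) auto
  then have "z - w \<in> Bd b A B (Suc s)"
    by (rule gen_subset_Bd) (use a Suc.prems in \<open>auto intro: cone_in_Bd\<close>)
  from Bd_add [OF this wB] show ?case
    by simp
qed

lemma card_Diff2:
  assumes "finite A" "i \<in> A" "j \<in> A" "i \<noteq> j"
  shows "Suc (Suc (card (A - {i, j}))) = card A"
proof -
  have "card {i, j} \<le> card A" "card (A - {i, j}) = card A - card {i, j}"
    using assms by (intro card_mono card_Diff_subset; simp)+
  then show ?thesis
    using assms by simp
qed

text \<open>
  Below the degree \<open>\<nu>\<close> the homology is zero. Splitting at a corner, the coefficients at two
  rooks as well as the cycles in the star generators lie in the same range; the boundary cases are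
  those where a direction has only one unoccupied line.
\<close>

theorem vanishing:
  assumes "finite A" "finite B" "s < card A" "s < card B" "3 * s + 2 \<le> card A + card B" "z \<in> Zc b A B s"
  shows "z \<in> Bd b A B s"
  using assms
proof (induction s arbitrary: A B z rule: less_induct)
  case (less s)
  consider "card A = Suc s" | "card B = Suc s" | "s = 0" | n where "s = Suc n" "Suc s < card A" "Suc s < card B"
    using less.prems by (metis Suc_lessI not0_implies_Suc)
  then show ?case
  proof cases
    case 1
    then show ?thesis
      using less.prems by (intro vanishing_few_rows) auto
  next
    case 2
    then show ?thesis
      using vanishing_few_rows [of B A s z "\<not> b"] less.prems by (simp add: Zc_transpose Bd_transpose)
  next
    case 3
    have "A \<noteq> {}" "B \<noteq> {}"
      using less.prems by auto
    then obtain i j where ij: "i \<in> A" "j \<in> B"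
      by blast
    have "z \<in> Ch b A B 0"
      using less.prems 3 by (simp add: Zc_def)
    then obtain n where "z = frag_cmul n (frag_of {})"
      by (rule Ch_0E)
    then have "z \<in> Zc b (A - {i}) (B - {j}) s"
      unfolding 3 by (auto simp: Zc_def intro: Ch_cmul)
    then show ?thesis
      using ij by (rule cone_in_Bd)
  next
    case (4 n)
    have "A \<noteq> {}" "B \<noteq> {}"
      using less.prems by auto
    then obtain i0 j0 where ij: "i0 \<in> A" "j0 \<in> B"
      by blast
    have z: "z \<in> Zc b A B (Suc n)"
      using less.prems 4 by simp
    have "z \<in> gen (star_gens b A B i0 j0 n \<union> Bd b A B (Suc n))"
    proof (rule star_generation [OF less.prems(1,2) ij z])
      fix i j n' x
      assume *: "n = Suc n'" "i \<in> A - {i0}" "j \<in> B - {j0}" "x \<in> Zc b (A - {i0, i}) (B - {j0, j}) n'"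
      then show "x \<in> Bd b (A - {i0, i}) (B - {j0, j}) n'"
        using less.prems 4 ij card_Diff2 [of A i0 i] card_Diff2 [of B j0 j]
        by (intro less.IH) auto
    qed
    moreover have "x \<in> Bd b A B (Suc n)" if "x \<in> star_gens b A B i0 j0 n" for x
      using that
    proof (cases rule: star_gens_cases)
      case (row j y)
      then have "y \<in> Bd b (A - {i0}) (B - {j0, j}) n"
        using less.prems 4 ij card_Diff2 [of B j0 j] by (intro less.IH) auto
      then show ?thesis
        unfolding row(3) using ij row by (intro pair_in_Bd') auto
    next
      case (col i y)
      then have "y \<in> Bd b (A - {i0, i}) (B - {j0}) n"
        using less.prems 4 ij card_Diff2 [of A i0 i] by (intro less.IH) auto
      then show ?thesis
        unfolding col(3) using ij col by (intro col_pair_in_Bd') auto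
    qed
    ultimately show ?thesis
      using gen_subset_Bd 4 by (metis Un_least order_refl subsetI)
  qed
qed

section \<open>Generation by joins of 0-spheres\<close>

definition products :: "bool \<Rightarrow> nat set \<Rightarrow> nat set \<Rightarrow> chain set"
  where "products b A B = (\<Union>p. \<Union>q. sph b p q A B)"

definition near_products :: "bool \<Rightarrow> nat set \<Rightarrow> nat set \<Rightarrow> chain set"
  where "near_products b A B = (\<Union>c\<in>B. products b A (B - {c})) \<union> (\<Union>r\<in>A. products b (A - {r}) B)"

lemma products_transpose: "products (\<not> b) B A = products b A B"
  unfolding products_def sph_transpose by (rule SUP_commute)

lemma near_products_transpose: "near_products (\<not> b) B A = near_products b A B"
  unfolding near_products_def products_transpose by (rule Un_commute)

lemma pair_products:
  assumes "y \<in> products b (A - {i}) (B - {k, j})" "i \<in> A" "j \<in> B" "k \<in> B" "j \<noteq> k"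
  shows "pair b i j k y \<in> products b A B"
proof -
  obtain p q where "y \<in> sph b p q (A - {i}) (B - {j, k})"
    using assms(1) by (auto simp: products_def insert_commute)
  from sph_pair' [OF this assms(2-5)] show ?thesis
    unfolding products_def by blast
qed

lemma pair_near_products:
  assumes "y \<in> near_products b (A - {i}) (B - {k, j})" "i \<in> A" "j \<in> B" "k \<in> B" "j \<noteq> k"
  shows "pair b i j k y \<in> near_products b A B"
proof -
  consider c where "c \<in> B - {k, j}" "y \<in> products b (A - {i}) (B - {k, j} - {c})"
    | r where "r \<in> A - {i}" "y \<in> products b (A - {i} - {r}) (B - {k, j})"
    using assms(1) unfolding near_products_def by blast
  then show ?thesis
  proof cases
    case 1
    have "B - {k, j} - {c} = B - {c} - {k, j}"
      by auto
    with 1(2) have "y \<in> products b (A - {i}) (B - {c} - {k, j})"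
      by simp
    then have "pair b i j k y \<in> products b A (B - {c})"
      by (rule pair_products) (use 1(1) assms in blast)+
    then show ?thesis
      using 1(1) unfolding near_products_def by blast
  next
    case 2
    have "A - {i} - {r} = A - {r} - {i}"
      by auto
    with 2(2) have "y \<in> products b (A - {r} - {i}) (B - {k, j})"
      by simp
    then have "pair b i j k y \<in> products b (A - {r}) B"
      by (rule pair_products) (use 2(1) assms in blast)+
    then show ?thesis
      using 2(1) unfolding near_products_def by blast
  qed
qed

text \<open>
  The induction step shared by the three generation theorems: if the cycles on the smaller boards
  are generated by a family that is closed under joins with 0-spheres, then so are the star
  generators.
\<close>

lemma star_step:
  assumes row: "\<And>b A B i j k y. i \<in> A \<Longrightarrow> j \<in> B \<Longrightarrow> k \<in> B \<Longrightarrow> j \<noteq> k \<Longrightarrow>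
      y \<in> P b (A - {i}) (B - {k, j}) \<Longrightarrow> pair b i j k y \<in> P b A B"
    and transpose: "\<And>b A B. P (\<not> b) B A = P b A B"
    and ij: "i0 \<in> A" "j0 \<in> B" and x: "x \<in> star_gens b A B i0 j0 n"
    and IHrow: "\<And>j y. j \<in> B - {j0} \<Longrightarrow> y \<in> Zc b (A - {i0}) (B - {j0, j}) n \<Longrightarrow>
      y \<in> gen (P b (A - {i0}) (B - {j0, j}) \<union> Bd b (A - {i0}) (B - {j0, j}) n)"
    and IHcol: "\<And>i y. i \<in> A - {i0} \<Longrightarrow> y \<in> Zc b (A - {i0, i}) (B - {j0}) n \<Longrightarrow>
      y \<in> gen (P b (A - {i0, i}) (B - {j0}) \<union> Bd b (A - {i0, i}) (B - {j0}) n)"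
  shows "x \<in> gen (P b A B \<union> Bd b A B (Suc n))"
  using x
proof (cases rule: star_gens_cases)
  case (row j y)
  show ?thesis
    unfolding row(3)
  proof (rule gen_image [OF IHrow [OF row(1,2)]])
    fix u assume "u \<in> P b (A - {i0}) (B - {j0, j}) \<union> Bd b (A - {i0}) (B - {j0, j}) n"
    then show "pair b i0 j j0 u \<in> gen (P b A B \<union> Bd b A B (Suc n))"
      using assms(1) [of i0 A j B j0 u b] pair_in_Bd' [of u b A i0 B j0 j n] row(1) ij
      by (intro gen_base) auto
  qed simp
next
  case (col i y)
  show ?thesis
    unfolding col(3)
  proof (rule gen_image [OF IHcol [OF col(1,2)]])
    fix u assume "u \<in> P b (A - {i0, i}) (B - {j0}) \<union> Bd b (A - {i0, i}) (B - {j0}) n"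
    then show "pair (\<not> b) j0 i i0 u \<in> gen (P b A B \<union> Bd b A B (Suc n))"
      using assms(1) [of j0 B i A i0 u "\<not> b"] col_pair_in_Bd' [of u b A i0 i B j0 n] col(1) ij
      unfolding transpose by (intro gen_base) auto
  qed simp
qed

text \<open>
  This is the reason why the part with two rooks next to the corner can be removed if
  \<open>card A + card B\<close> is \<open>3 (s + 2)\<close> or \<open>3 (s + 2) + 1\<close>; one line less and the coefficients are no
  longer in the vanishing range.
\<close>

lemma vanishing_corner:
  assumes "finite A" "finite B" "i0 \<in> A" "j0 \<in> B" "i \<in> A - {i0}" "j \<in> B - {j0}"
    and "s + 2 < card A" "s + 2 < card B" "3 * s + 6 \<le> card A + card B"
    and "x \<in> Zc b (A - {i0, i}) (B - {j0, j}) s"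
  shows "x \<in> Bd b (A - {i0, i}) (B - {j0, j}) s"
  using card_Diff2 [of A i0 i] card_Diff2 [of B j0 j] assms by (intro vanishing) auto

text \<open>
  The induction ends at the boards with exactly twice as many columns as rows, or the other way
  round, where the cycles are top-dimensional.
\<close>

theorem cycles_gen_products:
  assumes "finite A" "finite B" "card A + card B = 3 * s" "card A \<le> 2 * card B" "card B \<le> 2 * card A"
    and "z \<in> Zc b A B s"
  shows "z \<in> gen (products b A B \<union> Bd b A B s)"
  using assms
proof (induction s arbitrary: A B z)
  case 0
  then have "z \<in> gen (sph b 0 0 A B)"
    by (intro top_cycles(1)) auto
  then show ?case
    by (rule gen_mono) (auto simp: products_def)
next
  case (Suc n)
  consider "card B = 2 * card A" | "card A = 2 * card B" | "card A < 2 * card B" "card B < 2 * card A"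
    using Suc.prems by linarith
  then show ?case
  proof cases
    case 1
    then have "card A = Suc n"
      using Suc.prems by simp
    then have "z \<in> gen (sph b (Suc n) 0 A B)"
      using Suc.prems 1 by (intro top_cycles(1)) auto
    then show ?thesis
      by (rule gen_mono) (auto simp: products_def)
  next
    case 2
    then have "card B = Suc n"
      using Suc.prems by simp
    then have "z \<in> gen (sph (\<not> b) (Suc n) 0 B A)"
      using Suc.prems 2 by (intro top_cycles(1)) (auto simp: Zc_transpose)
    then show ?thesis
      unfolding sph_transpose by (rule gen_mono) (auto simp: products_def)
  next
    case 3
    have "A \<noteq> {}" "B \<noteq> {}"
      using 3 by auto
    then obtain i0 j0 where ij: "i0 \<in> A" "j0 \<in> B"
      by blast
    have "Suc n < card A"
      using 3 Suc.prems(3) by simp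
    moreover have "Suc n < card B"
      using 3 Suc.prems(3) by simp
    ultimately have "card B + 3 \<le> 2 * card A" "card A + 3 \<le> 2 * card B"
      using Suc.prems(3) by simp_all
    note card = this
    have "z \<in> gen (star_gens b A B i0 j0 n \<union> Bd b A B (Suc n))"
      by (rule star_generation [OF Suc.prems(1,2) ij Suc.prems(6)], rule vanishing_corner)
        (use Suc.prems ij card in auto)
    then show ?thesis
    proof (rule gen_mono_gen)
      fix x assume "x \<in> star_gens b A B i0 j0 n \<union> Bd b A B (Suc n)"
      moreover have "x \<in> gen (products b A B \<union> Bd b A B (Suc n))" if "x \<in> star_gens b A B i0 j0 n"
      proof (rule star_step [where P = products, OF _ products_transpose ij that])
        fix j y assume "j \<in> B - {j0}" "y \<in> Zc b (A - {i0}) (B - {j0, j}) n"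
        then show "y \<in> gen (products b (A - {i0}) (B - {j0, j}) \<union> Bd b (A - {i0}) (B - {j0, j}) n)"
          using Suc.prems ij card card_Diff2 [of B j0 j] by (intro Suc.IH) auto
      next
        fix i y assume "i \<in> A - {i0}" "y \<in> Zc b (A - {i0, i}) (B - {j0}) n"
        then show "y \<in> gen (products b (A - {i0, i}) (B - {j0}) \<union> Bd b (A - {i0, i}) (B - {j0}) n)"
          using Suc.prems ij card card_Diff2 [of A i0 i] by (intro Suc.IH) auto
      qed (rule pair_products)
      ultimately show "x \<in> gen (products b A B \<union> Bd b A B (Suc n))"
        by (blast intro: gen_base)
    qed
  qed
qed

lemma top_cycles_near_products:
  assumes "finite A" "finite B" "card B = Suc (2 * card A)" "z \<in> Zc b A B (card A)"
  shows "z \<in> gen (near_products b A B)"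
proof -
  have "z \<in> gen (\<Union>k\<in>B. Zc b A (B - {k}) (card A))"
    using assms by (intro top_cycles_avoid_column) auto
  then show ?thesis
  proof (rule gen_mono_gen)
    fix y assume "y \<in> (\<Union>k\<in>B. Zc b A (B - {k}) (card A))"
    then obtain k where k: "k \<in> B" and y: "y \<in> Zc b A (B - {k}) (card A)"
      by (rule UN_E)
    have "y \<in> gen (sph b (card A) 0 A (B - {k}))"
      using assms k y by (intro top_cycles(1)) auto
    then show "y \<in> gen (near_products b A B)"
      by (rule gen_mono) (use k in \<open>auto simp: near_products_def products_def\<close>)
  qed
qed

text \<open>
  The same induction as for \<open>cycles_gen_products\<close>; at the end there is one line more than double,
  and by \<open>top_cycles_avoid_column\<close> one line is spare.
\<close>

theorem cycles_gen_near_products: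
  assumes "finite A" "finite B" "card A + card B = 3 * s + 1"
    and "card A \<le> 2 * card B + 1" "card B \<le> 2 * card A + 1" and "z \<in> Zc b A B s"
  shows "z \<in> gen (near_products b A B \<union> Bd b A B s)"
  using assms
proof (induction s arbitrary: A B z)
  case 0
  show ?case
  proof (cases "card A = 0")
    case True
    with 0 have "z \<in> gen (near_products b A B)"
      by (intro top_cycles_near_products) simp_all
    then show ?thesis
      by (rule gen_mono) blast
  next
    case False
    with 0(3) have "card B = 0" "card A = Suc (2 * card B)"
      by linarith+
    with 0 have "z \<in> gen (near_products (\<not> b) B A)"
      by (intro top_cycles_near_products) (simp_all add: Zc_transpose)
    then show ?thesis
      unfolding near_products_transpose by (rule gen_mono) blast
  qed
next
  case (Suc n)
  consider "card B = Suc (2 * card A)" | "card A = Suc (2 * card B)"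
    | "card A < 2 * card B + 1" "card B < 2 * card A + 1"
    using Suc.prems by linarith
  then show ?case
  proof cases
    case 1
    then have "card A = Suc n"
      using Suc.prems by simp
    then have "z \<in> gen (near_products b A B)"
      using Suc.prems 1 by (intro top_cycles_near_products) auto
    then show ?thesis
      by (rule gen_mono) blast
  next
    case 2
    then have "card B = Suc n"
      using Suc.prems by simp
    then have "z \<in> gen (near_products (\<not> b) B A)"
      using Suc.prems 2 by (intro top_cycles_near_products) (auto simp: Zc_transpose)
    then show ?thesis
      unfolding near_products_transpose by (rule gen_mono) blast
  next
    case 3
    have "Suc n < card A"
      using 3 Suc.prems(3) by simp
    moreover have "Suc n < card B"
      using 3 Suc.prems(3) by simp
    ultimately have "card B + 2 \<le> 2 * card A" "card A + 2 \<le> 2 * card B"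
      using Suc.prems(3) by simp_all
    note card = this
    then have "A \<noteq> {}" "B \<noteq> {}"
      by auto
    then obtain i0 j0 where ij: "i0 \<in> A" "j0 \<in> B"
      by blast
    have "z \<in> gen (star_gens b A B i0 j0 n \<union> Bd b A B (Suc n))"
      by (rule star_generation [OF Suc.prems(1,2) ij Suc.prems(6)], rule vanishing_corner)
        (use Suc.prems ij card in auto)
    then show ?thesis
    proof (rule gen_mono_gen)
      fix x assume "x \<in> star_gens b A B i0 j0 n \<union> Bd b A B (Suc n)"
      moreover have "x \<in> gen (near_products b A B \<union> Bd b A B (Suc n))" if "x \<in> star_gens b A B i0 j0 n"
      proof (rule star_step [where P = near_products, OF _ near_products_transpose ij that])
        fix j y assume "j \<in> B - {j0}" "y \<in> Zc b (A - {i0}) (B - {j0, j}) n"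
        then show "y \<in> gen (near_products b (A - {i0}) (B - {j0, j}) \<union> Bd b (A - {i0}) (B - {j0, j}) n)"
          using Suc.prems ij card card_Diff2 [of B j0 j] by (intro Suc.IH) auto
      next
        fix i y assume "i \<in> A - {i0}" "y \<in> Zc b (A - {i0, i}) (B - {j0}) n"
        then show "y \<in> gen (near_products b (A - {i0, i}) (B - {j0}) \<union> Bd b (A - {i0, i}) (B - {j0}) n)"
          using Suc.prems ij card card_Diff2 [of A i0 i] by (intro Suc.IH) auto
      qed (rule pair_near_products)
      ultimately show "x \<in> gen (near_products b A B \<union> Bd b A B (Suc n))"
        by (blast intro: gen_base)
    qed
  qed
qed

section \<open>Three-torsion\<close>

text \<open>
  Two non-attacking positions, both compatible with \<open>x\<close>, are the ends of an edge.
\<close>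

lemma exchange_move:
  assumes "x \<in> Zc b X Y s" "i \<notin> X" "r \<notin> X" "i \<noteq> r" "j \<notin> Y" "k \<notin> Y" "j \<noteq> k"
    and "X \<union> {i, r} \<subseteq> A" "Y \<union> {j, k} \<subseteq> B"
  shows "wedge (pt b r j) x - wedge (pt b i k) x \<in> Bd b A B (Suc s)"
proof -
  have "wedge (pt b i k) x \<in> Ch b (insert i X) (insert k Y) (Suc s)"
    using assms by (intro wedge_in_Ch Zc_Ch)
  then have "wedge (pt b r j) (wedge (pt b i k) x) \<in> Ch b (insert r (insert i X)) (insert j (insert k Y)) (Suc (Suc s))"
    by (rule wedge_in_Ch) (use assms in auto)
  then have "wedge (pt b r j) (wedge (pt b i k) x) \<in> Ch b A B (Suc (Suc s))"
    by (rule Ch_mono) (use assms in auto)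
  moreover have "bd (wedge (pt b r j) (wedge (pt b i k) x)) = wedge (pt b i k) x - wedge (pt b r j) x"
    using Zc_finitary [OF assms(1)] Zc_bd [OF assms(1)]
      Ch_finitary [OF \<open>wedge (pt b i k) x \<in> _\<close>] by (simp add: bd_wedge)
  ultimately have "wedge (pt b i k) x - wedge (pt b r j) x \<in> Bd b A B (Suc s)"
    using BdI by metis
  from Bd_minus [OF this] show ?thesis
    by simp
qed

text \<open>
  In a \<open>2 \<times> 2\<close> board the 0-sphere in a row is homologous to the 0-sphere in a column, so
  that a spare row can be traded for a spare column.
\<close>

lemma row_pair_to_col_pair:
  assumes "x \<in> Zc b X Y s" "i \<notin> X" "r \<notin> X" "i \<noteq> r" "j \<notin> Y" "k \<notin> Y" "j \<noteq> k"
    and "X \<union> {i, r} \<subseteq> A" "Y \<union> {j, k} \<subseteq> B"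
  shows "pair b i j k x - pair (\<not> b) j i r x \<in> Bd b A B (Suc s)"
  using exchange_move [OF assms] by (simp add: pair_def)

text \<open>
  Trading twice exchanges the column \<open>j\<close> of a column sphere with a spare column \<open>k\<close>, at the cost
  of a sign.
\<close>

lemma col_pair_swap_spare:
  assumes "x \<in> Zc b X Y s" "i \<notin> X" "r \<notin> X" "i \<noteq> r" "j \<notin> Y" "k \<notin> Y" "j \<noteq> k"
    and "X \<union> {i, r} \<subseteq> A" "Y \<union> {j, k} \<subseteq> B"
  shows "pair (\<not> b) j i r x + pair (\<not> b) k i r x \<in> Bd b A B (Suc s)"
proof -
  have "pair b i j k x - pair (\<not> b) j i r x + (pair b i k j x - pair (\<not> b) k i r x) \<in> Bd b A B (Suc s)"
    using assms by (intro Bd_add row_pair_to_col_pair [of x b X Y s]) auto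
  then have "- (pair b i j k x - pair (\<not> b) j i r x + (pair b i k j x - pair (\<not> b) k i r x)) \<in> Bd b A B (Suc s)"
    by (rule Bd_minus)
  then show ?thesis
    by (simp add: pair_swap [of b i k j] add.commute)
qed

text \<open>
  The join of \<open>w\<close> with three spheres on five rows and four columns, the row sphere at \<open>j\<close>, \<open>k\<close>
  being the centre of attention and the column spheres at \<open>x\<close> and \<open>y\<close> its partners. There will be
  one spare column \<open>l\<close>.
\<close>

definition torsion_cycle :: "bool \<Rightarrow> nat \<Rightarrow> nat \<Rightarrow> nat \<Rightarrow> nat \<Rightarrow> nat \<Rightarrow> nat \<Rightarrow> chain \<Rightarrow> nat \<Rightarrow> nat \<Rightarrow> nat \<Rightarrow> chain"
  where "torsion_cycle b r1 r2 r3 r4 r5 x w j k y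
    = pair (\<not> b) x r1 r5 (pair b r2 j k (pair (\<not> b) y r3 r4 w))"

context
  fixes b :: bool and A0 B0 A B :: "nat set" and w :: chain and s :: nat
    and r1 r2 r3 r4 r5 x :: nat
  assumes w: "w \<in> Zc b A0 B0 s"
    and rows: "distinct [r1, r2, r3, r4, r5]" "{r1, r2, r3, r4, r5} \<inter> A0 = {}" "A0 \<union> {r1, r2, r3, r4, r5} \<subseteq> A"
begin

abbreviation cyc :: "nat \<Rightarrow> nat \<Rightarrow> nat \<Rightarrow> chain"
  where "cyc \<equiv> torsion_cycle b r1 r2 r3 r4 r5 x w"

lemma w_col_pair:
  "z \<in> Zc b X Y t \<Longrightarrow> j \<notin> Y \<Longrightarrow> i \<notin> X \<Longrightarrow> k \<notin> X \<Longrightarrow>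
    pair (\<not> b) j i k z \<in> Zc b (insert i (insert k X)) (insert j Y) (Suc t)"
  using pair_in_Zc [of z "\<not> b" Y X t j i k] by (simp add: Zc_transpose)

lemma torsion_swap_spare:
  assumes cols: "distinct [j, k, l, x, y]" "{j, k, l, x, y} \<inter> B0 = {}" "B0 \<union> {j, k, l, x, y} \<subseteq> B"
  shows "cyc j k y + cyc j k l \<in> Bd b A B (Suc (Suc (Suc s)))"
proof -
  let ?v = "pair (\<not> b) x r1 r5 (pair b r2 j k w)"
  have v: "?v \<in> Zc b (insert r1 (insert r5 (insert r2 A0))) (insert x (insert j (insert k B0))) (Suc (Suc s))"
    using rows cols by (intro w_col_pair pair_in_Zc w) auto
  have "cyc j k y' = pair (\<not> b) y' r3 r4 ?v" for y'
    unfolding torsion_cycle_def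
    by (subst pair_pair [of "\<not> b" y'], subst pair_pair [of "\<not> b" y']) simp
  then show ?thesis
    using col_pair_swap_spare [OF v, of r3 r4 y l A B] rows cols by auto
qed

text \<open>
  Exchanging the columns \<open>k\<close> and \<open>y\<close>, which both belong to the join. The spare column \<open>l\<close> is
  traded for the spare row \<open>r5\<close>, so that the column sphere at \<open>x\<close> becomes a row sphere; then the
  row sphere at \<open>j\<close>, \<open>k\<close> becomes a column sphere with spare column \<open>k\<close>, which is exchanged with
  \<open>y\<close>.
\<close>

lemma torsion_swap_col:
  assumes cols: "distinct [j, k, l, x, y]" "{j, k, l, x, y} \<inter> B0 = {}" "B0 \<union> {j, k, l, x, y} \<subseteq> B"
  shows "cyc j k y + cyc j y k \<in> Bd b A B (Suc (Suc (Suc s)))"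
proof -
  let ?Bd = "Bd b A B (Suc (Suc (Suc s)))"
  have a: "pair b r1 x l (pair b r2 j k' (pair (\<not> b) y' r3 r4 w)) - cyc j k' y' \<in> ?Bd"
    if k': "{k', y'} = {k, y}" for k' y'
  proof -
    have "k' \<noteq> y'" "{j, k', l, x, y'} = {j, k, l, x, y}" "distinct [j, k', l, x, y']"
      using k' cols(1) by (auto simp: doubleton_eq_iff)
    note cols' = this cols(2,3)
    have "pair b r2 j k' (pair (\<not> b) y' r3 r4 w)
        \<in> Zc b (insert r2 (insert r3 (insert r4 A0))) (insert j (insert k' (insert y' B0))) (Suc (Suc s))"
      using rows cols' by (intro w_col_pair pair_in_Zc w) auto
    then show ?thesis
      unfolding torsion_cycle_def using rows cols' by (intro row_pair_to_col_pair) auto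
  qed
  have c: "pair b r2 j k' (pair b r1 x l (pair (\<not> b) y' r3 r4 w))
      - pair (\<not> b) j r2 r5 (pair b r1 x l (pair (\<not> b) y' r3 r4 w)) \<in> ?Bd"
    if k': "{k', y'} = {k, y}" for k' y'
  proof -
    have "k' \<noteq> y'" "{j, k', l, x, y'} = {j, k, l, x, y}" "distinct [j, k', l, x, y']"
      using k' cols(1) by (auto simp: doubleton_eq_iff)
    note cols' = this cols(2,3)
    have "pair b r1 x l (pair (\<not> b) y' r3 r4 w)
        \<in> Zc b (insert r1 (insert r3 (insert r4 A0))) (insert x (insert l (insert y' B0))) (Suc (Suc s))"
      using rows cols' by (intro w_col_pair pair_in_Zc w) auto
    then show ?thesis
      using rows cols' by (intro row_pair_to_col_pair) auto
  qed
  have d: "pair (\<not> b) y r3 r4 (pair (\<not> b) j r2 r5 (pair b r1 x l w))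
      + pair (\<not> b) k r3 r4 (pair (\<not> b) j r2 r5 (pair b r1 x l w)) \<in> ?Bd"
  proof -
    have "pair (\<not> b) j r2 r5 (pair b r1 x l w)
        \<in> Zc b (insert r2 (insert r5 (insert r1 A0))) (insert j (insert x (insert l B0))) (Suc (Suc s))"
      using rows cols by (intro w_col_pair pair_in_Zc w) auto
    then show ?thesis
      using rows cols by (intro col_pair_swap_spare) auto
  qed
  have e: "pair (\<not> b) j r2 r5 (pair b r1 x l (pair (\<not> b) y' r3 r4 w))
      = pair (\<not> b) y' r3 r4 (pair (\<not> b) j r2 r5 (pair b r1 x l w))" for y'
    by (subst pair_pair [of b r1], simp, subst pair_pair [of "\<not> b" j], simp)
  have f: "pair b r2 j k' (pair b r1 x l v) = - pair b r1 x l (pair b r2 j k' v)" for k' v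
    by (rule pair_pair)
  let ?u = "\<lambda>k' y'. pair b r1 x l (pair b r2 j k' (pair (\<not> b) y' r3 r4 w))"
  let ?d = "\<lambda>y'. pair (\<not> b) y' r3 r4 (pair (\<not> b) j r2 r5 (pair b r1 x l w))"
  have a1: "?u k y - cyc j k y \<in> ?Bd" and a2: "?u y k - cyc j y k \<in> ?Bd"
    by (rule a; auto)+
  have c1: "- ?u k y - ?d y \<in> ?Bd" and c2: "- ?u y k - ?d k \<in> ?Bd"
    using c [of k y] c [of y k] unfolding e f by auto
  have "- ((- ?u k y - ?d y) + (- ?u y k - ?d k) + (?d y + ?d k)
      + (?u k y - cyc j k y) + (?u y k - cyc j y k)) \<in> ?Bd"
    by (rule Bd_minus [OF Bd_add [OF Bd_add [OF Bd_add [OF Bd_add [OF c1 c2] d] a1] a2]])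
  moreover have "- ((- ?u k y - ?d y) + (- ?u y k - ?d k) + (?d y + ?d k)
      + (?u k y - cyc j k y) + (?u y k - cyc j y k))
    = cyc j k y + cyc j y k"
    by simp
  ultimately show ?thesis
    by (simp only:)
qed

lemma torsion_shift:
  assumes cols: "distinct [j, k, l, x, y]" "{j, k, l, x, y} \<inter> B0 = {}" "B0 \<union> {j, k, l, x, y} \<subseteq> B"
  shows "cyc j k y + cyc j l y \<in> Bd b A B (Suc (Suc (Suc s)))"
proof -
  have 1: "cyc j k y + cyc j k l \<in> Bd b A B (Suc (Suc (Suc s)))"
    by (rule torsion_swap_spare [OF cols])
  have 2: "cyc j k l + cyc j l k \<in> Bd b A B (Suc (Suc (Suc s)))"
    by (rule torsion_swap_col [of j k y l]) (use cols in auto)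
  have 3: "cyc j l k + cyc j l y \<in> Bd b A B (Suc (Suc (Suc s)))"
    by (rule torsion_swap_spare) (use cols in auto)
  from Bd_add [OF Bd_diff [OF 1 2] 3] show ?thesis
    by (simp add: add.commute)
qed

text \<open>
  Write \<open>c j k\<close> for the class of the join with fixed \<open>y\<close>. The three classes \<open>c j k\<close>, \<open>c k l\<close>,
  \<open>c l j\<close> add up to zero, since the spheres do, and by \<open>torsion_shift\<close> they are all equal.
\<close>

lemma three_torsion_cycle:
  assumes cols: "distinct [j, k, l, x, y]" "{j, k, l, x, y} \<inter> B0 = {}" "B0 \<union> {j, k, l, x, y} \<subseteq> B"
  shows "frag_cmul 3 (cyc j k y) \<in> Bd b A B (Suc (Suc (Suc s)))"
proof -
  have lin: "cyc k j y = - cyc j k y"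
    "cyc j l y = cyc j k y + cyc k l y"
    by (simp_all add: torsion_cycle_def pair_def [of b])
  \<comment> \<open>by \<open>lin\<close> the left-hand side is three times \<open>cyc j k y\<close>\<close>
  have "(cyc j k y + cyc j l y) - (cyc k j y + cyc k l y)
      \<in> Bd b A B (Suc (Suc (Suc s)))"
    using cols by (intro Bd_diff torsion_shift) auto
  moreover have "frag_cmul 3 c = c + c + c" for c :: chain
    using frag_cmul_distrib [of 1 2 c] frag_cmul_distrib [of 1 1 c] by simp
  ultimately show ?thesis
    using lin by (simp add: add.assoc)
qed

end

lemma sph_minus: "x \<in> sph b p q A B \<Longrightarrow> - x \<in> sph b p q A B"
  unfolding sph_def using ssph.neg by blast

lemma sph_col_pairE:
  assumes "x \<in> sph b p (Suc q) A B"
  obtains j i i' y where "j \<in> B" "i \<in> A" "i' \<in> A" "i \<noteq> i'" "y \<in> sph b p q (A - {i, i'}) (B - {j})"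
    "x = pair (\<not> b) j i i' y"
proof -
  have "x \<in> sph (\<not> b) (Suc q) p B A"
    using assms by (simp add: sph_transpose)
  then show ?thesis
    by (rule sph_pairE) (use that in \<open>auto simp: sph_transpose\<close>)
qed

lemma three_kills_near_product:
  assumes x: "x \<in> sph b p q A (B - {l})" and l: "l \<in> B" and pq: "1 \<le> p" "2 \<le> q"
  shows "frag_cmul 3 x \<in> Bd b A B (p + q)"
proof -
  obtain p' q' where p: "p = Suc p'" and q: "q = Suc (Suc q')"
    using pq by (metis Suc_le_D Suc_le_mono One_nat_def numeral_2_eq_2)
  let ?B = "B - {l}"
  from x [unfolded p] obtain r2 j k x1 where 1: "r2 \<in> A" "j \<in> ?B" "k \<in> ?B" "j \<noteq> k"
    and x1: "x1 \<in> sph b p' q (A - {r2}) (?B - {j, k})" and x_eq: "x = pair b r2 j k x1"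
    by (rule sph_pairE)
  from x1 [unfolded q] obtain c r1 r5 x2 where 2: "c \<in> ?B - {j, k}" "r1 \<in> A - {r2}" "r5 \<in> A - {r2}" "r1 \<noteq> r5"
    and x2: "x2 \<in> sph b p' (Suc q') (A - {r2} - {r1, r5}) (?B - {j, k} - {c})"
    and x1_eq: "x1 = pair (\<not> b) c r1 r5 x2"
    by (rule sph_col_pairE)
  from x2 obtain y r3 r4 w where 3: "y \<in> ?B - {j, k} - {c}" "r3 \<in> A - {r2} - {r1, r5}" "r4 \<in> A - {r2} - {r1, r5}"
    "r3 \<noteq> r4"
    and w: "w \<in> sph b p' q' (A - {r2} - {r1, r5} - {r3, r4}) (?B - {j, k} - {c} - {y})"
    and x2_eq: "x2 = pair (\<not> b) y r3 r4 w"
    by (rule sph_col_pairE)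
  have x_minus: "x = - pair (\<not> b) c r1 r5 (pair b r2 j k (pair (\<not> b) y r3 r4 w))"
    unfolding x_eq x1_eq x2_eq by (rule pair_pair)
  have "frag_cmul 3 (torsion_cycle b r1 r2 r3 r4 r5 c w j k y) \<in> Bd b A B (Suc (Suc (Suc (p' + q'))))"
  proof (rule three_torsion_cycle [OF sph_Zc [OF w]])
    show "distinct [r1, r2, r3, r4, r5]" "distinct [j, k, l, c, y]"
      using 1 2 3 by auto
  qed (use 1 2 3 l in auto)
  then have "- frag_cmul 3 (torsion_cycle b r1 r2 r3 r4 r5 c w j k y) \<in> Bd b A B (p + q)"
    unfolding p q using Bd_minus by fastforce
  then show ?thesis
    unfolding x_minus by (simp only: torsion_cycle_def frag_cmul_minus)
qed

text \<open>
  By the bounds each generating join has the one row sphere and two column spheres (or,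
  transposed, one column sphere and two row spheres) that make a torsion cycle.
\<close>

theorem three_kills:
  assumes "finite A" "finite B" "card A + card B = 3 * s + 1" "card A + 5 \<le> 2 * card B" "card B + 5 \<le> 2 * card A"
    and "z \<in> Zc b A B s"
  shows "frag_cmul 3 z \<in> Bd b A B s"
proof -
  have "z \<in> gen (near_products b A B \<union> Bd b A B s)"
    using assms by (intro cycles_gen_near_products) auto
  then have "frag_cmul 3 z \<in> gen (Bd b A B s)"
  proof (rule gen_image)
    fix x assume "x \<in> near_products b A B \<union> Bd b A B s"
    then consider "x \<in> Bd b A B s" | c p q where "c \<in> B" "x \<in> sph b p q A (B - {c})"
      | r p q where "r \<in> A" "x \<in> sph b p q (A - {r}) B"
      unfolding near_products_def products_def by blast
    then have "frag_cmul 3 x \<in> Bd b A B s"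
    proof cases
      case 1
      then show ?thesis
        by (rule Bd_cmul)
    next
      case (2 c p q)
      have "card A = p + 2 * q" "card B = Suc (2 * p + q)"
        using sph_card [OF 2(2)] card_Suc_Diff1 [OF assms(2) 2(1)] by linarith+
      then have "1 \<le> p" "2 \<le> q" "p + q = s"
        using assms by linarith+
      then show ?thesis
        using three_kills_near_product [OF 2(2,1)] by simp
    next
      case (3 r p q)
      have "card B = 2 * p + q" "card A = Suc (p + 2 * q)"
        using sph_card [OF 3(2)] card_Suc_Diff1 [OF assms(1) 3(1)] by linarith+
      then have "1 \<le> q" "2 \<le> p" "p + q = s"
        using assms by linarith+
      then show ?thesis
        using three_kills_near_product [of x "\<not> b" q p B A r] 3
        by (simp add: sph_transpose Bd_transpose add.commute)
    qed
    then show "frag_cmul 3 x \<in> gen (Bd b A B s)"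
      by (rule gen_base)
  qed (simp add: frag_cmul_distrib2)
  then show ?thesis
    by (rule gen_subset_Bd) auto
qed

section \<open>Joins with a small cycle\<close>

text \<open>
  What is needed of the join with a fixed cycle of \<open>n\<close> rooks on the board \<open>A0 \<times> B0\<close>: the
  join commutes up to the sign \<open>(-1)^n\<close> with wedges and boundaries. In this form the hexagon and
  the \<open>4 \<times> 4\<close> cycle below are treated alike, and no product of chains is necessary.
\<close>

definition cycle_op :: "bool \<Rightarrow> nat set \<Rightarrow> nat set \<Rightarrow> nat \<Rightarrow> (chain \<Rightarrow> chain) \<Rightarrow> bool"
  where "cycle_op b A0 B0 n W \<longleftrightarrow> (\<forall>x y. W (x + y) = W x + W y) \<and>
    (\<forall>k x. W (frag_cmul k x) = frag_cmul k (W x)) \<and>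
    (\<forall>v x. W (wedge v x) = frag_cmul ((-1) ^ n) (wedge v (W x))) \<and>
    (\<forall>x. finitary x \<longrightarrow> bd (W x) = frag_cmul ((-1) ^ n) (W (bd x))) \<and>
    (\<forall>A B s x. A0 \<inter> A = {} \<longrightarrow> B0 \<inter> B = {} \<longrightarrow> x \<in> Ch b A B s \<longrightarrow> W x \<in> Ch b (A0 \<union> A) (B0 \<union> B) (s + n))"

lemma cycle_op_transpose: "cycle_op (\<not> b) B0 A0 n W \<longleftrightarrow> cycle_op b A0 B0 n W"
  unfolding cycle_op_def Ch_transpose by (intro conj_cong refl) blast

lemma cycle_opD:
  assumes "cycle_op b A0 B0 n W"
  shows "W (x + y) = W x + W y" "W (frag_cmul k x) = frag_cmul k (W x)"
    "W (wedge v x) = frag_cmul ((-1) ^ n) (wedge v (W x))"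
    "finitary x \<Longrightarrow> bd (W x) = frag_cmul ((-1) ^ n) (W (bd x))"
    "A0 \<inter> A = {} \<Longrightarrow> B0 \<inter> B = {} \<Longrightarrow> x \<in> Ch b A B s \<Longrightarrow> W x \<in> Ch b (A0 \<union> A) (B0 \<union> B) (s + n)"
  using assms unfolding cycle_op_def by (cases v, simp)+

lemma cycle_op_minus: "cycle_op b A0 B0 n W \<Longrightarrow> W (- x) = - W x"
  using cycle_opD(2) [of b A0 B0 n W "-1" x] by simp

lemma cycle_op_pair:
  assumes "cycle_op b A0 B0 n W"
  shows "W (pair b' i j k x) = frag_cmul ((-1) ^ n) (pair b' i j k (W x))"
  using cycle_opD(1) [OF assms, of "wedge (pt b' i j) x" "- wedge (pt b' i k) x"] cycle_op_minus [OF assms]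
    cycle_opD(3) [OF assms] by (simp add: pair_def frag_cmul_diff_distrib2)

lemma cycle_op_Zc:
  assumes "cycle_op b A0 B0 n W" "A0 \<inter> A = {}" "B0 \<inter> B = {}" "x \<in> Zc b A B s"
  shows "W x \<in> Zc b (A0 \<union> A) (B0 \<union> B) (s + n)"
proof -
  have "W 0 = 0"
    using cycle_opD(2) [OF assms(1), of 0 0] by simp
  then show ?thesis
    using cycle_opD(4,5) [OF assms(1)] assms(2-4) Zc_finitary [OF assms(4)] by (auto simp: Zc_def)
qed

lemma cycle_op_Bd:
  assumes "cycle_op b A0 B0 n W" "A0 \<inter> A = {}" "B0 \<inter> B = {}" "x \<in> Bd b A B s"
  shows "W x \<in> Bd b (A0 \<union> A) (B0 \<union> B) (s + n)"
proof -
  obtain c where c: "c \<in> Ch b A B (Suc s)" "x = bd c"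
    using assms(4) by (auto simp: Bd_def)
  have "W c \<in> Ch b (A0 \<union> A) (B0 \<union> B) (Suc (s + n))"
    using cycle_opD(5) [OF assms(1-3) c(1)] by simp
  then have "frag_cmul ((-1) ^ n) (bd (W c)) \<in> Bd b (A0 \<union> A) (B0 \<union> B) (s + n)"
    by (intro Bd_cmul BdI)
  moreover have "frag_cmul ((-1) ^ n) (bd (W c)) = W x"
    unfolding cycle_opD(4) [OF assms(1) Ch_finitary [OF c(1)]] c(2)
    by (simp flip: power_mult_distrib)
  ultimately show ?thesis
    by simp
qed

lemma hexagon_cycle_op:
  assumes "i \<noteq> r" "distinct [j, k, l]"
  shows "cycle_op b {i, r} {j, k, l} 2 (hexagon b i r j k l)"
proof -
  have "hexagon b i r j k l (x + y) = hexagon b i r j k l x + hexagon b i r j k l y"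
    "hexagon b i r j k l (frag_cmul c x) = frag_cmul c (hexagon b i r j k l x)" for x y c
    by (simp_all add: hexagon_def frag_cmul_distrib2)
  moreover have "hexagon b i r j k l x \<in> Ch b ({i, r} \<union> A) ({j, k, l} \<union> B) (s + 2)"
    if "{i, r} \<inter> A = {}" "{j, k, l} \<inter> B = {}" "x \<in> Ch b A B s" for A B s x
    using that assms by (intro hexagon_in_Ch) auto
  ultimately show ?thesis
    unfolding cycle_op_def by (simp add: wedge_hexagon bd_hexagon)
qed

text \<open>
  The path of edges \<open>(p, k)\<close>, \<open>(r, l)\<close>, \<open>(i, k)\<close>, \<open>(p, l)\<close>: it fills the 0-sphere \<open>{k, l}\<close> in row
  \<open>p\<close>, using the two additional rows \<open>i\<close> and \<open>r\<close>.
\<close>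

definition quad_fill :: "bool \<Rightarrow> nat \<Rightarrow> nat \<Rightarrow> nat \<Rightarrow> nat \<Rightarrow> nat \<Rightarrow> chain \<Rightarrow> chain"
  where "quad_fill b i r p k l x = wedge (pt b r l) (wedge (pt b p k) x) + wedge (pt b i k) (wedge (pt b r l) x)
    + wedge (pt b p l) (wedge (pt b i k) x)"

text \<open>
  A cycle on the \<open>4 \<times> 4\<close> board whose coefficient at the two rooks \<open>(i0, j)\<close>, \<open>(i, j0)\<close> is
  the 0-sphere \<open>{k, l}\<close> in row \<open>p\<close>, row \<open>r\<close> being spare. The boundary of the first summand
  consists of this sphere joined with \<open>(i, j0)\<close> and with \<open>(i0, j)\<close>. The second summand moves the
  rook \<open>(i, j0)\<close> along column \<open>j0\<close> to the corner \<open>(i0, j0)\<close>, which is possible because the rest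
  bounds a cone over \<open>(r, j)\<close>; the third moves \<open>(i0, j)\<close> along row \<open>i0\<close> to the corner, where the
  sphere bounds by \<open>quad_fill\<close>.
\<close>

definition quad :: "bool \<Rightarrow> nat \<Rightarrow> nat \<Rightarrow> nat \<Rightarrow> nat \<Rightarrow> nat \<Rightarrow> nat \<Rightarrow> nat \<Rightarrow> nat \<Rightarrow> chain \<Rightarrow> chain"
  where "quad b i0 j0 i j r p k l x = wedge (pt b i0 j) (wedge (pt b i j0) (pair b p k l x))
    + pair (\<not> b) j0 i i0 (wedge (pt b r j) (pair b p k l x)) - pair b i0 j j0 (quad_fill b i r p k l x)"

lemma bd_quad_fill: "finitary x \<Longrightarrow> bd (quad_fill b i r p k l x) = pair b p k l x + quad_fill b i r p k l (bd x)"
  by (simp add: quad_fill_def bd_wedge finitary_wedge pair_def)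

lemma bd_quad: "finitary x \<Longrightarrow> bd (quad b i0 j0 i j r p k l x) = - quad b i0 j0 i j r p k l (bd x)"
proof -
  assume x: "finitary x"
  then have "finitary (quad_fill b i r p k l x)"
    unfolding quad_fill_def by (intro finitary_add finitary_wedge)
  then have "bd (quad b i0 j0 i j r p k l x)
    = wedge (pt b i j0) (pair b p k l x) - wedge (pt b i0 j) (pair b p k l x + wedge (pt b i j0) (pair b p k l (bd x)))
      - pair (\<not> b) j0 i i0 (pair b p k l x + wedge (pt b r j) (pair b p k l (bd x)))
      + pair b i0 j j0 (pair b p k l x + quad_fill b i r p k l (bd x))"
    using x by (simp add: quad_def bd_wedge bd_pair finitary_wedge finitary_pair bd_quad_fill)
  also have "\<dots> = - quad b i0 j0 i j r p k l (bd x)"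
    by (simp add: quad_def pair_def [of _ i0 j j0] pair_def [of _ j0 i i0])
  finally show ?thesis .
qed

lemma wedge_quad: "quad b i0 j0 i j r p k l (wedge v x) = - wedge v (quad b i0 j0 i j r p k l x)"
proof -
  have 1: "wedge u (wedge u' (wedge v x)) = wedge v (wedge u (wedge u' x))" for u u' x
    by (subst wedge_wedge [of u']) (simp, subst wedge_wedge [of u], simp)
  have "quad_fill b i r p k l (wedge v x) = wedge v (quad_fill b i r p k l x)"
    by (simp add: quad_fill_def 1)
  moreover have "pair b p k l (wedge v x) = - wedge v (pair b p k l x)" for b p k l x
    by (simp add: wedge_pair)
  moreover have "pair b' i j k (wedge u (wedge v y)) = wedge v (pair b' i j k (wedge u y))" for b' i j k u y
    by (subst wedge_wedge) (simp add: wedge_pair)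
  ultimately show ?thesis
    by (simp add: quad_def 1)
qed

lemma triple_wedge_in_Ch:
  assumes "x \<in> Ch b A B s" "S \<inter> A = {}" "T \<inter> B = {}" "distinct [a1, a2, a3]" "distinct [b1, b2, b3]"
    and "{a1, a2, a3} \<subseteq> S" "{b1, b2, b3} \<subseteq> T"
  shows "wedge (pt b a1 b1) (wedge (pt b a2 b2) (wedge (pt b a3 b3) x)) \<in> Ch b (S \<union> A) (T \<union> B) (s + 3)"
proof -
  have "wedge (pt b a1 b1) (wedge (pt b a2 b2) (wedge (pt b a3 b3) x))
    \<in> Ch b (insert a1 (insert a2 (insert a3 A))) (insert b1 (insert b2 (insert b3 B))) (Suc (Suc (Suc s)))"
    using assms by (intro wedge_in_Ch) auto
  then have "wedge (pt b a1 b1) (wedge (pt b a2 b2) (wedge (pt b a3 b3) x)) \<in> Ch b (S \<union> A) (T \<union> B) (Suc (Suc (Suc s)))"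
    by (rule Ch_mono) (use assms in auto)
  then show ?thesis
    by (simp add: eval_nat_numeral)
qed

lemma quad_in_Ch:
  assumes "x \<in> Ch b A B s" "{i0, i, r, p} \<inter> A = {}" "{j0, j, k, l} \<inter> B = {}"
    and rows: "distinct [i0, i, r, p]" and cols: "distinct [j0, j, k, l]"
  shows "quad b i0 j0 i j r p k l x \<in> Ch b ({i0, i, r, p} \<union> A) ({j0, j, k, l} \<union> B) (s + 3)"
proof -
  note w3 = triple_wedge_in_Ch [OF assms(1-3)]
  show ?thesis
    unfolding quad_def quad_fill_def pair_def wedge_linear pt_transpose
    by (intro Ch_add Ch_diff w3) (use rows cols in auto)
qed

lemma quad_cycle_op:
  assumes "distinct [i0, i, r, p]" "distinct [j0, j, k, l]"
  shows "cycle_op b {i0, i, r, p} {j0, j, k, l} 3 (quad b i0 j0 i j r p k l)"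
proof -
  have "quad b i0 j0 i j r p k l (x + y) = quad b i0 j0 i j r p k l x + quad b i0 j0 i j r p k l y"
    "quad b i0 j0 i j r p k l (frag_cmul c x) = frag_cmul c (quad b i0 j0 i j r p k l x)" for x y c
    by (simp_all add: quad_def quad_fill_def frag_cmul_distrib2 frag_cmul_diff_distrib2)
  moreover have "quad b i0 j0 i j r p k l x \<in> Ch b ({i0, i, r, p} \<union> A) ({j0, j, k, l} \<union> B) (s + 3)"
    if "{i0, i, r, p} \<inter> A = {}" "{j0, j, k, l} \<inter> B = {}" "x \<in> Ch b A B s" for A B s x
    using that assms by (intro quad_in_Ch) auto
  ultimately show ?thesis
    unfolding cycle_op_def by (simp add: wedge_quad bd_quad)
qed

lemma quad_corner:
  assumes "x \<in> Ch b A B s" "{i0, i, r, p} \<inter> A = {}" "{j0, j, k, l} \<inter> B = {}"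
    and "distinct [i0, i, r, p]" "distinct [j0, j, k, l]" "i' \<noteq> i0" "j' \<noteq> j0"
  shows "contract (pt b i' j0) (contract (pt b i0 j') (quad b i0 j0 i j r p k l x))
    = (if i' = i \<and> j' = j then pair b p k l x else 0)"
proof -
  have c0: "contract (pt b i0 c) x = 0" "contract (pt b c j0) x = 0" for c
    using contract_eq_0 [OF assms(1)] assms(2,3) by auto
  have fin: "finitary x"
    using assms(1) by (rule Ch_finitary)
  have ne: "i \<noteq> i0" "r \<noteq> i0" "p \<noteq> i0" "j \<noteq> j0" "k \<noteq> j0" "l \<noteq> j0"
    "i0 \<noteq> i" "i0 \<noteq> r" "i0 \<noteq> p" "j0 \<noteq> j" "j0 \<noteq> k" "j0 \<noteq> l" "i0 \<noteq> i'" "j0 \<noteq> j'"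
    using assms by auto
  have row: "contract (pt b i0 c) (pair b p k l x) = 0" "contract (pt b i0 c) (quad_fill b i r p k l x) = 0" for c
    using ne by (simp_all add: contract_pair c0 quad_fill_def contract_wedge_pt)
  have col: "contract (pt b c j0) (pair b p k l x) = 0" "contract (pt b c j0) (quad_fill b i r p k l x) = 0" for c
    using ne by (simp_all add: contract_pair c0 quad_fill_def contract_wedge_pt)
  have fq: "finitary (quad_fill b i r p k l x)" "finitary (pair b p k l x)"
    using fin unfolding quad_fill_def by (auto intro: finitary_add finitary_wedge finitary_pair)
  have 1: "contract (pt b i0 j') (wedge (pt b i0 j) (wedge (pt b i j0) (pair b p k l x)))
      = (if j' = j then wedge (pt b i j0) (pair b p k l x) else 0)"
    using ne fq by (simp add: contract_wedge_pt contract_wedge_self row finitary_wedge)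
  have 2: "contract (pt b i0 j') (pair (\<not> b) j0 i i0 (wedge (pt b r j) (pair b p k l x))) = 0"
    using ne assms(7) by (simp add: contract_col_pair contract_wedge_pt row)
  have 3: "contract (pt b i0 j') (pair b i0 j j0 (quad_fill b i r p k l x))
      = (if j' = j then quad_fill b i r p k l x else 0)"
    using ne assms(7) fq by (simp add: pair_def contract_wedge_pt contract_wedge_self row)
  have "contract (pt b i0 j') (quad b i0 j0 i j r p k l x)
      = (if j' = j then wedge (pt b i j0) (pair b p k l x) - quad_fill b i r p k l x else 0)"
    by (simp add: quad_def 1 2 3)
  then show ?thesis
    using fq by (cases "i' = i") (simp_all add: contract_wedge_pt contract_wedge_self col)
qed

text \<open>
  Triples of rows, columns and rooks: the hexagon, its transpose, and the \<open>4 \<times> 4\<close> cycle.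
\<close>

definition op_products :: "bool \<Rightarrow> nat set \<Rightarrow> nat set \<Rightarrow> chain set"
  where "op_products b A B = {W x | W x A0 B0 n p q. cycle_op b A0 B0 n W \<and> A0 \<subseteq> A \<and> B0 \<subseteq> B \<and>
    (card A0, card B0, n) \<in> {(2, 3, 2), (3, 2, 2), (4, 4, 3)} \<and> x \<in> sph b p q (A - A0) (B - B0)}"

lemma op_productsI:
  assumes "cycle_op b A0 B0 n W" "A0 \<subseteq> A" "B0 \<subseteq> B"
    "(card A0, card B0, n) \<in> {(2, 3, 2), (3, 2, 2), (4, 4, 3)}" "x \<in> sph b p q (A - A0) (B - B0)"
  shows "W x \<in> op_products b A B"
  unfolding op_products_def using assms by blast

lemma op_productsE:
  assumes "y \<in> op_products b A B"
  obtains W x A0 B0 n p q where "y = W x" "cycle_op b A0 B0 n W" "A0 \<subseteq> A" "B0 \<subseteq> B"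
    "(card A0, card B0, n) \<in> {(2, 3, 2), (3, 2, 2), (4, 4, 3)}" "x \<in> sph b p q (A - A0) (B - B0)"
  using assms unfolding op_products_def by blast

lemma op_products_transpose: "op_products (\<not> b) B A = op_products b A B"
proof -
  have "op_products b A B \<subseteq> op_products (\<not> b) B A" for b A B
  proof
    fix y assume "y \<in> op_products b A B"
    then obtain W x A0 B0 n p q where "y = W x" "cycle_op b A0 B0 n W" "A0 \<subseteq> A" "B0 \<subseteq> B"
      "(card A0, card B0, n) \<in> {(2, 3, 2), (3, 2, 2), (4, 4, 3)}" "x \<in> sph b p q (A - A0) (B - B0)"
      by (rule op_productsE)
    then show "y \<in> op_products (\<not> b) B A"
      using op_productsI [of "\<not> b" B0 A0 n W B A x q p]
      by (auto simp: cycle_op_transpose sph_transpose)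
  qed
  from this [of b A B] this [of "\<not> b" B A] show ?thesis
    by auto
qed

lemma pair_op_products:
  assumes "y \<in> op_products b (A - {i}) (B - {k, j})" "i \<in> A" "j \<in> B" "k \<in> B" "j \<noteq> k"
  shows "pair b i j k y \<in> op_products b A B"
  using assms(1)
proof (rule op_productsE)
  fix W x A0 B0 n p q
  assume y: "y = W x" and W: "cycle_op b A0 B0 n W" and sub: "A0 \<subseteq> A - {i}" "B0 \<subseteq> B - {k, j}"
    and card: "(card A0, card B0, n) \<in> {(2, 3, 2), (3, 2, 2), (4, 4, 3)}"
    and x: "x \<in> sph b p q (A - {i} - A0) (B - {k, j} - B0)"
  have "A - {i} - A0 = A - A0 - {i}" "B - {k, j} - B0 = B - B0 - {j, k}"
    by auto
  with x have "x \<in> sph b p q (A - A0 - {i}) (B - B0 - {j, k})"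
    by simp
  then have "pair b i j k x \<in> sph b (Suc p) q (A - A0) (B - B0)"
    by (rule sph_pair') (use assms sub in auto)
  then have "frag_cmul ((-1) ^ n) (pair b i j k x) \<in> sph b (Suc p) q (A - A0) (B - B0)"
    using sph_minus by (cases "even n") auto
  then have "W (frag_cmul ((-1) ^ n) (pair b i j k x)) \<in> op_products b A B"
    using op_productsI [OF W _ _ card] sub by blast
  moreover have "W (frag_cmul ((-1) ^ n) (pair b i j k x)) = pair b i j k y"
    unfolding y cycle_opD(2) [OF W] cycle_op_pair [OF W] by (simp flip: power_mult_distrib)
  ultimately show ?thesis
    by simp
qed

lemma op_products_Zc:
  assumes "finite A" "finite B" "card A + card B + 1 = 3 * s" "y \<in> op_products b A B"
  shows "y \<in> Zc b A B s"
  using assms(4)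
proof (rule op_productsE)
  fix W x A0 B0 n p q
  assume y: "y = W x" and W: "cycle_op b A0 B0 n W" and sub: "A0 \<subseteq> A" "B0 \<subseteq> B"
    and card: "(card A0, card B0, n) \<in> {(2, 3, 2), (3, 2, 2), (4, 4, 3)}"
    and x: "x \<in> sph b p q (A - A0) (B - B0)"
  have "card A = card A0 + card (A - A0)" "card B = card B0 + card (B - B0)"
    using sub assms(1,2) by (simp_all add: card_Diff_subset finite_subset card_mono)
  then have s: "p + q + n = s"
    using card sph_card(3,4) [OF x] assms(3) by auto
  have "W x \<in> Zc b (A0 \<union> (A - A0)) (B0 \<union> (B - B0)) (p + q + n)"
    by (rule cycle_op_Zc [OF W _ _ sph_Zc [OF x]]) auto
  then show ?thesis
    using sub y s by (simp add: Un_absorb1)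
qed

lemma hexagon_products_op_products: "hexagon_products b A B \<subseteq> op_products b A B"
proof
  fix y assume "y \<in> hexagon_products b A B"
  then obtain i r j k l x p where ir: "i \<in> A" "r \<in> A" "i \<noteq> r"
    and jkl: "j \<in> B" "k \<in> B" "l \<in> B" "j \<noteq> k" "j \<noteq> l" "k \<noteq> l"
    and x: "x \<in> sph b p 0 (A - {i, r}) (B - {j, k, l})" and y: "y = hexagon b i r j k l x"
    unfolding hexagon_products_def by blast
  have "card {i, r} = 2" "card {j, k, l} = 3"
    using ir jkl by auto
  then show "y \<in> op_products b A B"
    unfolding y using ir jkl x by (intro op_productsI [OF hexagon_cycle_op]) auto
qed

text \<open>
  A coefficient that is a join with spare row \<open>r\<close> contains, by the size of the board, a row
  sphere. Together with this sphere, the two rooks and the spare row extend to \<open>quad\<close>.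
\<close>

lemma quad_lift:
  assumes fin: "finite A" "finite B" and card: "card A + 4 \<le> 2 * card B"
    and ij: "i0 \<in> A" "j0 \<in> B" "i \<in> A - {i0}" "j \<in> B - {j0}" and r: "r \<in> A - {i0, i}"
    and x: "x \<in> products b (A - {i0, i} - {r}) (B - {j0, j})"
  shows "\<exists>w\<in>op_products b A B. \<forall>i'\<in>A - {i0}. \<forall>j'\<in>B - {j0}.
    contract (pt b i' j0) (contract (pt b i0 j') w) = (if i' = i \<and> j' = j then x else 0)"
proof -
  obtain p q where pq: "x \<in> sph b p q (A - {i0, i} - {r}) (B - {j0, j})"
    using x unfolding products_def by blast
  have "Suc (Suc (Suc (p + 2 * q))) = card A" "Suc (Suc (2 * p + q)) = card B"
    using card_Diff2 [of A i0 i] card_Diff2 [of B j0 j] card_Suc_Diff1 [OF _ r] sph_card(3,4) [OF pq] ij fin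
    by auto
  then obtain p' where "p = Suc p'"
    using card by (cases p) auto
  with pq obtain i1 k l y where i1: "i1 \<in> A - {i0, i} - {r}" and kl: "k \<in> B - {j0, j}" "l \<in> B - {j0, j}" "k \<noteq> l"
    and y: "y \<in> sph b p' q (A - {i0, i} - {r} - {i1}) (B - {j0, j} - {k, l})" and x_eq: "x = pair b i1 k l y"
    by (metis sph_pairE)
  have sets: "A - {i0, i} - {r} - {i1} = A - {i0, i, r, i1}" "B - {j0, j} - {k, l} = B - {j0, j, k, l}"
    by auto
  note y = y [unfolded sets]
  have d: "distinct [i0, i, r, i1]" "distinct [j0, j, k, l]"
    using ij r i1 kl by auto
  have c4: "(card {i0, i, r, i1}, card {j0, j, k, l}, 3) \<in> {(2, 3, 2), (3, 2, 2), (4, 4, 3::nat)}"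
    using d by simp
  have sub: "{i0, i, r, i1} \<subseteq> A" "{j0, j, k, l} \<subseteq> B"
    using ij r i1 kl by simp_all
  have "quad b i0 j0 i j r i1 k l y \<in> op_products b A B"
    by (rule op_productsI [OF quad_cycle_op [OF d] sub c4 y])
  moreover have "contract (pt b i' j0) (contract (pt b i0 j') (quad b i0 j0 i j r i1 k l y))
    = (if i' = i \<and> j' = j then x else 0)" if "i' \<in> A - {i0}" "j' \<in> B - {j0}" for i' j'
    unfolding x_eq using that by (intro quad_corner [OF Zc_Ch [OF sph_Zc [OF y]] _ _ d]) auto
  ultimately show ?thesis
    by blast
qed

text \<open>
  Here the coefficients at two rooks next to the corner are on a board whose number of lines is 1
  modulo 3, so by \<open>cycles_gen_near_products\<close> they are joins with a spare line, and \<open>quad_lift\<close>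
  applies. The induction ends at boards of top-dimensional cycles, which are hexagon products.
\<close>

theorem cycles_gen_op_products:
  assumes "finite A" "finite B" "card A + card B + 1 = 3 * s" "card A < 2 * card B" "card B < 2 * card A"
    and "z \<in> Zc b A B s"
  shows "z \<in> gen (op_products b A B \<union> Bd b A B s)"
  using assms
proof (induction s arbitrary: A B z)
  case 0
  from 0(3) show ?case
    by simp
next
  case (Suc n)
  consider "Suc (card B) = 2 * card A" | "Suc (card A) = 2 * card B"
    | "card A + 1 < 2 * card B" "card B + 1 < 2 * card A"
    using Suc.prems by linarith
  then show ?case
  proof cases
    case 1
    then have "card A = Suc n"
      using Suc.prems by simp
    then have "z \<in> gen (hexagon_products b A B)"
      using Suc.prems 1 by (intro top_cycles(2)) auto
    then show ?thesis
      by (rule gen_mono) (use hexagon_products_op_products in blast)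
  next
    case 2
    then have "card B = Suc n"
      using Suc.prems by simp
    then have "z \<in> gen (hexagon_products (\<not> b) B A)"
      using Suc.prems 2 by (intro top_cycles(2)) (auto simp: Zc_transpose)
    then show ?thesis
      by (rule gen_mono) (use hexagon_products_op_products [of "\<not> b" B A] op_products_transpose [of b] in blast)
  next
    case 3
    have "Suc n < card A"
      using 3 Suc.prems(3) by simp
    moreover have "Suc n < card B"
      using 3 Suc.prems(3) by simp
    ultimately have card: "card B + 4 \<le> 2 * card A" "card A + 4 \<le> 2 * card B"
      using Suc.prems(3) by simp_all
    then have "A \<noteq> {}" "B \<noteq> {}"
      by auto
    then obtain i0 j0 where ij: "i0 \<in> A" "j0 \<in> B"
      by blast
    obtain n' where n: "n = Suc n'"
      using Suc.prems card by (cases n) auto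
    let ?S = "\<lambda>i j. near_products b (A - {i0, i}) (B - {j0, j}) \<union> Bd b (A - {i0, i}) (B - {j0, j}) n'"
    let ?G = "op_products b A B \<union> Bd b A B (Suc n)"
    have "z \<in> gen (?G \<union> star_gens b A B i0 j0 n \<union> Bd b A B (Suc n))"
    proof (rule star_reduction [OF Suc.prems(1,2) ij Suc.prems(6), where S = ?S])
      fix i j assume *: "i \<in> A - {i0}" "j \<in> B - {j0}"
      have "contract (pt b i j0) (contract (pt b i0 j) z) \<in> Zc b (A - {i0} - {i}) (B - {j} - {j0}) n'"
        using Suc.prems(6) by (intro contract_in_Zc) (simp add: n)
      then have "contract (pt b i j0) (contract (pt b i0 j) z) \<in> Zc b (A - {i0, i}) (B - {j0, j}) n'"
        by (simp add: Diff_insert2 [symmetric] insert_commute)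
      then show "contract (pt b i j0) (contract (pt b i0 j) z) \<in> gen (?S i j)"
        using card_Diff2 [of A i0 i] card_Diff2 [of B j0 j] * ij Suc.prems(1-3) card n
        by (intro cycles_gen_near_products) auto
    next
      fix i j x
      assume *: "i \<in> A - {i0}" "j \<in> B - {j0}" and "x \<in> ?S i j"
      then consider "x \<in> Bd b (A - {i0, i}) (B - {j0, j}) n'"
        | r where "r \<in> A - {i0, i}" "x \<in> products b (A - {i0, i} - {r}) (B - {j0, j})"
        | c where "c \<in> B - {j0, j}" "x \<in> products b (A - {i0, i}) (B - {j0, j} - {c})"
        unfolding near_products_def by blast
      then show "\<exists>w\<in>gen ?G. \<forall>i'\<in>A - {i0}. \<forall>j'\<in>B - {j0}.
        contract (pt b i' j0) (contract (pt b i0 j') w) = (if i' = i \<and> j' = j then x else 0)"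
      proof cases
        case 1
        then show ?thesis
          using star_lift_boundary [OF 1 ij *] unfolding n by (blast intro: gen_base)
      next
        case (2 r)
        then show ?thesis
          using quad_lift [OF Suc.prems(1,2) card(2) ij * 2] by (blast intro: gen_base)
      next
        case (3 c)
        \<comment> \<open>a spare column is the transposed situation; exchanging the order of the two contractions costs a sign\<close>
        have "x \<in> products (\<not> b) (B - {j0, j} - {c}) (A - {i0, i})"
          using 3(2) by (simp add: products_transpose)
        from quad_lift [OF Suc.prems(2,1) card(1) ij(2,1) *(2,1) 3(1) this]
        obtain w where w: "w \<in> op_products b A B"
          and "\<forall>j'\<in>B - {j0}. \<forall>i'\<in>A - {i0}.
            contract (pt b i0 j') (contract (pt b i' j0) w) = (if j' = j \<and> i' = i then x else 0)"
          by (auto simp: op_products_transpose)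
        then have "\<forall>i'\<in>A - {i0}. \<forall>j'\<in>B - {j0}.
            contract (pt b i' j0) (contract (pt b i0 j') (- w)) = (if i' = i \<and> j' = j then x else 0)"
          using contract_contract [of "pt b i' j0" "pt b i0 j'" "w" for i' j'] by auto
        then show ?thesis
          using w by (blast intro: gen_base gen_minus)
      qed
    qed (use op_products_Zc [OF Suc.prems(1-3)] in \<open>auto intro: Bd_subset_Zc\<close>)
    then show ?thesis
    proof (rule gen_mono_gen)
      fix x assume "x \<in> ?G \<union> star_gens b A B i0 j0 n \<union> Bd b A B (Suc n)"
      moreover have "x \<in> gen ?G" if "x \<in> star_gens b A B i0 j0 n"
      proof (rule star_step [where P = op_products, OF _ op_products_transpose ij that])
        fix j y assume "j \<in> B - {j0}" "y \<in> Zc b (A - {i0}) (B - {j0, j}) n"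
        then show "y \<in> gen (op_products b (A - {i0}) (B - {j0, j}) \<union> Bd b (A - {i0}) (B - {j0, j}) n)"
          using Suc.prems ij card card_Diff2 [of B j0 j] by (intro Suc.IH) auto
      next
        fix i y assume "i \<in> A - {i0}" "y \<in> Zc b (A - {i0, i}) (B - {j0}) n"
        then show "y \<in> gen (op_products b (A - {i0, i}) (B - {j0}) \<union> Bd b (A - {i0, i}) (B - {j0}) n)"
          using Suc.prems ij card card_Diff2 [of A i0 i] by (intro Suc.IH) auto
      qed (rule pair_op_products)
      ultimately show "x \<in> gen ?G"
        by (blast intro: gen_base)
    qed
  qed
qed

context
  fixes b :: bool and N :: int
  assumes N: "\<And>A B x. x \<in> sph b 3 3 A B \<Longrightarrow> frag_cmul N x \<in> Bd b A B 6"
begin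

text \<open>
  A boundary stays one when it is joined with further spheres.
\<close>

lemma kills_sph:
  assumes "x \<in> sph b p q A B" "3 \<le> p" "3 \<le> q"
  shows "frag_cmul N x \<in> Bd b A B (p + q)"
  using assms
proof (induction "p + q" arbitrary: p q A B x)
  case 0
  then show ?case
    by simp
next
  case (Suc n)
  consider "p = 3" "q = 3" | p' where "p = Suc p'" "3 \<le> p'" | q' where "q = Suc q'" "3 \<le> q'"
    using Suc.prems(2,3) by (cases p; cases q) (auto simp: le_Suc_eq)
  then show ?case
  proof cases
    case 1
    then show ?thesis
      using N [of x A B] Suc.prems(1) by simp
  next
    case (2 p')
    from Suc.prems(1) [unfolded 2(1)] obtain i j k y where *: "i \<in> A" "j \<in> B" "k \<in> B" "j \<noteq> k"
      and y: "y \<in> sph b p' q (A - {i}) (B - {j, k})" and x: "x = pair b i j k y"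
      by (rule sph_pairE)
    have "frag_cmul N y \<in> Bd b (A - {i}) (B - {k, j}) (p' + q)"
      using Suc.hyps(1) [OF _ y 2(2) Suc.prems(3)] Suc.hyps(2) 2(1) by (simp add: insert_commute)
    from pair_in_Bd' [OF this *(1-3)] show ?thesis
      by (simp add: x 2(1))
  next
    case (3 q')
    from Suc.prems(1) [unfolded 3(1)] obtain j i i' y where *: "j \<in> B" "i \<in> A" "i' \<in> A" "i \<noteq> i'"
      and y: "y \<in> sph b p q' (A - {i, i'}) (B - {j})" and x: "x = pair (\<not> b) j i i' y"
      by (rule sph_col_pairE)
    have "frag_cmul N y \<in> Bd b (A - {i', i}) (B - {j}) (p + q')"
      using Suc.hyps(1) [OF _ y Suc.prems(2) 3(2)] Suc.hyps(2) 3(1) by (simp add: insert_commute)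
    from col_pair_in_Bd' [OF this *(2,1,3)] show ?thesis
      by (simp add: x 3(1))
  qed
qed

text \<open>
  A join with \<open>p\<close> and \<open>q\<close> spheres has \<open>3 q = 2 card A - card B\<close> and \<open>3 p = 2 card B - card A\<close>,
  hence the bounds.
\<close>

theorem kills_product_range:
  assumes "finite A" "finite B" "card A + card B = 3 * s" "card A + 9 \<le> 2 * card B" "card B + 9 \<le> 2 * card A"
    and "z \<in> Zc b A B s"
  shows "frag_cmul N z \<in> Bd b A B s"
proof -
  have "z \<in> gen (products b A B \<union> Bd b A B s)"
    using assms by (intro cycles_gen_products) auto
  then have "frag_cmul N z \<in> gen (Bd b A B s)"
  proof (rule gen_image)
    fix x assume "x \<in> products b A B \<union> Bd b A B s"
    then consider "x \<in> Bd b A B s" | p q where "x \<in> sph b p q A B"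
      unfolding products_def by blast
    then have "frag_cmul N x \<in> Bd b A B s"
    proof cases
      case 1
      then show ?thesis
        by (rule Bd_cmul)
    next
      case (2 p q)
      then have "3 \<le> p" "3 \<le> q" "p + q = s"
        using sph_card(3,4) [OF 2] assms by linarith+
      then show ?thesis
        using kills_sph [OF 2] by simp
    qed
    then show "frag_cmul N x \<in> gen (Bd b A B s)"
      by (rule gen_base)
  qed (simp add: frag_cmul_distrib2)
  then show ?thesis
    by (rule gen_subset_Bd) auto
qed

text \<open>
  A small cycle on a board of \<open>a\<close> rows and \<open>b\<close> columns lowers \<open>3 p\<close> by \<open>2 b - a\<close> and \<open>3 q\<close> by
  \<open>2 a - b\<close>, at most 4 in each of the three cases.
\<close>

theorem kills_op_product_range:
  assumes "finite A" "finite B" "card A + card B + 1 = 3 * s"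
    and "card A + 13 \<le> 2 * card B" "card B + 13 \<le> 2 * card A" "z \<in> Zc b A B s"
  shows "frag_cmul N z \<in> Bd b A B s"
proof -
  have "z \<in> gen (op_products b A B \<union> Bd b A B s)"
    using assms by (intro cycles_gen_op_products) auto
  then have "frag_cmul N z \<in> gen (Bd b A B s)"
  proof (rule gen_image)
    fix y assume "y \<in> op_products b A B \<union> Bd b A B s"
    moreover have "frag_cmul N y \<in> Bd b A B s" if "y \<in> op_products b A B"
      using that
    proof (rule op_productsE)
      fix W x A0 B0 n p q
      assume y: "y = W x" and W: "cycle_op b A0 B0 n W" and sub: "A0 \<subseteq> A" "B0 \<subseteq> B"
        and c: "(card A0, card B0, n) \<in> {(2, 3, 2), (3, 2, 2), (4, 4, 3)}"
        and x: "x \<in> sph b p q (A - A0) (B - B0)"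
      have "card A = card A0 + card (A - A0)" "card B = card B0 + card (B - B0)"
        using sub assms(1,2) by (simp_all add: card_Diff_subset finite_subset card_mono)
      then have pq: "3 \<le> p" "3 \<le> q" "p + q + n = s"
        using c sph_card(3,4) [OF x] assms(3-5) by auto
      have "W (frag_cmul N x) \<in> Bd b (A0 \<union> (A - A0)) (B0 \<union> (B - B0)) (p + q + n)"
        by (rule cycle_op_Bd [OF W _ _ kills_sph [OF x pq(1,2)]]) auto
      then show "frag_cmul N y \<in> Bd b A B s"
        using sub pq(3) by (simp add: y cycle_opD(2) [OF W] Un_absorb1)
    qed
    ultimately show "frag_cmul N y \<in> gen (Bd b A B s)"
      by (auto intro: gen_base Bd_cmul)
  qed (simp add: frag_cmul_distrib2)
  then show ?thesis
    by (rule gen_subset_Bd) auto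
qed

end

section \<open>Functionals on the homology with values modulo 3\<close>

lemma three_eq_0: "(3::3) = 0"
  by simp

lemma of_int_eq_0_iff_3: "(of_int n :: 3) = 0 \<longleftrightarrow> 3 dvd n"
proof -
  have "(of_int n :: 3) = of_int (3 * (n div 3) + n mod 3)"
    by simp
  also have "\<dots> = 3 * of_int (n div 3) + of_int (n mod 3)"
    by (simp only: of_int_add of_int_mult of_int_numeral)
  finally have "(of_int n :: 3) = of_int (n mod 3)"
    by (simp only: three_eq_0 mult_zero_left add_0)
  moreover have "n mod 3 \<in> {0, 1, 2}"
    by auto
  ultimately show ?thesis
    by (auto simp: dvd_eq_mod_eq_0)
qed

lemma of_int_eq_iff_3: "(of_int m :: 3) = of_int n \<longleftrightarrow> 3 dvd m - n"
  using of_int_eq_0_iff_3 [of "m - n"] by simp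

lemma triple_sum_3: "a + a + a = (0::3)"
proof -
  have "a + a + a = (1 + 1 + 1) * a"
    by (simp only: distrib_right mult_1_left)
  also have "1 + 1 + 1 = (0::3)"
    by simp
  finally show ?thesis
    by simp
qed

lemma contract_in_Bd:
  "z \<in> Bd b A B (Suc s) \<Longrightarrow> contract (pt b i j) z \<in> Bd b (A - {i}) (B - {j}) s"
proof -
  assume "z \<in> Bd b A B (Suc s)"
  then obtain c where c: "c \<in> Ch b A B (Suc (Suc s))" "z = bd c"
    by (auto simp: Bd_def)
  have "bd (contract (pt b i j) c) \<in> Bd b (A - {i}) (B - {j}) s"
    by (intro BdI contract_in_Ch c)
  from Bd_minus [OF this] show ?thesis
    by (simp add: c(2) bd_contract)
qed

text \<open>
  The values of \<open>\<phi>\<close> matter on cycles only. The numeral type \<open>3\<close> is the ring of integers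
  modulo 3.
\<close>

definition homology_functional :: "bool \<Rightarrow> nat set \<Rightarrow> nat set \<Rightarrow> nat \<Rightarrow> (chain \<Rightarrow> 3) \<Rightarrow> bool"
  where "homology_functional b A B s \<phi> \<longleftrightarrow> (\<forall>x\<in>Zc b A B s. \<forall>y\<in>Zc b A B s. \<phi> (x + y) = \<phi> x + \<phi> y) \<and>
    (\<forall>x\<in>Bd b A B s. \<phi> x = 0)"

lemma homology_functional_add: "homology_functional b A B s \<phi> \<Longrightarrow> x \<in> Zc b A B s \<Longrightarrow> y \<in> Zc b A B s \<Longrightarrow> \<phi> (x + y) = \<phi> x + \<phi> y"
  and homology_functional_Bd: "homology_functional b A B s \<phi> \<Longrightarrow> x \<in> Bd b A B s \<Longrightarrow> \<phi> x = 0"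
  by (auto simp: homology_functional_def)

lemma homology_functional_zero: "homology_functional b A B s \<phi> \<Longrightarrow> \<phi> 0 = 0"
  using homology_functional_Bd Bd_zero by blast

lemma homology_functional_minus:
  assumes "homology_functional b A B s \<phi>" "x \<in> Zc b A B s"
  shows "\<phi> (- x) = - \<phi> x"
  using homology_functional_add [OF assms Zc_minus [OF assms(2)]] homology_functional_zero [OF assms(1)]
  by (simp add: eq_neg_iff_add_eq_0 add.commute)

lemma homology_functional_diff:
  assumes "homology_functional b A B s \<phi>" "x \<in> Zc b A B s" "y \<in> Zc b A B s"
  shows "\<phi> (x - y) = \<phi> x - \<phi> y"
  using homology_functional_add [OF assms(1,2) Zc_minus [OF assms(3)]] homology_functional_minus [OF assms(1,3)] by simp

lemma homology_functional_sum:
  assumes "homology_functional b A B s \<phi>" "\<And>i. i \<in> I \<Longrightarrow> f i \<in> Zc b A B s"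
  shows "\<phi> (sum f I) = (\<Sum>i\<in>I. \<phi> (f i))"
  using assms(2)
proof (induction I rule: infinite_finite_induct)
  case (insert x F)
  then show ?case
    using homology_functional_add [OF assms(1), of "f x" "sum f F"] by (auto intro: Zc_sum)
qed (use homology_functional_zero [OF assms(1)] in auto)

definition sign_functional :: "bool \<Rightarrow> nat set \<Rightarrow> nat set \<Rightarrow> nat \<Rightarrow> (chain \<Rightarrow> 3) \<Rightarrow> bool"
  where "sign_functional b A B s \<phi> \<longleftrightarrow> homology_functional b A B s \<phi> \<and> (\<forall>p q x v. ssph b p q A B x v \<longrightarrow> \<phi> x = of_int v)"

text \<open>
  The sign of a join with a spare line is that of the join, with the spare line put in front of
  the other lines of its kind; the factor \<open>(-1)^q\<close> is the one in \<open>ssph.row\<close>. With this choice both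
  kinds of spare line are compatible with \<open>row_pair_to_col_pair\<close>.
\<close>

definition near_sign_functional :: "bool \<Rightarrow> nat set \<Rightarrow> nat set \<Rightarrow> nat \<Rightarrow> (chain \<Rightarrow> 3) \<Rightarrow> bool"
  where "near_sign_functional b A B s \<phi> \<longleftrightarrow> homology_functional b A B s \<phi> \<and>
    (\<forall>c\<in>B. \<forall>p q x v. ssph b p q A (B - {c}) x v \<longrightarrow> \<phi> x = of_int (psign c (B - {c}) * v)) \<and>
    (\<forall>r\<in>A. \<forall>p q x v. ssph b p q (A - {r}) B x v \<longrightarrow> \<phi> x = of_int ((-1) ^ q * psign r (A - {r}) * v))"

lemma near_sign_functionalD:
  assumes "near_sign_functional b A B s \<phi>"
  shows "homology_functional b A B s \<phi>"
    "c \<in> B \<Longrightarrow> ssph b p q A (B - {c}) x v \<Longrightarrow> \<phi> x = of_int (psign c (B - {c}) * v)"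
    "r \<in> A \<Longrightarrow> ssph b p q (A - {r}) B x v \<Longrightarrow> \<phi> x = of_int ((-1) ^ q * psign r (A - {r}) * v)"
  using assms unfolding near_sign_functional_def by blast+

lemma ssph_sign_square: "ssph b p q A B x v \<Longrightarrow> v * v = 1"
proof (induction rule: ssph.induct)
  case (row p q A B x v i j k)
  have "(psign i A * psign2 j k B * (-1) ^ q * v) * (psign i A * psign2 j k B * (-1) ^ q * v)
    = (psign i A * psign i A) * (psign j (insert k B) * psign j (insert k B)) * (psign k B * psign k B)
      * ((-1) ^ q * (-1) ^ q) * (v * v)"
    by (simp add: psign2_def mult_ac)
  then show ?case
    using row by (simp flip: power_mult_distrib)
next
  case (col p q A B x v j i i')
  have "(psign j B * psign2 i i' A * v) * (psign j B * psign2 i i' A * v)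
    = (psign j B * psign j B) * (psign i (insert i' A) * psign i (insert i' A)) * (psign i' A * psign i' A) * (v * v)"
    by (simp add: psign2_def mult_ac)
  then show ?case
    using col by simp
qed auto

lemma neg_one_power_square [simp]: "(-1::int) ^ n * ((-1) ^ n * a) = a"
  by (simp flip: mult.assoc power_mult_distrib)

lemma col_factorE:
  assumes "col_factor b p q A B x v j i i'"
  obtains q' x0 v0 where "q = Suc q'" "j \<in> B" "i \<in> A" "i' \<in> A" "i \<noteq> i'"
    "ssph b p q' (A - {i, i'}) (B - {j}) x0 v0" "x = pair (\<not> b) j i i' x0"
    "v = psign j (B - {j}) * psign2 i i' (A - {i, i'}) * v0"
proof -
  obtain q' x0 v0 where q: "q = Suc q'" and mem: "j \<in> B" "i \<in> A" "i' \<in> A" "i \<noteq> i'"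
    and s: "ssph (\<not> b) q' p (B - {j}) (A - {i, i'}) x0 v0" and x: "x = pair (\<not> b) j i i' x0"
    and v: "(-1) ^ (p * q) * v = psign j (B - {j}) * psign2 i i' (A - {i, i'}) * (-1) ^ p * v0"
    using assms unfolding col_factor_def row_factor_def by blast
  have "v = (-1) ^ (p * q) * ((-1) ^ (p * q) * v)"
    by simp
  also have "\<dots> = psign j (B - {j}) * psign2 i i' (A - {i, i'}) * ((-1) ^ (q' * p) * v0)"
  proof -
    have "(-1::int) ^ (p * q) * (-1) ^ p = (-1) ^ (q' * p) * ((-1) ^ p * (-1) ^ p)"
      by (simp add: q power_add mult.commute)
    also have "\<dots> = (-1) ^ (q' * p)"
      by (simp flip: power_mult_distrib)
    finally show ?thesis
      unfolding v by (simp add: mult_ac)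
  qed
  finally have v': "v = \<dots>" .
  show ?thesis
    using that [OF q mem _ x v'] ssph_transpose [OF s] by simp
qed

lemma contract_row_pair:
  assumes "x \<in> Ch b X Y t" "i \<notin> X" "j \<noteq> k"
  shows "contract (pt b i l) (pair b i j k x) = (if l = j then x else if l = k then - x else 0)"
proof -
  have "contract (pt b i l) x = 0" for l
    using contract_eq_0 [OF assms(1)] assms(2) by blast
  then show ?thesis
    using Ch_finitary [OF assms(1)] assms(3) by (simp add: pair_def contract_wedge_pt contract_wedge_self)
qed

lemma contract_row_col_pair:
  assumes "x \<in> Ch b X Y t" "i \<notin> X" "i \<noteq> i'"
  shows "contract (pt b i l) (pair (\<not> b) j i i' x) = (if l = j then x else 0)"
proof -
  have "contract (pt b i l) x = 0" for l
    using contract_eq_0 [OF assms(1)] assms(2) by blast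
  then show ?thesis
    using Ch_finitary [OF assms(1)] assms(3) by (simp add: pair_def contract_wedge_pt contract_wedge_self)
qed

lemma neg_one_power_parity: "even (m + n) \<Longrightarrow> (-1::int) ^ m = (-1) ^ n"
  by (cases "even m"; cases "even n") auto

text \<open>
  The value of \<open>\<phi>\<close> is a signed sum over the coefficients in row \<open>i\<close>, each of which is a cycle
  with a spare line. On a join whose sphere at row \<open>i\<close> is a column sphere, only one coefficient is
  non-zero, and its contribution is the sign \<open>v\<close>. On a join with a row sphere in row \<open>i\<close> there are
  two, each contributing \<open>-v\<close>, and \<open>-2 v = v\<close> modulo 3.
\<close>

lemma sign_functional_of_near:
  assumes fin: "finite A" "finite B" and i: "i \<in> A" and card: "card A + card B = 3 * Suc s"
    and near: "\<And>j. j \<in> B \<Longrightarrow> \<exists>\<phi>. near_sign_functional b (A - {i}) (B - {j}) s \<phi>"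
  shows "\<exists>\<phi>. sign_functional b A B (Suc s) \<phi>"
proof -
  obtain f where f: "\<And>j. j \<in> B \<Longrightarrow> near_sign_functional b (A - {i}) (B - {j}) s (f j)"
    using near by metis
  note cf = near_sign_functionalD(1) [OF f]
  \<comment> \<open>\<open>card B = 2 p + q\<close>, so \<open>(-1)^card B\<close> stands for the \<open>(-1)^q\<close> in the signs of joins without referring to \<open>q\<close>\<close>
  define \<epsilon> where "\<epsilon> = (\<lambda>j. - (psign i (A - {i}) * (-1) ^ card B * psign j (B - {j})))"
  define \<phi> where "\<phi> = (\<lambda>z. \<Sum>j\<in>B. of_int (\<epsilon> j) * f j (contract (pt b i j) z))"
  have "homology_functional b A B (Suc s) \<phi>"
    unfolding homology_functional_def
  proof (intro conjI ballI)
    fix x y assume "x \<in> Zc b A B (Suc s)" "y \<in> Zc b A B (Suc s)"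
    then show "\<phi> (x + y) = \<phi> x + \<phi> y"
      unfolding \<phi>_def by (simp add: homology_functional_add [OF cf] contract_in_Zc distrib_left sum.distrib)
  next
    fix x assume "x \<in> Bd b A B (Suc s)"
    then show "\<phi> x = 0"
      unfolding \<phi>_def by (simp add: homology_functional_Bd [OF cf] contract_in_Bd)
  qed
  moreover have "\<phi> x = of_int v" if s: "ssph b p q A B x v" for p q x v
  proof -
    consider j k where "row_factor b p q A B x v i j k" | j i' where "col_factor b p q A B x v j i i'"
      using ssph_row_cases [OF s i] by blast
    then show ?thesis
    proof cases
      case (1 j k)
      then obtain p' x0 v0 where mem: "i \<in> A" "j \<in> B" "k \<in> B" "j \<noteq> k" and p: "p = Suc p'"
        and s0: "ssph b p' q (A - {i}) (B - {j, k}) x0 v0" and x: "x = pair b i j k x0"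
        and v: "v = psign i (A - {i}) * psign2 j k (B - {j, k}) * (-1) ^ q * v0"
        unfolding row_factor_def by blast
      let ?B = "B - {j, k}"
      have sets: "B - {j} - {k} = ?B" "B - {k} - {j} = ?B" "B - {j} = insert k ?B" "B - {k} = insert j ?B"
        using mem by auto
      have "p' + q = s"
        using ssph_card(3,4) [OF s] p card by simp
      then have x0Z: "x0 \<in> Zc b (A - {i}) ?B s"
        using ssph_Zc [OF s0] by simp
      then have x0: "x0 \<in> Zc b (A - {i}) (B - {j}) s" "x0 \<in> Zc b (A - {i}) (B - {k}) s"
        by (auto elim: Zc_mono)
      have fj: "f j x0 = of_int (psign k ?B * v0)" "f k x0 = of_int (psign j ?B * v0)"
        using near_sign_functionalD(2) [OF f [of j], of k p' q x0 v0] near_sign_functionalD(2) [OF f [of k], of j p' q x0 v0] mem s0 sets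
        by auto
      have "\<phi> x = (\<Sum>l\<in>B. if l = j then of_int (\<epsilon> j) * f j x0 else if l = k then - of_int (\<epsilon> k) * f k x0 else 0)"
      proof -
        have "contract (pt b i l) x = (if l = j then x0 else if l = k then - x0 else 0)" for l
          unfolding x by (rule contract_row_pair [OF Zc_Ch [OF x0Z] _ mem(4)]) simp
        then show ?thesis
          unfolding \<phi>_def
          using homology_functional_minus [OF cf x0(2)] homology_functional_zero [OF cf] mem by (intro sum.cong) auto
      qed
      also have "\<dots> = of_int (\<epsilon> j) * f j x0 - of_int (\<epsilon> k) * f k x0"
        using fin mem by (simp add: sum.remove [of B j] sum.remove [of "B - {j}" k])
      also have "\<dots> = of_int (\<epsilon> j * psign k ?B * v0 - \<epsilon> k * psign j ?B * v0)"
        by (simp add: fj mult_ac)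
      also have "\<dots> = of_int v"
      proof -
        have "psign2 k j ?B = - psign2 j k ?B"
          using mem fin by (intro psign2_swap) auto
        then have jk: "psign k (B - {k}) * psign j ?B = - psign2 j k ?B" "psign j (B - {j}) * psign k ?B = psign2 j k ?B"
          by (simp_all add: psign2_def sets)
        have "(-1::int) ^ card B = (-1) ^ q"
          using ssph_card(4) [OF s] by (simp add: power_add)
        then have v': "v = psign i (A - {i}) * (-1) ^ card B * psign2 j k ?B * v0"
          by (simp add: v mult_ac)
        have "\<epsilon> j * psign k ?B * v0 = - (psign i (A - {i}) * (-1) ^ card B * (psign j (B - {j}) * psign k ?B) * v0)"
          by (simp add: \<epsilon>_def mult_ac)
        also have "\<dots> = - v"
          unfolding jk v' by simp
        finally have e1: "\<epsilon> j * psign k ?B * v0 = - v" .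
        have "\<epsilon> k * psign j ?B * v0 = - (psign i (A - {i}) * (-1) ^ card B * (psign k (B - {k}) * psign j ?B) * v0)"
          by (simp add: \<epsilon>_def mult_ac)
        also have "\<dots> = v"
          unfolding jk v' by simp
        finally have e2: "\<epsilon> k * psign j ?B * v0 = v" .
        \<comment> \<open>here \<open>-2 v = v\<close> modulo 3 is used\<close>
        show ?thesis
          unfolding e1 e2 of_int_eq_iff_3 by simp
      qed
      finally show ?thesis .
    next
      case (2 j i')
      then obtain q' x0 v0 where q: "q = Suc q'" and mem: "j \<in> B" "i \<in> A" "i' \<in> A" "i \<noteq> i'"
        and s0: "ssph b p q' (A - {i, i'}) (B - {j}) x0 v0" and x: "x = pair (\<not> b) j i i' x0"
        and v: "v = psign j (B - {j}) * psign2 i i' (A - {i, i'}) * v0"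
        by (rule col_factorE)
      have sets: "A - {i} - {i'} = A - {i, i'}" "A - {i} = insert i' (A - {i, i'})"
        using mem by auto
      have "p + q' = s"
        using ssph_card(3,4) [OF s] q card by simp
      then have x0Z: "x0 \<in> Zc b (A - {i, i'}) (B - {j}) s"
        using ssph_Zc [OF s0] by simp
      have fj: "f j x0 = of_int ((-1) ^ q' * psign i' (A - {i, i'}) * v0)"
        using near_sign_functionalD(3) [OF f [of j], of i' p q' x0 v0] mem s0 sets by auto
      have "\<phi> x = (\<Sum>l\<in>B. if l = j then of_int (\<epsilon> j) * f j x0 else 0)"
      proof -
        have "contract (pt b i l) x = (if l = j then x0 else 0)" for l
          unfolding x by (rule contract_row_col_pair [OF Zc_Ch [OF x0Z] _ mem(4)]) simp
        then show ?thesis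
          unfolding \<phi>_def using homology_functional_zero [OF cf] by (intro sum.cong) auto
      qed
      also have "\<dots> = of_int (\<epsilon> j) * f j x0"
        using fin mem by simp
      also have "\<dots> = of_int (\<epsilon> j * ((-1) ^ q' * psign i' (A - {i, i'}) * v0))"
        by (simp add: fj)
      also have "\<epsilon> j * ((-1) ^ q' * psign i' (A - {i, i'}) * v0) = v"
      proof -
        have "(-1::int) ^ card B = - ((-1) ^ q')"
          using ssph_card(4) [OF s] by (simp add: power_add q)
        then show ?thesis
          by (simp add: \<epsilon>_def v psign2_def sets(2) [symmetric] mult_ac)
      qed
      finally show ?thesis .
    qed
  qed
  ultimately show ?thesis
    unfolding sign_functional_def by blast
qed

lemma gen_Union_decomposition:
  assumes "z \<in> gen (\<Union>k\<in>B. Zc b A (B - {k}) s)" "finite B"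
  shows "\<exists>\<zeta>. (\<forall>c\<in>B. \<zeta> c \<in> Zc b A (B - {c}) s) \<and> z = (\<Sum>c\<in>B. \<zeta> c)"
  using assms(1)
proof (induction z rule: gen_induct_subgroup)
  case (base x)
  then obtain k where k: "k \<in> B" "x \<in> Zc b A (B - {k}) s"
    by blast
  then show ?case
    using assms(2) by (intro exI [of _ "\<lambda>c. if c = k then x else 0"]) auto
next
  case zero
  then show ?case
    by (intro exI [of _ "\<lambda>c. 0"]) auto
next
  case (add x y)
  then obtain \<zeta> \<eta> where "\<forall>c\<in>B. \<zeta> c \<in> Zc b A (B - {c}) s" "x = (\<Sum>c\<in>B. \<zeta> c)"
    "\<forall>c\<in>B. \<eta> c \<in> Zc b A (B - {c}) s" "y = (\<Sum>c\<in>B. \<eta> c)"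
    by blast
  then show ?case
    by (intro exI [of _ "\<lambda>c. \<zeta> c + \<eta> c"]) (auto simp: sum.distrib intro: Zc_add)
next
  case (minus x)
  then obtain \<zeta> where "\<forall>c\<in>B. \<zeta> c \<in> Zc b A (B - {c}) s" "x = (\<Sum>c\<in>B. \<zeta> c)"
    by blast
  then show ?case
    by (intro exI [of _ "\<lambda>c. - \<zeta> c"]) (auto simp: sum_negf intro: Zc_minus)
qed

lemma hexagon_swap: "hexagon b i r j k l x = hexagon b r i j k l x"
proof -
  have "wedge (pt b i j) (wedge (pt b r k) x) = - wedge (pt b r k) (wedge (pt b i j) x)" for j k
    by (rule wedge_wedge)
  then show ?thesis
    by (simp add: hexagon_def pair_def)
qed

text \<open>
  Compares the signs of the three joins in \<open>hexagon_eq_pairs\<close>.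
\<close>

lemma psign_four_cycle:
  assumes "finite Y" "distinct [j, k, l, d]" "j \<notin> Y" "k \<notin> Y" "l \<notin> Y" "d \<notin> Y"
  shows "psign2 j l (insert k (insert d Y)) * psign2 k d Y = - (psign2 j k (insert l (insert d Y)) * psign2 l d Y)"
    "psign2 k l (insert d (insert j Y)) * psign2 d j Y = - (psign2 j k (insert l (insert d Y)) * psign2 l d Y)"
proof -
  have kl: "psign l (insert k (insert d Y)) * psign k (insert d Y)
      = - (psign k (insert l (insert d Y)) * psign l (insert d Y))"
    using assms by (intro psign_swap) auto
  have "psign2 j l (insert k (insert d Y)) * psign2 k d Y
      = psign j (insert l (insert k (insert d Y))) * (psign l (insert k (insert d Y)) * psign k (insert d Y)) * psign d Y"
    by (simp add: psign2_def)
  also have "\<dots> = - (psign j (insert l (insert k (insert d Y))) * psign k (insert l (insert d Y)) * psign l (insert d Y) * psign d Y)"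
    unfolding kl by simp
  finally show 1: "psign2 j l (insert k (insert d Y)) * psign2 k d Y = - (psign2 j k (insert l (insert d Y)) * psign2 l d Y)"
    by (simp add: psign2_def insert_commute)
  have "psign2 k l (insert d (insert j Y)) * psign2 d j Y = psign2 d j (insert k (insert l Y)) * psign2 k l Y"
    using assms by (intro psign2_psign2) auto
  also have "\<dots> = - psign2 j d (insert k (insert l Y)) * psign2 k l Y"
    using assms by (subst psign2_swap) auto
  also have "\<dots> = - (psign j (insert d (insert k (insert l Y))) * (psign d (insert k (insert l Y)) * psign2 k l Y))"
    by (simp add: psign2_def)
  also have "psign d (insert k (insert l Y)) * psign2 k l Y = psign2 k l (insert d Y) * psign d Y"
    using assms by (intro psign_psign2) auto
  finally show "psign2 k l (insert d (insert j Y)) * psign2 d j Y = - (psign2 j k (insert l (insert d Y)) * psign2 l d Y)"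
    by (simp add: psign2_def insert_commute)
qed

lemma psign_three_cycle:
  assumes "finite X" "j \<notin> X" "k \<notin> X" "l \<notin> X" "distinct [j, k, l]"
  shows "psign j (insert k (insert l X)) * psign2 k l X = psign k (insert l (insert j X)) * psign2 l j X"
proof -
  have "psign j (insert k (insert l X)) * psign2 k l X = psign2 k l (insert j X) * psign j X"
    using assms by (intro psign_psign2) auto
  then show ?thesis
    by (simp add: psign2_def)
qed

text \<open>
  The hexagon is a signed sum of three joins, and the signs are such that three equal values are
  added.
\<close>

lemma sign_functional_hexagon:
  assumes f: "sign_functional b A B s f" and fin: "finite A" "finite B" and card: "card A + card B = 3 * s"
    and ir: "i \<in> A" "r \<in> A" "i \<noteq> r" and jkl: "j \<in> B" "k \<in> B" "l \<in> B" "d \<in> B" "distinct [j, k, l, d]"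
    and x: "ssph b p q (A - {i, r}) (B - {j, k, l, d}) x v"
  shows "f (hexagon b i r j k l x) = 0"
proof -
  let ?Y = "B - {j, k, l, d}" and ?A = "A - {i, r}"
  have fY: "finite ?Y"
    using fin by simp
  define K where "K = psign i (insert r ?A) * psign r ?A * ((-1) ^ q * (-1) ^ q) * v"
  have T: "f (pair b i a1 a2 (pair b r c1 c2 x)) = of_int (K * (psign2 a1 a2 (insert c1 (insert c2 ?Y)) * psign2 c1 c2 ?Y))
      \<and> pair b i a1 a2 (pair b r c1 c2 x) \<in> Zc b A B s"
    if "{a1, a2, c1, c2} = {j, k, l, d}" "distinct [a1, a2, c1, c2]" for a1 a2 c1 c2
  proof -
    have new: "c1 \<notin> ?Y" "c2 \<notin> ?Y" "a1 \<notin> ?Y" "a2 \<notin> ?Y"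
      unfolding that(1) [symmetric] by auto
    have "ssph b (Suc (Suc p)) q (insert i (insert r ?A)) (insert a1 (insert a2 (insert c1 (insert c2 ?Y))))
      (pair b i a1 a2 (pair b r c1 c2 x))
      (psign i (insert r ?A) * psign2 a1 a2 (insert c1 (insert c2 ?Y)) * (-1) ^ q
        * (psign r ?A * psign2 c1 c2 ?Y * (-1) ^ q * v))"
      using that(2) ir new by (intro ssph.row x) auto
    moreover have "insert i (insert r ?A) = A" "insert a1 (insert a2 (insert c1 (insert c2 ?Y))) = B"
    proof -
      show "insert i (insert r ?A) = A"
        using ir by auto
      have "insert a1 (insert a2 (insert c1 (insert c2 ?Y))) = {a1, a2, c1, c2} \<union> ?Y"
        by auto
      then show "insert a1 (insert a2 (insert c1 (insert c2 ?Y))) = B"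
        unfolding that(1) using jkl by auto
    qed
    ultimately have s: "ssph b (Suc (Suc p)) q A B (pair b i a1 a2 (pair b r c1 c2 x))
      (K * (psign2 a1 a2 (insert c1 (insert c2 ?Y)) * psign2 c1 c2 ?Y))"
      by (simp add: K_def mult_ac)
    moreover have "Suc (Suc p) + q = s"
      using ssph_card(3,4) [OF s] card by simp
    ultimately show ?thesis
      using f ssph_Zc [OF s] unfolding sign_functional_def by auto
  qed
  define W where "W = K * (psign2 j k (insert l (insert d ?Y)) * psign2 l d ?Y)"
  have T1: "f (pair b i j l (pair b r k d x)) = of_int (- W)" "pair b i j l (pair b r k d x) \<in> Zc b A B s"
    using T [of j l k d] jkl(5) psign_four_cycle(1) [OF fY jkl(5)] by (auto simp: W_def)
  have T2: "f (pair b i j k (pair b r l d x)) = of_int W" "pair b i j k (pair b r l d x) \<in> Zc b A B s"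
    using T [of j k l d] jkl(5) by (auto simp: W_def)
  have T3: "f (pair b i k l (pair b r d j x)) = of_int (- W)" "pair b i k l (pair b r d j x) \<in> Zc b A B s"
    using T [of k l d j] jkl(5) psign_four_cycle(2) [OF fY jkl(5)] by (auto simp: W_def)
  have cf: "homology_functional b A B s f"
    using f by (simp add: sign_functional_def)
  have "f (hexagon b i r j k l x) = of_int (- W) - of_int W + of_int (- W)"
    unfolding hexagon_eq_pairs [of _ _ _ _ _ _ _ d]
    using T1 T2 T3 by (simp add: homology_functional_add [OF cf] homology_functional_diff [OF cf] Zc_diff)
  also have "\<dots> = of_int (- 3 * W)"
    by simp
  also have "\<dots> = 0"
    by (subst of_int_eq_0_iff_3) simp
  finally show ?thesis .
qed

text \<open>
  A cycle \<open>z\<close> of the \<open>m \<times> (2 m + 1)\<close> board is a sum of cycles \<open>\<zeta> c\<close>, each avoiding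
  the column \<open>c\<close>, and \<open>\<phi> z\<close> is the signed sum of the values at the \<open>\<zeta> c\<close> of the
  functionals on the smaller boards. To see that this does not depend on the choice of \<open>\<zeta>\<close>,
  let the \<open>\<zeta> c\<close> add up to zero. Then they are the coefficients in a new row \<open>r0\<close> of a cycle
  on \<open>m + 1\<close> rows, and such cycles are combinations of hexagon products by \<open>top_cycles\<close>. If \<open>r0\<close>
  is a row of the hexagon, three equal values add up; otherwise every coefficient is itself a
  hexagon product.
\<close>

lemma near_sign_functional_top:
  assumes fin: "finite A" "finite B" and card: "card B = Suc (2 * card A)"
    and full: "\<And>c. c \<in> B \<Longrightarrow> \<exists>\<phi>. sign_functional b A (B - {c}) (card A) \<phi>"
  shows "\<exists>\<phi>. near_sign_functional b A B (card A) \<phi>"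
proof -
  let ?m = "card A"
  obtain f where f: "\<And>c. c \<in> B \<Longrightarrow> sign_functional b A (B - {c}) ?m (f c)"
    using full by metis
  then have cf: "\<And>c. c \<in> B \<Longrightarrow> homology_functional b A (B - {c}) ?m (f c)"
    by (simp add: sign_functional_def)
  obtain r0 where r0: "r0 \<notin> A"
    using fin(1) ex_new_if_finite infinite_UNIV_nat by blast
  let ?A = "insert r0 A"
  define \<Psi> where "\<Psi> = (\<lambda>Y. \<Sum>c\<in>B. of_int (psign c (B - {c})) * f c (contract (pt b r0 c) Y))"
  have cZ: "contract (pt b r0 c) Y \<in> Zc b A (B - {c}) ?m" if "Y \<in> Zc b ?A B (Suc ?m)" for c Y
    using contract_in_Zc [OF that, of r0 c] r0 by simp
  have \<Psi>_add: "\<Psi> (x + y) = \<Psi> x + \<Psi> y" if "x \<in> Zc b ?A B (Suc ?m)" "y \<in> Zc b ?A B (Suc ?m)" for x y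
    unfolding \<Psi>_def using that by (simp add: homology_functional_add [OF cf] cZ distrib_left sum.distrib)
  have \<Psi>_hex: "\<Psi> y = 0" if yh: "y \<in> hexagon_products b ?A B" for y
  proof -
    obtain i r j k l x p where ir: "i \<in> ?A" "r \<in> ?A" "i \<noteq> r"
      and jkl: "j \<in> B" "k \<in> B" "l \<in> B" "j \<noteq> k" "j \<noteq> l" "k \<noteq> l"
      and xs: "x \<in> sph b p 0 (?A - {i, r}) (B - {j, k, l})" and y: "y = hexagon b i r j k l x"
      using yh unfolding hexagon_products_def by blast
    \<comment> \<open>the three positions in row \<open>r0\<close> contribute the same value\<close>
    have own_row: "\<Psi> (hexagon b r0 r j k l x) = 0" if r: "r \<in> A" and xs: "x \<in> sph b p 0 (A - {r}) (B - {j, k, l})" for r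
    proof -
      let ?X = "B - {j, k, l}"
      have fX: "finite ?X"
        using fin by simp
      obtain v where v: "ssph b p 0 (A - {r}) ?X x v"
        using xs unfolding sph_def by blast
      have val: "f a (pair b r c d x) = of_int (psign r (A - {r}) * psign2 c d ?X * v)"
        if "{a, c, d} = {j, k, l}" "distinct [a, c, d]" for a c d
      proof -
        have new: "c \<notin> ?X" "d \<notin> ?X"
          unfolding that(1) [symmetric] by auto
        have "a \<in> {j, k, l}"
          unfolding that(1) [symmetric] by simp
        then have "a \<in> B"
          using jkl by auto
        have "insert c (insert d ?X) = B - {a}"
        proof -
          have "insert c (insert d (B - {a, c, d})) = B - {a}" if "{a, c, d} \<subseteq> B" "distinct [a, c, d]"
            using that by auto
          moreover have "{a, c, d} \<subseteq> B"
            unfolding that(1) using jkl by blast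
          ultimately show ?thesis
            using that by simp
        qed
        moreover have "insert r (A - {r}) = A"
          using r by auto
        moreover have "ssph b (Suc p) 0 (insert r (A - {r})) (insert c (insert d ?X)) (pair b r c d x)
          (psign r (A - {r}) * psign2 c d ?X * (-1) ^ 0 * v)"
          using that(2) new by (intro ssph.row v) auto
        ultimately have "ssph b (Suc p) 0 A (B - {a}) (pair b r c d x) (psign r (A - {r}) * psign2 c d ?X * v)"
          by simp
        then show ?thesis
          using f [OF \<open>a \<in> B\<close>] unfolding sign_functional_def by blast
      qed
      have xC: "x \<in> Ch b (A - {r}) ?X p"
        using xs by (intro Zc_Ch sph_Zc_row_top)
      have c0: "contract (pt b r0 c) x = 0" for c
        using contract_eq_0 [OF xC] r0 by blast
      have nr: "r0 \<noteq> r" "r \<noteq> r0"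
        using r r0 by auto
      have cp: "contract (pt b r0 c) (pair b r c' d' x) = 0" for c c' d'
        using nr by (simp add: contract_pair c0)
      have fp: "finitary (pair b r c' d' x)" for c' d'
        by (intro finitary_pair Ch_finitary [OF xC])
      have con: "contract (pt b r0 c) (hexagon b r0 r j k l x) = (if c = j then pair b r k l x
          else if c = k then pair b r l j x else if c = l then pair b r j k x else 0)" for c
        using jkl by (simp add: hexagon_def contract_wedge_pt contract_wedge_self cp fp)
      have "\<Psi> (hexagon b r0 r j k l x)
        = (\<Sum>c\<in>{j, k, l}. of_int (psign c (B - {c})) * f c (contract (pt b r0 c) (hexagon b r0 r j k l x)))"
        unfolding \<Psi>_def using fin jkl homology_functional_zero [OF cf]
        by (intro sum.mono_neutral_right) (auto simp: con)
      also have "\<dots> = of_int (psign j (B - {j})) * f j (pair b r k l x)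
        + of_int (psign k (B - {k})) * f k (pair b r l j x) + of_int (psign l (B - {l})) * f l (pair b r j k x)"
        using jkl by (simp add: con add.assoc)
      also have "\<dots> = of_int (psign r (A - {r}) * v * (psign j (B - {j}) * psign2 k l ?X))
        + of_int (psign r (A - {r}) * v * (psign k (B - {k}) * psign2 l j ?X))
        + of_int (psign r (A - {r}) * v * (psign l (B - {l}) * psign2 j k ?X))"
        using jkl by (subst val val val; auto)+
      also have "\<dots> = 0"
      proof -
        have ins: "B - {j} = insert k (insert l ?X)" "B - {k} = insert l (insert j ?X)" "B - {l} = insert j (insert k ?X)"
          using jkl by auto
        have "psign j (B - {j}) * psign2 k l ?X = psign k (B - {k}) * psign2 l j ?X"
          unfolding ins using jkl fX by (intro psign_three_cycle) auto
        moreover have "psign k (B - {k}) * psign2 l j ?X = psign l (B - {l}) * psign2 j k ?X"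
          unfolding ins using jkl fX by (intro psign_three_cycle) auto
        ultimately show ?thesis
          by (simp only: triple_sum_3)
      qed
      finally show ?thesis .
    qed
    consider "i = r0" | "r = r0" | "r0 \<noteq> i" "r0 \<noteq> r"
      by blast
    then show ?thesis
    proof cases
      case 1
      then have "r \<in> A" "?A - {i, r} = A - {r}"
        using ir r0 by auto
      then show ?thesis
        using own_row [of r] xs y 1 by simp
    next
      case 2
      then have "i \<in> A" "?A - {i, r} = A - {i}"
        using ir r0 by auto
      then show ?thesis
        using own_row [of i] xs y 2 by (simp add: hexagon_swap)
    next
      case 3
      then have "r0 \<in> ?A - {i, r}"
        by simp
      with xs obtain p' a d x0 where p: "p = Suc p'" and ad: "a \<in> B - {j, k, l}" "d \<in> B - {j, k, l}" "a \<noteq> d"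
        and x0: "x0 \<in> sph b p' 0 (?A - {i, r} - {r0}) (B - {j, k, l} - {a, d})" and x: "x = pair b r0 a d x0"
        by (rule sph_pair_rowE)
      have irA: "i \<in> A" "r \<in> A"
        using ir 3 by auto
      have sets: "?A - {i, r} - {r0} = A - {i, r}" "B - {j, k, l} - {a, d} = B - {a} - {j, k, l, d}"
        "B - {j, k, l} - {a, d} = B - {d} - {j, k, l, a}"
        using 3 r0 by auto
      have yp: "y = pair b r0 a d (hexagon b i r j k l x0)"
        unfolding y x pair_hexagon ..
      have x0Z: "x0 \<in> Zc b (A - {i, r}) (B - {j, k, l} - {a, d}) p'"
        using sph_Zc_row_top [OF x0] unfolding sets(1) .
      have hZ: "hexagon b i r j k l x0 \<in> Ch b ({i, r} \<union> (A - {i, r})) ({j, k, l} \<union> (B - {j, k, l} - {a, d})) (p' + 2)"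
        using ir jkl by (intro hexagon_in_Ch Zc_Ch [OF x0Z]) auto
      have con: "contract (pt b r0 c) y = (if c = a then hexagon b i r j k l x0
          else if c = d then - hexagon b i r j k l x0 else 0)" for c
        unfolding yp using 3 r0 irA by (intro contract_row_pair [OF hZ _ ad(3)]) auto
      have zero: "f c (hexagon b i r j k l x0) = 0" if "{c, e} = {a, d}" "c \<noteq> e" for c e
      proof -
        have ce: "c \<in> B - {j, k, l}" "e \<in> B - {j, k, l}"
          using that(1) ad by (auto simp: doubleton_eq_iff)
        have "B - {j, k, l} - {a, d} = B - {c} - {j, k, l, e}"
          unfolding that(1) [symmetric] by auto
        then obtain v where "ssph b p' 0 (A - {i, r}) (B - {c} - {j, k, l, e}) x0 v"
          using x0 unfolding sph_def sets(1) by auto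
        moreover have "card A + card (B - {c}) = 3 * ?m"
          using ce fin card by simp
        moreover have "j \<in> B - {c}" "k \<in> B - {c}" "l \<in> B - {c}" "e \<in> B - {c}" "distinct [j, k, l, e]"
          using ce jkl that(2) by auto
        ultimately show ?thesis
          using sign_functional_hexagon [OF f [of c] fin(1) _ _ irA ir(3)] ce fin by blast
      qed
      have "hexagon b i r j k l x0 \<in> Zc b A (B - {d}) ?m"
      proof -
        have "{i, r} \<union> (A - {i, r}) = A"
          using irA by auto
        moreover have "p' + 2 = ?m"
          using card_Diff2 [OF fin(1) irA ir(3)] sph_card(3) [OF x0] unfolding sets(1) by simp
        moreover have "bd (hexagon b i r j k l x0) = 0"
          unfolding bd_hexagon [OF Zc_finitary [OF x0Z]] Zc_bd [OF x0Z] by (simp add: hexagon_def)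
        moreover have "{j, k, l} \<union> (B - {j, k, l} - {a, d}) \<subseteq> B - {d}"
          using jkl ad by auto
        ultimately show ?thesis
          using hZ by (auto simp: Zc_def intro: Ch_mono)
      qed
      then have "f d (- hexagon b i r j k l x0) = 0"
        using homology_functional_minus [OF cf [of d]] zero [of d a] ad by auto
      then show ?thesis
        unfolding \<Psi>_def con using zero [of a d] ad homology_functional_zero [OF cf] by (intro sum.neutral) auto
    qed
  qed
  have \<Psi>_0: "\<Psi> Y = 0" if Y: "Y \<in> Zc b ?A B (Suc ?m)" for Y
  proof -
    have "Y \<in> gen (hexagon_products b ?A B)"
      using Y fin r0 card by (intro top_cycles(2)) auto
    then have "\<Psi> Y = 0 \<and> Y \<in> Zc b ?A B (Suc ?m)"
    proof (induction Y rule: gen_induct_subgroup)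
      case (base x)
      then show ?case
        using \<Psi>_hex hexagon_products_Zc [of x b ?A B] fin r0 by simp
    next
      case zero
      then show ?case
        using homology_functional_zero [OF cf] by (simp add: \<Psi>_def)
    next
      case (add x y)
      then show ?case
        using \<Psi>_add by (auto intro: Zc_add)
    next
      case (minus x)
      have "\<Psi> (x + (- x)) = \<Psi> x + \<Psi> (- x)"
        using minus by (intro \<Psi>_add Zc_minus) auto
      moreover have "\<Psi> 0 = 0"
        using homology_functional_zero [OF cf] by (simp add: \<Psi>_def)
      ultimately show ?case
        using minus by (auto intro: Zc_minus)
    qed
    then show ?thesis
      by blast
  qed
  define E where "E = (\<lambda>\<zeta>. \<Sum>c\<in>B. of_int (psign c (B - {c})) * f c (\<zeta> c))"
  have E_0: "E \<zeta> = 0" if \<zeta>: "\<And>c. c \<in> B \<Longrightarrow> \<zeta> c \<in> Zc b A (B - {c}) ?m" and sum0: "(\<Sum>c\<in>B. \<zeta> c) = 0" for \<zeta>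
  proof -
    define Y where "Y = (\<Sum>c\<in>B. wedge (pt b r0 c) (\<zeta> c))"
    have "wedge (pt b r0 c) (\<zeta> c) \<in> Ch b ?A B (Suc ?m)" if "c \<in> B" for c
      using Ch_wedge_in [of "\<zeta> c" b ?A r0 B c ?m] Zc_Ch [OF \<zeta> [OF that]] that r0 by simp
    moreover have "bd Y = 0"
      unfolding Y_def using sum0 Zc_finitary [OF \<zeta>] Zc_bd [OF \<zeta>] by (simp add: bd_sum bd_wedge)
    ultimately have "Y \<in> Zc b ?A B (Suc ?m)"
      unfolding Zc_def Y_def by (auto intro: Ch_sum)
    then have "\<Psi> Y = 0"
      by (rule \<Psi>_0)
    moreover have "contract (pt b r0 c) Y = \<zeta> c" if "c \<in> B" for c
    proof -
      have "contract (pt b r0 c) (\<zeta> c') = 0" if "c' \<in> B" for c'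
        using contract_eq_0 [OF Zc_Ch [OF \<zeta> [OF that]]] r0 by blast
      then have "contract (pt b r0 c) (wedge (pt b r0 c') (\<zeta> c')) = (if c' = c then \<zeta> c else 0)" if "c' \<in> B" for c'
        using that Zc_finitary [OF \<zeta>] by (auto simp: contract_wedge_pt contract_wedge_self)
      then show ?thesis
        unfolding Y_def using that fin by (simp add: contract_sum)
    qed
    ultimately show ?thesis
      by (simp add: \<Psi>_def E_def)
  qed
  have E_eq: "E \<zeta> = E \<eta>" if "\<And>c. c \<in> B \<Longrightarrow> \<zeta> c \<in> Zc b A (B - {c}) ?m" "\<And>c. c \<in> B \<Longrightarrow> \<eta> c \<in> Zc b A (B - {c}) ?m"
    "(\<Sum>c\<in>B. \<zeta> c) = (\<Sum>c\<in>B. \<eta> c)" for \<zeta> \<eta>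
  proof -
    have "E (\<lambda>c. \<zeta> c - \<eta> c) = 0"
      using that by (intro E_0) (auto simp: sum_subtractf intro: Zc_diff)
    moreover have "E (\<lambda>c. \<zeta> c - \<eta> c) = E \<zeta> - E \<eta>"
      unfolding E_def using that by (simp add: homology_functional_diff [OF cf] right_diff_distrib sum_subtractf)
    ultimately show ?thesis
      by simp
  qed
  define \<phi> where "\<phi> = (\<lambda>z. E (SOME \<zeta>. (\<forall>c\<in>B. \<zeta> c \<in> Zc b A (B - {c}) ?m) \<and> z = (\<Sum>c\<in>B. \<zeta> c)))"
  have \<phi>_eq: "\<phi> z = E \<zeta>" if \<zeta>: "\<And>c. c \<in> B \<Longrightarrow> \<zeta> c \<in> Zc b A (B - {c}) ?m" "z = (\<Sum>c\<in>B. \<zeta> c)" for z \<zeta>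
  proof -
    have "\<exists>\<zeta>. (\<forall>c\<in>B. \<zeta> c \<in> Zc b A (B - {c}) ?m) \<and> z = (\<Sum>c\<in>B. \<zeta> c)"
      using \<zeta> by blast
    from someI_ex [OF this] show ?thesis
      unfolding \<phi>_def using \<zeta> by (intro E_eq) auto
  qed
  have decomp: "\<exists>\<zeta>. (\<forall>c\<in>B. \<zeta> c \<in> Zc b A (B - {c}) ?m) \<and> z = (\<Sum>c\<in>B. \<zeta> c)" if "z \<in> Zc b A B ?m" for z
    using that fin card by (intro gen_Union_decomposition top_cycles_avoid_column) auto
  have "homology_functional b A B ?m \<phi>"
    unfolding homology_functional_def
  proof (intro conjI ballI)
    fix x y assume "x \<in> Zc b A B ?m" "y \<in> Zc b A B ?m"
    then obtain \<zeta> \<eta> where \<zeta>: "\<And>c. c \<in> B \<Longrightarrow> \<zeta> c \<in> Zc b A (B - {c}) ?m" "x = (\<Sum>c\<in>B. \<zeta> c)"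
      and \<eta>: "\<And>c. c \<in> B \<Longrightarrow> \<eta> c \<in> Zc b A (B - {c}) ?m" "y = (\<Sum>c\<in>B. \<eta> c)"
      using decomp by metis
    have "\<phi> (x + y) = E (\<lambda>c. \<zeta> c + \<eta> c)"
      using \<zeta> \<eta> by (intro \<phi>_eq) (auto simp: sum.distrib intro: Zc_add)
    also have "\<dots> = E \<zeta> + E \<eta>"
      unfolding E_def using \<zeta>(1) \<eta>(1) by (simp add: homology_functional_add [OF cf] distrib_left sum.distrib)
    finally show "\<phi> (x + y) = \<phi> x + \<phi> y"
      using \<phi>_eq [OF \<zeta>] \<phi>_eq [OF \<eta>] by simp
  next
    fix x assume "x \<in> Bd b A B ?m"
    then have "x = 0"
      using Ch_eq_0_if_few_rows [of _ b A B "Suc ?m"] fin unfolding Bd_def by fastforce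
    moreover have "\<phi> 0 = E (\<lambda>c. 0)"
      by (intro \<phi>_eq) auto
    ultimately show "\<phi> x = 0"
      using homology_functional_zero [OF cf] by (simp add: E_def)
  qed
  moreover have "\<phi> x = of_int (psign c (B - {c}) * v)" if c: "c \<in> B" and s: "ssph b p q A (B - {c}) x v" for c p q x v
  proof -
    have "p + q = ?m"
      using ssph_card(3,4) [OF s] c fin card by simp
    then have "x \<in> Zc b A (B - {c}) ?m"
      using ssph_Zc [OF s] by simp
    then have "\<phi> x = E (\<lambda>c'. if c' = c then x else 0)"
      using c fin by (intro \<phi>_eq) auto
    also have "\<dots> = (\<Sum>c'\<in>B. if c' = c then of_int (psign c (B - {c})) * f c x else 0)"
      unfolding E_def using homology_functional_zero [OF cf] by (intro sum.cong) auto
    also have "\<dots> = of_int (psign c (B - {c})) * f c x"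
      using c fin by simp
    also have "f c x = of_int v"
      using f [OF c] s unfolding sign_functional_def by blast
    finally show ?thesis
      by simp
  qed
  moreover have False if r: "r \<in> A" and s: "ssph b p q (A - {r}) B x v" for r p q x v
    using ssph_card(3,4) [OF s] card_Suc_Diff1 [OF fin(1) r] card by linarith
  ultimately show ?thesis
    unfolding near_sign_functional_def by blast
qed

section \<open>Moving a join with a spare line to the corner\<close>

text \<open>
  The class of \<open>x\<close> is a join with a spare line, seen through a \<open>2 \<times> 2\<close> board: by
  \<open>row_pair_to_col_pair\<close> and \<open>pair_swap\<close>, the 0-spheres in any of the two rows \<open>i\<close>, \<open>r\<close> and two
  columns \<open>j\<close>, \<open>k\<close> give the same class up to sign, so it is immaterial which of the four lines is
  the spare one. The sign \<open>v\<close> is normalised to be that of the join with its spare line.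
\<close>

definition box :: "bool \<Rightarrow> nat set \<Rightarrow> nat set \<Rightarrow> nat \<Rightarrow> chain \<Rightarrow> int \<Rightarrow> nat \<Rightarrow> nat \<Rightarrow> nat \<Rightarrow> nat \<Rightarrow>
    nat \<Rightarrow> nat \<Rightarrow> nat set \<Rightarrow> nat set \<Rightarrow> chain \<Rightarrow> int \<Rightarrow> bool"
  where "box b A B s x v i r j k p q A0 B0 x0 v0 \<longleftrightarrow> A = insert i (insert r A0) \<and> B = insert j (insert k B0) \<and>
    i \<notin> A0 \<and> r \<notin> A0 \<and> i \<noteq> r \<and> j \<notin> B0 \<and> k \<notin> B0 \<and> j \<noteq> k \<and> x - pair b i j k x0 \<in> Bd b A B s \<and>
    s = Suc (p + q) \<and> ssph b p q A0 B0 x0 v0 \<and> v = - psign2 i r A0 * psign2 j k B0 * v0"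

lemma boxE:
  assumes "box b A B s x v i r j k p q A0 B0 x0 v0"
  obtains "A = insert i (insert r A0)" "B = insert j (insert k B0)"
    "i \<notin> A0" "r \<notin> A0" "i \<noteq> r" "j \<notin> B0" "k \<notin> B0" "j \<noteq> k" "x - pair b i j k x0 \<in> Bd b A B s"
    "s = Suc (p + q)" "ssph b p q A0 B0 x0 v0" "v = - psign2 i r A0 * psign2 j k B0 * v0"
    "finite A0" "finite B0"
  using assms ssph_card(1,2) unfolding box_def by metis

lemma boxI:
  assumes "A = insert i (insert r A0)" "B = insert j (insert k B0)"
    "i \<notin> A0" "r \<notin> A0" "i \<noteq> r" "j \<notin> B0" "k \<notin> B0" "j \<noteq> k" "x - pair b i j k x0 \<in> Bd b A B s"
    "s = Suc (p + q)" "ssph b p q A0 B0 x0 v0" "v = - psign2 i r A0 * psign2 j k B0 * v0"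
  shows "box b A B s x v i r j k p q A0 B0 x0 v0"
  unfolding box_def using assms by blast

lemma box_swap_cols:
  assumes "box b A B s x v i r j k p q A0 B0 x0 v0"
  shows "box b A B s x v i r k j p q A0 B0 (- x0) (- v0)"
  using assms
proof (rule boxE)
  assume *: "A = insert i (insert r A0)" "B = insert j (insert k B0)" "i \<notin> A0" "r \<notin> A0" "i \<noteq> r" "j \<notin> B0" "k \<notin> B0" "j \<noteq> k"
    "x - pair b i j k x0 \<in> Bd b A B s" "s = Suc (p + q)" and s: "ssph b p q A0 B0 x0 v0"
    and v: "v = - psign2 i r A0 * psign2 j k B0 * v0" and fin: "finite A0" "finite B0"
  show ?thesis
  proof (rule boxI [OF *(1) _ *(3-5) *(7,6) _ _ *(10) ssph.neg [OF s]])
    show "v = - psign2 i r A0 * psign2 k j B0 * - v0"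
      using psign2_swap [of B0 j k] * fin by (simp add: v)
  qed (use * in \<open>auto simp: pair_swap [of b i k j]\<close>)
qed

text \<open>
  The sign factor is the one by which the signs of joins with a spare line change under
  transposition.
\<close>

lemma box_transpose:
  assumes "box b A B s x v i r j k p q A0 B0 x0 v0"
  shows "box (\<not> b) B A s x ((-1) ^ (card A * card B) * v) j k i r q p B0 A0 x0 ((-1) ^ (p * q) * v0)"
  using assms
proof (rule boxE)
  assume *: "A = insert i (insert r A0)" "B = insert j (insert k B0)" "i \<notin> A0" "r \<notin> A0" "i \<noteq> r" "j \<notin> B0" "k \<notin> B0" "j \<noteq> k"
    "x - pair b i j k x0 \<in> Bd b A B s" "s = Suc (p + q)" and s: "ssph b p q A0 B0 x0 v0"
    and v: "v = - psign2 i r A0 * psign2 j k B0 * v0" and fin: "finite A0" "finite B0"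
  have "pair b i j k x0 - pair (\<not> b) j i r x0 \<in> Bd b A B (Suc (p + q))"
    using * by (intro row_pair_to_col_pair [OF ssph_Zc [OF s]]) auto
  from Bd_add [OF *(9) [unfolded *(10)] this]
  have x: "x - pair (\<not> b) j i r x0 \<in> Bd (\<not> b) B A s"
    unfolding Bd_transpose by (simp add: *(10))
  have "card A = Suc (Suc (p + 2 * q))" "card B = Suc (Suc (2 * p + q))"
    using * fin ssph_card(3,4) [OF s] by auto
  then have "(-1::int) ^ (card A * card B) = (-1) ^ (p * q)"
    by (intro neg_one_power_parity) auto
  then have v': "(-1) ^ (card A * card B) * v = - psign2 j k B0 * psign2 i r A0 * ((-1) ^ (p * q) * v0)"
    by (simp add: v mult_ac)
  show ?thesis
    by (rule boxI [OF *(2,1,6-8,3-5) x _ ssph_transpose [OF s] v']) (simp add: *(10))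
qed

lemma box_swap_rows:
  assumes "box b A B s x v i r j k p q A0 B0 x0 v0"
  shows "box b A B s x v r i j k p q A0 B0 (- x0) (- v0)"
  using box_transpose [OF box_swap_cols [OF box_transpose [OF assms]]]
  by (simp add: mult.commute [of "card B"] mult.commute [of q])

text \<open>
  The sphere of the box and another row sphere of the join anticommute and hence can exchange
  their roles; the other row \<open>r\<close> of the box remains.
\<close>

lemma box_row_transfer:
  assumes box: "box b A B s x v i r j k p q A0 B0 x0 v0"
    and factor: "row_factor b p q A0 B0 x0 v0 i1 a d"
  shows "\<exists>A1 B1 x1 v1. box b A B s x v i1 r a d p q A1 B1 x1 v1 \<and> row_factor b p q A1 B1 x1 v1 i j k"
  using box
proof (rule boxE)
  assume *: "A = insert i (insert r A0)" "B = insert j (insert k B0)" "i \<notin> A0" "r \<notin> A0" "i \<noteq> r" "j \<notin> B0" "k \<notin> B0" "j \<noteq> k"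
    "x - pair b i j k x0 \<in> Bd b A B s" "s = Suc (p + q)" and s: "ssph b p q A0 B0 x0 v0"
    and v: "v = - psign2 i r A0 * psign2 j k B0 * v0" and fin: "finite A0" "finite B0"
  from factor show ?thesis
  proof (rule row_factorE)
    fix p' A1 B1 x1 v1
    assume p: "p = Suc p'" and A0: "A0 = insert i1 A1" and B0: "B0 = insert a (insert d B1)"
      and new: "i1 \<notin> A1" "a \<notin> B1" "d \<notin> B1" "a \<noteq> d" and s1: "ssph b p' q A1 B1 x1 v1"
      and x0: "x0 = pair b i1 a d x1" and v0: "v0 = psign i1 A1 * psign2 a d B1 * (-1) ^ q * v1"
    have new': "i \<notin> A1" "r \<notin> A1" "i \<noteq> i1" "r \<noteq> i1" "j \<notin> B1" "k \<notin> B1" "j \<noteq> a" "j \<noteq> d" "k \<noteq> a" "k \<noteq> d"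
      using * A0 B0 by auto
    note fin1 = ssph_card(1,2) [OF s1]
    let ?v = "- (psign i A1 * psign2 j k B1 * (-1) ^ q * v1)"
    have s': "ssph b p q (insert i A1) (insert j (insert k B1)) (- pair b i j k x1) ?v"
      unfolding p using new' * by (intro ssph.neg ssph.row s1) auto
    have x': "x - pair b i1 a d (- pair b i j k x1) \<in> Bd b A B s"
      using *(9) unfolding x0 by (subst (asm) pair_pair) simp
    have e1: "psign2 i r (insert i1 A1) * psign i1 A1 = - (psign2 i1 r (insert i A1) * psign i A1)"
    proof -
      have ri: "psign r (insert i1 A1) * psign i1 A1 = - (psign i1 (insert r A1) * psign r A1)"
        using fin1 new new' by (intro psign_swap) auto
      have ii: "psign i (insert r (insert i1 A1)) * psign i1 (insert r A1)
          = - (psign i1 (insert i (insert r A1)) * psign i (insert r A1))"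
        using fin1 new new' psign_swap [of "insert r A1" i i1] *(5) by (auto simp: insert_commute)
      have ir: "psign i (insert r A1) * psign r A1 = - (psign r (insert i A1) * psign i A1)"
        using fin1 new new' *(5) by (intro psign_swap) auto
      have "psign2 i r (insert i1 A1) * psign i1 A1
          = psign i (insert r (insert i1 A1)) * (psign r (insert i1 A1) * psign i1 A1)"
        by (simp add: psign2_def)
      also have "\<dots> = - ((psign i (insert r (insert i1 A1)) * psign i1 (insert r A1)) * psign r A1)"
        unfolding ri by simp
      also have "\<dots> = psign i1 (insert i (insert r A1)) * (psign i (insert r A1) * psign r A1)"
        unfolding ii by simp
      also have "\<dots> = - (psign i1 (insert i (insert r A1)) * (psign r (insert i A1) * psign i A1))"
        unfolding ir by simp
      finally show ?thesis
        by (simp add: psign2_def insert_commute)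
    qed
    have e2: "psign2 j k (insert a (insert d B1)) * psign2 a d B1 = psign2 a d (insert j (insert k B1)) * psign2 j k B1"
      using fin1 new new' * by (intro psign2_psign2) auto
    have "v = - ((psign2 i r (insert i1 A1) * psign i1 A1) * (psign2 j k (insert a (insert d B1)) * psign2 a d B1) * (-1) ^ q * v1)"
      by (simp add: v v0 A0 B0 mult_ac)
    also have "\<dots> = - psign2 i1 r (insert i A1) * psign2 a d (insert j (insert k B1)) * ?v"
      unfolding e1 e2 by (simp add: mult_ac)
    finally have v': "v = \<dots>" .
    have "box b A B s x v i1 r a d p q (insert i A1) (insert j (insert k B1)) (- pair b i j k x1) ?v"
      by (rule boxI [OF _ _ _ _ _ _ _ new(4) x' *(10) s' v']) (use * A0 B0 new new' in auto)
    moreover have "row_factor b p q (insert i A1) (insert j (insert k B1)) (- pair b i j k x1) ?v i j k"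
      unfolding p using new' * by (intro row_factor_neg row_factor_outer s1) auto
    ultimately show ?thesis
      by blast
  qed
qed

definition in_box :: "bool \<Rightarrow> nat set \<Rightarrow> nat set \<Rightarrow> nat \<Rightarrow> chain \<Rightarrow> int \<Rightarrow> nat \<Rightarrow> nat \<Rightarrow> nat \<Rightarrow> nat \<Rightarrow> bool"
  where "in_box b A B s x v i r j k \<longleftrightarrow> (\<exists>p q A0 B0 x0 v0. box b A B s x v i r j k p q A0 B0 x0 v0)"

lemma in_boxI: "box b A B s x v i r j k p q A0 B0 x0 v0 \<Longrightarrow> in_box b A B s x v i r j k"
  unfolding in_box_def by blast

lemma in_boxE:
  assumes "in_box b A B s x v i r j k"
  obtains p q A0 B0 x0 v0 where "box b A B s x v i r j k p q A0 B0 x0 v0"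
  using assms unfolding in_box_def by auto

lemma in_box_swap:
  assumes "in_box b A B s x v i r j k"
  shows "in_box b A B s x v i r k j" "in_box b A B s x v r i j k"
  using assms by (auto elim!: in_boxE intro: in_boxI box_swap_cols box_swap_rows)

lemma in_box_transpose:
  assumes "in_box b A B s x v i r j k"
  shows "in_box (\<not> b) B A s x ((-1) ^ (card A * card B) * v) j k i r"
  using assms by (auto elim!: in_boxE intro: in_boxI box_transpose)

lemma in_box_transposeD:
  assumes "in_box (\<not> b) B A s x ((-1) ^ (card A * card B) * v) j k i r"
  shows "in_box b A B s x v i r j k"
  using in_box_transpose [OF assms] by (simp add: mult.commute [of "card B"])

text \<open>
  A row \<open>i0\<close> outside the box belongs to a sphere of \<open>x0\<close>. If this is a row sphere, transferring to
  it and, with \<open>i0\<close> as the remaining row, back to the old columns puts \<open>i0\<close> into the place of \<open>r\<close>.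
  If it is a column sphere, a transfer of the transposed box that keeps \<open>j0\<close> suffices. In both
  cases \<open>j0\<close> is not lost, so that columns can be treated in the same way afterwards.
\<close>

lemma in_box_bring_row:
  assumes box: "in_box b A B s x v i r j0 k" and i0: "i0 \<in> A"
  shows "\<exists>r' j. in_box b A B s x v i0 r' j0 j"
proof -
  obtain p q A0 B0 x0 v0 where box: "box b A B s x v i r j0 k p q A0 B0 x0 v0"
    using box by (rule in_boxE)
  then have A: "A = insert i (insert r A0)" and s: "ssph b p q A0 B0 x0 v0"
    unfolding box_def by blast+
  consider "i0 = i" | "i0 = r" | "i0 \<in> A0"
    using i0 A by blast
  then show ?thesis
  proof cases
    case 1
    then show ?thesis
      using in_boxI [OF box] by blast
  next
    case 2
    then show ?thesis
      using in_boxI [OF box_swap_rows [OF box]] by blast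
  next
    case 3
    consider a d where "row_factor b p q A0 B0 x0 v0 i0 a d" | a i1 where "col_factor b p q A0 B0 x0 v0 a i0 i1"
      using ssph_row_cases [OF s 3] by blast
    then show ?thesis
    proof cases
      case (1 a d)
      obtain A1 B1 x1 v1 where 1: "box b A B s x v i0 r a d p q A1 B1 x1 v1"
        and f: "row_factor b p q A1 B1 x1 v1 i j0 k"
        using box_row_transfer [OF box 1] by blast
      obtain A2 B2 x2 v2 where "box b A B s x v i i0 j0 k p q A2 B2 x2 v2"
        using box_row_transfer [OF box_swap_rows [OF 1] row_factor_neg [OF f]] by blast
      then show ?thesis
        using in_box_swap(2) [OF in_boxI] by blast
    next
      case (2 a i1)
      have tbox: "box (\<not> b) B A s x ((-1) ^ (card A * card B) * v) k j0 i r q p B0 A0 (- x0) (- ((-1) ^ (p * q) * v0))"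
        by (rule box_swap_rows [OF box_transpose [OF box]])
      have tfactor: "row_factor (\<not> b) q p B0 A0 (- x0) (- ((-1) ^ (p * q) * v0)) a i0 i1"
        using 2 unfolding col_factor_def by (rule row_factor_neg)
      have "in_box (\<not> b) B A s x ((-1) ^ (card A * card B) * v) a j0 i0 i1"
        using box_row_transfer [OF tbox tfactor] in_boxI [of "\<not> b"] by blast
      then have "in_box b A B s x v i0 i1 a j0"
        by (rule in_box_transposeD)
      then show ?thesis
        using in_box_swap(1) by blast
    qed
  qed
qed

lemma in_box_bring_corner:
  assumes box: "in_box b A B s x v i r j k" and "i0 \<in> A" "j0 \<in> B"
  shows "\<exists>r' j'. in_box b A B s x v i0 r' j0 j'"
proof -
  obtain r1 k1 where "in_box b A B s x v i0 r1 j k1"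
    using in_box_bring_row [OF box assms(2)] by blast
  then have "in_box (\<not> b) B A s x ((-1) ^ (card A * card B) * v) j k1 i0 r1"
    by (rule in_box_transpose)
  then obtain k2 r2 where "in_box (\<not> b) B A s x ((-1) ^ (card A * card B) * v) j0 k2 i0 r2"
    using in_box_bring_row assms(3) by blast
  then show ?thesis
    using in_box_transposeD by blast
qed

lemma ssph_spare_row_in_box:
  assumes s: "ssph b p q (A - {r}) B x v" and r: "r \<in> A" and p: "p > 0"
  shows "\<exists>i j k. in_box b A B (p + q) x ((-1) ^ q * psign r (A - {r}) * v) i r j k"
proof -
  obtain i j k where "row_factor b p q (A - {r}) B x v i j k"
    using ssph_row_factor [OF s p] by blast
  then show ?thesis
  proof (rule row_factorE)
    fix p' A0 B0 x0 v0
    assume p: "p = Suc p'" and A: "A - {r} = insert i A0" and B: "B = insert j (insert k B0)"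
      and new: "i \<notin> A0" "j \<notin> B0" "k \<notin> B0" "j \<noteq> k" and s0: "ssph b p' q A0 B0 x0 v0" and x: "x = pair b i j k x0"
      and v: "v = psign i A0 * psign2 j k B0 * (-1) ^ q * v0"
    have A': "A = insert i (insert r A0)" "r \<notin> A0" "i \<noteq> r"
      using A r by auto
    have "psign2 r i A0 = - psign2 i r A0"
      using ssph_card(1) [OF s0] A' new by (intro psign2_swap) auto
    then have "psign r (insert i A0) * psign i A0 = - psign2 i r A0"
      by (simp add: psign2_def)
    moreover have "(-1) ^ q * psign r (A - {r}) * v
        = (psign r (insert i A0) * psign i A0) * psign2 j k B0 * ((-1) ^ q * ((-1) ^ q * v0))"
      unfolding A v by (simp add: mult_ac)
    ultimately have v': "(-1) ^ q * psign r (A - {r}) * v = - psign2 i r A0 * psign2 j k B0 * v0"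
      by simp
    have "box b A B (p + q) x ((-1) ^ q * psign r (A - {r}) * v) i r j k p' q A0 B0 x0 v0"
      by (rule boxI [OF A'(1) B new(1) A'(2,3) new(2-4) _ _ s0 v']) (simp_all add: x p)
    then show ?thesis
      using in_boxI by blast
  qed
qed

lemma ssph_spare_col_in_box:
  assumes s: "ssph b p q A (B - {c}) x v" and c: "c \<in> B" and q: "q > 0"
  shows "\<exists>i r j k. in_box b A B (p + q) x (psign c (B - {c}) * v) i r j k"
proof -
  have fin: "finite B"
    using ssph_card(2) [OF s] by simp
  obtain j i i' where box: "in_box (\<not> b) B A (q + p) x ((-1) ^ p * psign c (B - {c}) * ((-1) ^ (p * q) * v)) j c i i'"
    using ssph_spare_row_in_box [OF ssph_transpose [OF s] c q] by blast
  have "card A = p + 2 * q" "card B = Suc (2 * p + q)"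
    using ssph_card(3,4) [OF s] card_Suc_Diff1 [OF fin c] by simp_all
  then have "(-1::int) ^ (card A * card B) = (-1) ^ p * (-1) ^ (p * q)"
    unfolding power_add [symmetric] by (intro neg_one_power_parity) auto
  then have "(-1) ^ p * psign c (B - {c}) * ((-1) ^ (p * q) * v) = (-1) ^ (card A * card B) * (psign c (B - {c}) * v)"
    by (simp add: mult_ac)
  then show ?thesis
    using in_box_transposeD box unfolding add.commute [of q p] by metis
qed

lemma near_sign_functional_transpose:
  assumes "near_sign_functional (\<not> b) B A s f" "finite A" "finite B"
  shows "\<exists>\<phi>. near_sign_functional b A B s \<phi>"
proof -
  let ?\<kappa> = "(-1::int) ^ (card A * card B)"
  define \<phi> where "\<phi> = (\<lambda>x. of_int ?\<kappa> * f x)"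
  have cf: "homology_functional (\<not> b) B A s f"
    by (rule near_sign_functionalD(1) [OF assms(1)])
  then have "homology_functional b A B s \<phi>"
    unfolding homology_functional_def \<phi>_def Zc_transpose Bd_transpose by (simp add: distrib_left)
  moreover have "\<phi> x = of_int (psign c (B - {c}) * v)" if c: "c \<in> B" and s: "ssph b p q A (B - {c}) x v" for c p q x v
  proof -
    have "card A = p + 2 * q" "card B = Suc (2 * p + q)"
      using ssph_card(3,4) [OF s] card_Suc_Diff1 [OF assms(3) c] by simp_all
    then have "?\<kappa> = (-1) ^ p * (-1) ^ (p * q)"
      unfolding power_add [symmetric] by (intro neg_one_power_parity) auto
    then have "?\<kappa> * ((-1) ^ p * psign c (B - {c}) * ((-1) ^ (p * q) * v)) = psign c (B - {c}) * v"
      by (simp add: mult_ac)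
    then show ?thesis
      unfolding \<phi>_def near_sign_functionalD(3) [OF assms(1) c ssph_transpose [OF s]] by (simp only: of_int_mult [symmetric])
  qed
  moreover have "\<phi> x = of_int ((-1) ^ q * psign r (A - {r}) * v)"
    if r: "r \<in> A" and s: "ssph b p q (A - {r}) B x v" for r p q x v
  proof -
    have "card A = Suc (p + 2 * q)" "card B = 2 * p + q"
      using ssph_card(3,4) [OF s] card_Suc_Diff1 [OF assms(2) r] by simp_all
    then have "?\<kappa> = (-1) ^ q * (-1) ^ (p * q)"
      unfolding power_add [symmetric] by (intro neg_one_power_parity) auto
    then have "?\<kappa> * (psign r (A - {r}) * ((-1) ^ (p * q) * v)) = (-1) ^ q * psign r (A - {r}) * v"
      by (simp add: mult_ac)
    then show ?thesis
      unfolding \<phi>_def near_sign_functionalD(2) [OF assms(1) r ssph_transpose [OF s]] by (simp only: of_int_mult [symmetric])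
  qed
  ultimately show ?thesis
    unfolding near_sign_functional_def by blast
qed

section \<open>Existence of the sign functional\<close>

text \<open>
  By \<open>star_generation\<close> a cycle is homologous to a star sum \<open>R (y, u)\<close>, and \<open>\<phi>\<close> is the
  corresponding signed sum of values of the given functionals \<open>f j\<close> and \<open>g i\<close>. It is well defined:
  if \<open>R (y, u)\<close> is the boundary of \<open>c\<close>, the coefficients \<open>q i j\<close> of \<open>c\<close> at two rooks \<open>(i0, j)\<close>,
  \<open>(i, j0)\<close> are cycles, \<open>y j\<close> is homologous to \<open>- (\<Sum>i. q i j)\<close> and \<open>u i\<close> to \<open>\<Sum>j. q i j\<close>.
  The contributions cancel since \<open>f j\<close> and \<open>g i\<close>, up to their signs, have the same value at
  \<open>q i j\<close>: modulo boundaries it is generated by joins, for which row \<open>i\<close> or column \<open>j\<close> is spare.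
  Finally, any join with a spare line has the right value because its box can be moved to the
  corner.
\<close>

lemma near_sign_functional_step:
  assumes fin: "finite A" "finite B" and card: "card A + card B = 3 * Suc n + 1"
    and range: "card A + 2 \<le> 2 * card B" "card B + 2 \<le> 2 * card A"
    and ij: "i0 \<in> A" "j0 \<in> B"
    and row: "\<And>j. j \<in> B - {j0} \<Longrightarrow> \<exists>\<phi>. near_sign_functional b (A - {i0}) (B - {j0, j}) n \<phi>"
    and col: "\<And>i. i \<in> A - {i0} \<Longrightarrow> \<exists>\<phi>. near_sign_functional b (A - {i0, i}) (B - {j0}) n \<phi>"
  shows "\<exists>\<phi>. near_sign_functional b A B (Suc n) \<phi>"
proof -
  obtain f where f: "\<And>j. j \<in> B - {j0} \<Longrightarrow> near_sign_functional b (A - {i0}) (B - {j0, j}) n (f j)"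
    using row by metis
  obtain g where g: "\<And>i. i \<in> A - {i0} \<Longrightarrow> near_sign_functional b (A - {i0, i}) (B - {j0}) n (g i)"
    using col by metis
  note cf = near_sign_functionalD(1) [OF f] and cg = near_sign_functionalD(1) [OF g]
  \<comment> \<open>these are the signs that a star generator \<open>pair b i0 j j0 x\<close> or \<open>pair (\<not> b) j0 i i0 x\<close> with a spare line forces\<close>
  define \<alpha> where "\<alpha> = (\<lambda>j. - (psign i0 (A - {i0}) * psign2 j j0 (B - {j0, j}) * (-1) ^ card B))"
  define \<beta> where "\<beta> = (\<lambda>i. - (psign j0 (B - {j0}) * psign2 i i0 (A - {i0, i})))"
  have compat: "of_int (\<alpha> j) * f j q = of_int (\<beta> i) * g i q"
    if i: "i \<in> A - {i0}" and j: "j \<in> B - {j0}" and q: "q \<in> Zc b (A - {i0, i}) (B - {j0, j}) n" for i j q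
  proof -
    have cards: "Suc (Suc (card (A - {i0, i}))) = card A" "Suc (Suc (card (B - {j0, j}))) = card B"
      using card_Diff2 [of A i0 i] card_Diff2 [of B j0 j] fin ij i j by auto
    have sub: "x \<in> Zc b (A - {i0}) (B - {j0, j}) n" "x \<in> Zc b (A - {i0, i}) (B - {j0}) n"
      if "x \<in> Zc b (A - {i0, i}) (B - {j0, j}) n" for x
      using that by (auto elim: Zc_mono)
    have "q \<in> gen (products b (A - {i0, i}) (B - {j0, j}) \<union> Bd b (A - {i0, i}) (B - {j0, j}) n)"
      using cards fin card range q by (intro cycles_gen_products) auto
    then have "of_int (\<alpha> j) * f j q = of_int (\<beta> i) * g i q \<and> q \<in> Zc b (A - {i0, i}) (B - {j0, j}) n"
    proof (induction q rule: gen_induct_subgroup)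
      case (base x)
      then consider "x \<in> Bd b (A - {i0, i}) (B - {j0, j}) n"
        | p q v where "ssph b p q (A - {i0, i}) (B - {j0, j}) x v"
        unfolding products_def sph_def by blast
      then show ?case
      proof cases
        case 1
        then have "x \<in> Bd b (A - {i0}) (B - {j0, j}) n" "x \<in> Bd b (A - {i0, i}) (B - {j0}) n"
          by (auto elim: Bd_mono)
        then show ?thesis
          using homology_functional_Bd [OF cf [OF j]] homology_functional_Bd [OF cg [OF i]] Bd_subset_Zc [OF 1] by simp
      next
        case (2 p q v)
        have "p + q = n"
          using ssph_card(3,4) [OF 2] cards card by simp
        have AB: "A - {i0} - {i} = A - {i0, i}" "B - {j0} - {j} = B - {j0, j}"
          "A - {i0} = insert i (A - {i0, i})" "B - {j0} = insert j (B - {j0, j})"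
          using i j by auto
        have fv: "f j x = of_int ((-1) ^ q * psign i (A - {i0, i}) * v)"
          using near_sign_functionalD(3) [OF f [OF j] i, of p q x v] 2 unfolding AB(1) by blast
        have gv: "g i x = of_int (psign j (B - {j0, j}) * v)"
          using near_sign_functionalD(2) [OF g [OF i] j, of p q x v] 2 unfolding AB(2) by blast
        have "card B = Suc (Suc (2 * p + q))"
          using ssph_card(4) [OF 2] cards by simp
        then have e: "(-1::int) ^ card B = (-1) ^ q"
          by (intro neg_one_power_parity) auto
        have "\<alpha> j * ((-1) ^ q * psign i (A - {i0, i}) * v)
            = - ((psign i0 (insert i (A - {i0, i})) * psign i (A - {i0, i})) * psign2 j j0 (B - {j0, j}) * ((-1) ^ q * ((-1) ^ q * v)))"
          unfolding \<alpha>_def e AB(3) by (simp add: mult_ac)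
        also have "\<dots> = - (psign2 i0 i (A - {i0, i}) * psign2 j j0 (B - {j0, j}) * v)"
          by (simp add: psign2_def)
        also have "\<dots> = - ((psign j0 (insert j (B - {j0, j})) * psign j (B - {j0, j})) * psign2 i i0 (A - {i0, i}) * v)"
        proof -
          have "psign2 i0 i (A - {i0, i}) = - psign2 i i0 (A - {i0, i})"
            "psign2 j j0 (B - {j0, j}) = - psign2 j0 j (B - {j0, j})"
            using fin i j by (intro psign2_swap; auto)+
          then show ?thesis
            by (simp add: psign2_def)
        qed
        also have "\<dots> = \<beta> i * (psign j (B - {j0, j}) * v)"
          unfolding \<beta>_def AB(4) by (simp add: mult_ac)
        finally have eq: "\<alpha> j * ((-1) ^ q * psign i (A - {i0, i}) * v) = \<beta> i * (psign j (B - {j0, j}) * v)" .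
        have "of_int (\<alpha> j) * f j x = of_int (\<beta> i) * g i x"
          unfolding fv gv of_int_mult [symmetric] eq ..
        then show ?thesis
          using ssph_Zc [OF 2] \<open>p + q = n\<close> by simp
      qed
    next
      case zero
      then show ?case
        using homology_functional_zero [OF cf [OF j]] homology_functional_zero [OF cg [OF i]] by simp
    next
      case (add x y)
      then show ?case
        using homology_functional_add [OF cf [OF j]] homology_functional_add [OF cg [OF i]] sub
        by (simp add: distrib_left Zc_add)
    next
      case (minus x)
      then show ?case
        using homology_functional_minus [OF cf [OF j]] homology_functional_minus [OF cg [OF i]] sub
        by (simp add: Zc_minus)
    qed
    then show ?thesis
      by blast
  qed
  define valid where "valid = (\<lambda>(y :: nat \<Rightarrow> chain, u :: nat \<Rightarrow> chain).
    (\<forall>j\<in>B - {j0}. y j \<in> Zc b (A - {i0}) (B - {j0, j}) n) \<and> (\<forall>i\<in>A - {i0}. u i \<in> Zc b (A - {i0, i}) (B - {j0}) n))"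
  define E where "E = (\<lambda>(y, u). (\<Sum>j\<in>B - {j0}. of_int (\<alpha> j) * f j (y j)) + (\<Sum>i\<in>A - {i0}. of_int (\<beta> i) * g i (u i)))"
  define R where "R = (\<lambda>(y, u). star_sum b A B i0 j0 y u)"
  have E_0: "E yu = 0" if v: "valid yu" and R: "R yu \<in> Bd b A B (Suc n)" for yu
  proof -
    obtain y u where yu: "yu = (y, u)"
      by fastforce
    have y: "y j \<in> Zc b (A - {i0}) (B - {j0, j}) n" if "j \<in> B - {j0}" for j
      using v that by (simp add: valid_def yu)
    have u: "u i \<in> Zc b (A - {i0, i}) (B - {j0}) n" if "i \<in> A - {i0}" for i
      using v that by (simp add: valid_def yu)
    obtain c where c: "c \<in> Ch b A B (Suc (Suc n))" and Rc: "star_sum b A B i0 j0 y u = bd c"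
      using R by (auto simp: R_def yu Bd_def)
    have cy: "contract (pt b i0 j) (bd c) = y j" if "j \<in> B - {j0}" for j
      unfolding Rc [symmetric] by (rule star_sum_contract(1) [OF fin y u that])
    have cu: "contract (pt b i j0) (bd c) = u i" if "i \<in> A - {i0}" for i
      unfolding Rc [symmetric] by (rule star_sum_contract(2) [OF fin y u that])
    define q where "q = (\<lambda>i j. contract (pt b i j0) (contract (pt b i0 j) c))"
    have cj: "contract (pt b i0 j) c \<in> Ch b (A - {i0}) (B - {j}) (Suc n)" for j
      using c by (rule contract_in_Ch)
    have ci: "contract (pt b i j0) c \<in> Ch b (A - {i}) (B - {j0}) (Suc n)" for i
      using c by (rule contract_in_Ch)
    have q: "q i j \<in> Zc b (A - {i0, i}) (B - {j0, j}) n" if i: "i \<in> A - {i0}" and j: "j \<in> B - {j0}" for i j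
    proof -
      have "contract (pt b i j0) (y j) = 0"
        using contract_eq_0 [OF Zc_Ch [OF y [OF j]]] by blast
      then have "bd (q i j) = 0"
        using cy [OF j] by (simp add: q_def bd_contract)
      moreover have "q i j \<in> Ch b (A - {i0} - {i}) (B - {j} - {j0}) n"
        unfolding q_def by (rule contract_in_Ch [OF cj])
      ultimately show ?thesis
        by (simp add: Zc_def Diff_insert2 [symmetric] insert_commute)
    qed
    have qsub: "q i j \<in> Zc b (A - {i0}) (B - {j0, j}) n" "q i j \<in> Zc b (A - {i0, i}) (B - {j0}) n"
      if "i \<in> A - {i0}" "j \<in> B - {j0}" for i j
      using q [OF that] by (auto elim: Zc_mono)
    have fy: "f j (y j) = - (\<Sum>i\<in>A - {i0}. f j (q i j))" if j: "j \<in> B - {j0}" for j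
    proof -
      define p where "p = contract (pt b i0 j) c - (\<Sum>i\<in>A - {i0}. wedge (pt b i j0) (q i j))"
      have "p \<in> Ch b (A - {i0}) (B - {j} - {j0}) (Suc n)"
        using row_expansion [of "contract (pt b i0 j) c" "\<not> b" "B - {j}" "A - {i0}" "Suc n" j0] cj fin
        by (simp add: Ch_transpose p_def q_def)
      then have pB: "bd p \<in> Bd b (A - {i0}) (B - {j0, j}) n"
        by (intro BdI) (simp add: Diff_insert2 [symmetric] insert_commute)
      have "bd p = - y j - (\<Sum>i\<in>A - {i0}. q i j)"
        unfolding p_def using cy [OF j] Zc_finitary [OF q [OF _ j]] Zc_bd [OF q [OF _ j]]
        by (simp add: bd_sum bd_wedge bd_contract)
      then have "y j = - bd p - (\<Sum>i\<in>A - {i0}. q i j)"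
        by simp
      then have "f j (y j) = f j (- bd p) - f j (\<Sum>i\<in>A - {i0}. q i j)"
        using homology_functional_diff [OF cf [OF j] Zc_minus [OF Bd_subset_Zc [OF pB]], of "\<Sum>i\<in>A - {i0}. q i j"] qsub(1) [OF _ j]
        by (auto intro: Zc_sum)
      also have "f j (- bd p) = 0"
        by (rule homology_functional_Bd [OF cf [OF j] Bd_minus [OF pB]])
      also have "f j (\<Sum>i\<in>A - {i0}. q i j) = (\<Sum>i\<in>A - {i0}. f j (q i j))"
        by (rule homology_functional_sum [OF cf [OF j]]) (rule qsub(1) [OF _ j])
      finally show ?thesis
        by simp
    qed
    have gu: "g i (u i) = (\<Sum>j\<in>B - {j0}. g i (q i j))" if i: "i \<in> A - {i0}" for i
    proof -
      define p where "p = contract (pt b i j0) c + (\<Sum>j\<in>B - {j0}. wedge (pt b i0 j) (q i j))"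
      have "contract (pt b i0 j) (contract (pt b i j0) c) = - q i j" for j
        unfolding q_def by (rule contract_contract)
      then have "p \<in> Ch b (A - {i} - {i0}) (B - {j0}) (Suc n)"
        using row_expansion [OF ci [of i], of i0] fin by (simp add: p_def sum_negf)
      then have pB: "bd p \<in> Bd b (A - {i0, i}) (B - {j0}) n"
        by (intro BdI) (simp add: Diff_insert2 [symmetric] insert_commute)
      have "bd p = - u i + (\<Sum>j\<in>B - {j0}. q i j)"
        unfolding p_def using cu [OF i] Zc_finitary [OF q [OF i]] Zc_bd [OF q [OF i]]
        by (simp add: bd_sum bd_wedge bd_contract)
      then have "u i = - bd p + (\<Sum>j\<in>B - {j0}. q i j)"
        by simp
      then have "g i (u i) = g i (- bd p) + g i (\<Sum>j\<in>B - {j0}. q i j)"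
        using homology_functional_add [OF cg [OF i] Zc_minus [OF Bd_subset_Zc [OF pB]], of "\<Sum>j\<in>B - {j0}. q i j"] qsub(2) [OF i]
        by (auto intro: Zc_sum)
      also have "g i (- bd p) = 0"
        by (rule homology_functional_Bd [OF cg [OF i] Bd_minus [OF pB]])
      also have "g i (\<Sum>j\<in>B - {j0}. q i j) = (\<Sum>j\<in>B - {j0}. g i (q i j))"
        by (rule homology_functional_sum [OF cg [OF i]]) (rule qsub(2) [OF i])
      finally show ?thesis
        by simp
    qed
    have "(\<Sum>i\<in>A - {i0}. of_int (\<beta> i) * g i (u i)) = (\<Sum>i\<in>A - {i0}. \<Sum>j\<in>B - {j0}. of_int (\<beta> i) * g i (q i j))"
      by (simp add: gu sum_distrib_left)
    also have "\<dots> = (\<Sum>j\<in>B - {j0}. \<Sum>i\<in>A - {i0}. of_int (\<beta> i) * g i (q i j))"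
      by (rule sum.swap)
    also have "\<dots> = (\<Sum>j\<in>B - {j0}. \<Sum>i\<in>A - {i0}. of_int (\<alpha> j) * f j (q i j))"
      using compat q by (intro sum.cong refl) simp
    also have "\<dots> = - (\<Sum>j\<in>B - {j0}. of_int (\<alpha> j) * f j (y j))"
      by (simp add: fy sum_distrib_left sum_negf)
    finally show ?thesis
      by (simp add: E_def yu)
  qed
  have R_pt: "R (\<lambda>j. y j + y' j, \<lambda>i. u i + u' i) = R (y, u) + R (y', u')"
    "R (\<lambda>j. - y j, \<lambda>i. - u i) = - R (y, u)" for y y' u u'
    by (simp_all add: R_def star_sum_def sum.distrib sum_negf)
  have E_pt: "E (\<lambda>j. y j + y' j, \<lambda>i. u i + u' i) = E (y, u) + E (y', u')"
    if "valid (y, u)" "valid (y', u')" for y y' u u'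
    using that by (simp add: E_def valid_def homology_functional_add [OF cf] homology_functional_add [OF cg] sum.distrib distrib_left)
  have E_neg: "E (\<lambda>j. - y j, \<lambda>i. - u i) = - E (y, u)" if "valid (y, u)" for y u
    using that by (simp add: E_def valid_def homology_functional_minus [OF cf] homology_functional_minus [OF cg] sum_negf)
  have valid_add: "valid (\<lambda>j. y j + y' j, \<lambda>i. u i + u' i)" if "valid (y, u)" "valid (y', u')" for y y' u u'
    using that by (simp add: valid_def Zc_add)
  have valid_neg: "valid (\<lambda>j. - y j, \<lambda>i. - u i)" if "valid (y, u)" for y u
    using that by (simp add: valid_def Zc_minus)
  have E_eq: "E yu = E yu'" if "valid yu" "valid yu'" "z - R yu \<in> Bd b A B (Suc n)" "z - R yu' \<in> Bd b A B (Suc n)" for z yu yu'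
  proof -
    obtain y u y' u' where yu: "yu = (y, u)" "yu' = (y', u')"
      by fastforce
    let ?w = "(\<lambda>j. y j + - y' j, \<lambda>i. u i + - u' i)"
    have Rw: "R ?w = (z - R yu') - (z - R yu)"
      unfolding yu R_pt(1) [of y "\<lambda>j. - y' j"] R_pt(2) by simp
    have "R ?w \<in> Bd b A B (Suc n)"
      unfolding Rw by (rule Bd_diff [OF that(4,3)])
    then have "E ?w = 0"
      using that yu by (intro E_0 valid_add valid_neg) auto
    moreover have "E ?w = E yu - E yu'"
      unfolding yu using E_pt [of y u "\<lambda>j. - y' j" "\<lambda>i. - u' i"] E_neg [of y' u'] valid_neg [of y' u'] that yu by simp
    ultimately show ?thesis
      by simp
  qed
  define \<phi> where "\<phi> = (\<lambda>z. E (SOME yu. valid yu \<and> z - R yu \<in> Bd b A B (Suc n)))"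
  have \<phi>_eq: "\<phi> z = E yu" if yu: "valid yu" "z - R yu \<in> Bd b A B (Suc n)" for z yu
  proof -
    have "\<exists>yu. valid yu \<and> z - R yu \<in> Bd b A B (Suc n)"
      using yu by blast
    from someI_ex [OF this] show ?thesis
      unfolding \<phi>_def using yu E_eq by blast
  qed
  have R0: "valid (\<lambda>j. 0, \<lambda>i. 0)" "R (\<lambda>j. 0, \<lambda>i. 0) = 0" "E (\<lambda>j. 0, \<lambda>i. 0) = 0"
    using homology_functional_zero [OF cf] homology_functional_zero [OF cg] by (simp_all add: valid_def R_def star_sum_def E_def)
  have R_row: "valid (\<lambda>l. if l = j then x else 0, \<lambda>i. 0)" "R (\<lambda>l. if l = j then x else 0, \<lambda>i. 0) = pair b i0 j j0 x"
    "E (\<lambda>l. if l = j then x else 0, \<lambda>i. 0) = of_int (\<alpha> j) * f j x"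
    if "j \<in> B - {j0}" "x \<in> Zc b (A - {i0}) (B - {j0, j}) n" for j x
  proof -
    have "pair b i0 l j0 (if l = j then x else 0) = (if l = j then pair b i0 j j0 x else 0)" for l
      by simp
    moreover have "of_int (\<alpha> l) * f l (if l = j then x else 0) = (if l = j then of_int (\<alpha> j) * f j x else 0)"
      if "l \<in> B - {j0}" for l
      using homology_functional_zero [OF cf [OF that]] by simp
    ultimately show "valid (\<lambda>l. if l = j then x else 0, \<lambda>i. 0)"
      "R (\<lambda>l. if l = j then x else 0, \<lambda>i. 0) = pair b i0 j j0 x"
      "E (\<lambda>l. if l = j then x else 0, \<lambda>i. 0) = of_int (\<alpha> j) * f j x"
      using that fin homology_functional_zero [OF cg] by (simp_all add: valid_def R_def star_sum_def E_def)
  qed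
  have R_col: "valid (\<lambda>j. 0, \<lambda>l. if l = i then x else 0)" "R (\<lambda>j. 0, \<lambda>l. if l = i then x else 0) = pair (\<not> b) j0 i i0 x"
    if "i \<in> A - {i0}" "x \<in> Zc b (A - {i0, i}) (B - {j0}) n" for i x
  proof -
    have "pair (\<not> b) j0 l i0 (if l = i then x else 0) = (if l = i then pair (\<not> b) j0 i i0 x else 0)" for l
      by simp
    then show "valid (\<lambda>j. 0, \<lambda>l. if l = i then x else 0)"
      "R (\<lambda>j. 0, \<lambda>l. if l = i then x else 0) = pair (\<not> b) j0 i i0 x"
      using that fin by (simp_all add: valid_def R_def star_sum_def)
  qed
  have ex: "\<exists>y u. valid (y, u) \<and> z - R (y, u) \<in> Bd b A B (Suc n)" if z: "z \<in> Zc b A B (Suc n)" for z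
  proof -
    have "z \<in> gen (star_gens b A B i0 j0 n \<union> Bd b A B (Suc n))"
      by (rule star_generation [OF fin ij z], rule vanishing_corner) (use fin ij card range in auto)
    then show ?thesis
    proof (induction z rule: gen_induct_subgroup)
      case (base x)
      then consider "x \<in> Bd b A B (Suc n)" | "x \<in> star_gens b A B i0 j0 n"
        by blast
      then show ?case
      proof cases
        case 1
        then show ?thesis
          using R0 by (intro exI [of _ "\<lambda>j. 0"]) auto
      next
        case 2
        then show ?thesis
        proof (cases rule: star_gens_cases)
          case (row j y)
          then show ?thesis
            using R_row(1,2) [OF row(1,2)] by (metis Bd_zero diff_self)
        next
          case (col i y)
          then show ?thesis
            using R_col(1,2) [OF col(1,2)] by (metis Bd_zero diff_self)
        qed
      qed
    next
      case zero
      then show ?case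
        using R0 by (metis Bd_zero diff_self)
    next
      case (add x x')
      then obtain y u y' u' where v: "valid (y, u)" "valid (y', u')"
        and B: "x - R (y, u) \<in> Bd b A B (Suc n)" "x' - R (y', u') \<in> Bd b A B (Suc n)"
        by blast
      have "x + x' - R (\<lambda>j. y j + y' j, \<lambda>i. u i + u' i) \<in> Bd b A B (Suc n)"
        unfolding R_pt using Bd_add [OF B] by (simp add: algebra_simps)
      then show ?case
        using valid_add [OF v] by blast
    next
      case (minus x)
      then obtain y u where v: "valid (y, u)" and B: "x - R (y, u) \<in> Bd b A B (Suc n)"
        by blast
      have "- x - R (\<lambda>j. - y j, \<lambda>i. - u i) \<in> Bd b A B (Suc n)"
        unfolding R_pt using Bd_minus [OF B] by (simp add: algebra_simps)
      then show ?case
        using valid_neg [OF v] by blast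
    qed
  qed
  have cphi: "homology_functional b A B (Suc n) \<phi>"
    unfolding homology_functional_def
  proof (intro conjI ballI)
    fix x x' assume "x \<in> Zc b A B (Suc n)" "x' \<in> Zc b A B (Suc n)"
    then obtain y u y' u' where v: "valid (y, u)" "valid (y', u')"
      and B: "x - R (y, u) \<in> Bd b A B (Suc n)" "x' - R (y', u') \<in> Bd b A B (Suc n)"
      using ex by metis
    have "x + x' - R (\<lambda>j. y j + y' j, \<lambda>i. u i + u' i) \<in> Bd b A B (Suc n)"
      unfolding R_pt using Bd_add [OF B] by (simp add: algebra_simps)
    then show "\<phi> (x + x') = \<phi> x + \<phi> x'"
      using \<phi>_eq [OF v(1) B(1)] \<phi>_eq [OF v(2) B(2)] \<phi>_eq [OF valid_add [OF v]] E_pt [OF v] by simp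
  next
    fix x assume "x \<in> Bd b A B (Suc n)"
    then show "\<phi> x = 0"
      using \<phi>_eq [OF R0(1)] R0 by simp
  qed
  \<comment> \<open>all joins with a spare line are treated at once, through a box at the corner\<close>
  have phi_box: "\<phi> x = of_int v" if box: "in_box b A B (Suc n) x v i r j k" for x v i r j k
  proof -
    obtain r' j' where "in_box b A B (Suc n) x v i0 r' j0 j'"
      using in_box_bring_corner [OF box ij] by blast
    then have "in_box b A B (Suc n) x v i0 r' j' j0"
      by (rule in_box_swap(1))
    then obtain p q A0 B0 x0 v0 where "box b A B (Suc n) x v i0 r' j' j0 p q A0 B0 x0 v0"
      by (rule in_boxE)
    then have AB: "A = insert i0 (insert r' A0)" "B = insert j' (insert j0 B0)" "i0 \<notin> A0" "r' \<notin> A0" "i0 \<noteq> r'"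
        "j' \<notin> B0" "j0 \<notin> B0" "j' \<noteq> j0" "x - pair b i0 j' j0 x0 \<in> Bd b A B (Suc n)"
        "n = p + q" and s: "ssph b p q A0 B0 x0 v0" and v: "v = - psign2 i0 r' A0 * psign2 j' j0 B0 * v0"
        and fin0: "finite A0" "finite B0"
      by (auto elim: boxE)
    have sets: "A - {i0} = insert r' A0" "B - {j0, j'} = B0" "A - {i0} - {r'} = A0" "insert r' A0 - {r'} = A0"
      using AB by auto
    have j': "j' \<in> B - {j0}" and r': "r' \<in> A - {i0}"
      using AB by auto
    have x0: "x0 \<in> Zc b (A - {i0}) (B - {j0, j'}) n"
      using ssph_Zc [OF s] unfolding sets AB(10) by (auto elim: Zc_mono)
    have "f j' x0 = of_int ((-1) ^ q * psign r' A0 * v0)"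
      using near_sign_functionalD(3) [OF f [OF j'] r', of p q x0 v0] s unfolding sets by blast
    moreover have "\<phi> x = of_int (\<alpha> j') * f j' x0"
      using \<phi>_eq [OF R_row(1) [OF j' x0]] R_row(2,3) [OF j' x0] AB(9) by simp
    ultimately have "\<phi> x = of_int (\<alpha> j' * ((-1) ^ q * psign r' A0 * v0))"
      by simp
    also have "\<alpha> j' * ((-1) ^ q * psign r' A0 * v0) = v"
    proof -
      have "card B = Suc (Suc (2 * p + q))"
        using AB fin0 ssph_card(4) [OF s] by simp
      then have e: "(-1::int) ^ card B = (-1) ^ q"
        by (intro neg_one_power_parity) auto
      have "\<alpha> j' * ((-1) ^ q * psign r' A0 * v0)
          = - ((psign i0 (insert r' A0) * psign r' A0) * psign2 j' j0 B0 * ((-1) ^ q * ((-1) ^ q * v0)))"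
        unfolding \<alpha>_def e sets by (simp add: mult_ac)
      then show ?thesis
        by (simp add: v psign2_def)
    qed
    finally show ?thesis .
  qed
  show ?thesis
  proof (intro exI [of _ \<phi>], unfold near_sign_functional_def, intro conjI cphi ballI allI impI)
    fix c p q x v assume c: "c \<in> B" and s: "ssph b p q A (B - {c}) x v"
    have "card A = p + 2 * q" "card B = Suc (2 * p + q)"
      using ssph_card(3,4) [OF s] card_Suc_Diff1 [OF fin(2) c] by simp_all
    then have "q > 0" "p + q = Suc n"
      using card range by (linarith, simp)
    then show "\<phi> x = of_int (psign c (B - {c}) * v)"
      using ssph_spare_col_in_box [OF s c] phi_box by metis
  next
    fix r p q x v assume r: "r \<in> A" and s: "ssph b p q (A - {r}) B x v"
    have "card A = Suc (p + 2 * q)" "card B = 2 * p + q"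
      using ssph_card(3,4) [OF s] card_Suc_Diff1 [OF fin(1) r] by simp_all
    then have "p > 0" "p + q = Suc n"
      using card range by (linarith, simp)
    then show "\<phi> x = of_int ((-1) ^ q * psign r (A - {r}) * v)"
      using ssph_spare_row_in_box [OF s r] phi_box by metis
  qed
qed

lemma ssph_empty:
  assumes "ssph b p q A B x v" "A = {}"
  shows "Poly_Mapping.lookup x {} = v"
  using assms by induction auto

lemma sign_functional_empty: "\<exists>\<phi>. sign_functional b {} {} 0 \<phi>"
proof -
  let ?\<phi> = "\<lambda>x :: chain. of_int (Poly_Mapping.lookup x {}) :: 3"
  have "x = 0" if "x \<in> Bd b {} {} 0" for x
    using that Ch_eq_0_if_few_rows [of _ b "{}" "{}" "Suc 0"] unfolding Bd_def by fastforce
  then have "?\<phi> x = 0" if "x \<in> Bd b {} {} 0" for x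
    using that by fastforce
  then have "homology_functional b {} {} 0 ?\<phi>"
    by (simp add: homology_functional_def lookup_add)
  moreover have "?\<phi> x = of_int v" if "ssph b p q {} {} x v" for p q x v
    using ssph_empty [OF that] by simp
  ultimately show ?thesis
    unfolding sign_functional_def by blast
qed

text \<open>
  The recursion runs over both kinds of functionals: the longest boards need the full functional
  on boards of the same number of rows, and this one needs the functional with a spare line for
  one rook fewer.
\<close>

theorem near_sign_functional_exists:
  assumes "finite A" "finite B" "card A + card B = 3 * s + 1" "card A \<le> 2 * card B + 1" "card B \<le> 2 * card A + 1"
  shows "\<exists>\<phi>. near_sign_functional b A B s \<phi>"
  using assms
proof (induction s arbitrary: b A B rule: less_induct)
  case (less s)
  have top: "\<exists>\<phi>. near_sign_functional b A B s \<phi>"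
    if fin: "finite A" "finite B" and card: "card B = Suc (2 * card A)" "card A = s" for b A B
  proof -
    have "\<exists>\<phi>. sign_functional b A (B - {c}) (card A) \<phi>" if c: "c \<in> B" for c
    proof (cases "A = {}")
      case True
      then have "card (B - {c}) = 0"
        using card fin c by simp
      then have "B - {c} = {}"
        using fin by (simp only: card_eq_0_iff) simp
      then show ?thesis
        unfolding True by (simp only: card.empty sign_functional_empty)
    next
      case False
      then obtain i where i: "i \<in> A"
        by blast
      then obtain m where m: "card A = Suc m"
        using fin(1) by (cases "card A") auto
      have "\<exists>\<phi>. near_sign_functional b (A - {i}) (B - {c} - {j}) m \<phi>" if j: "j \<in> B - {c}" for j
        using i j c fin card m by (intro less.IH) auto
      then show ?thesis
        unfolding m using i fin card m c by (intro sign_functional_of_near [OF _ _ i]) auto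
    qed
    then show ?thesis
      using near_sign_functional_top [OF fin card(1)] card(2) by metis
  qed
  have "card A + 2 \<le> 2 * card B" if "card A \<noteq> Suc (2 * card B)"
  proof -
    have "card A \<le> 2 * card B"
      using that less.prems(4) by linarith
    then have "s < card B"
      using less.prems(3) by linarith
    then show ?thesis
      using less.prems(3) by linarith
  qed
  moreover have "card B + 2 \<le> 2 * card A" if "card B \<noteq> Suc (2 * card A)"
  proof -
    have "card B \<le> 2 * card A"
      using that less.prems(5) by linarith
    then have "s < card A"
      using less.prems(3) by linarith
    then show ?thesis
      using less.prems(3) by linarith
  qed
  ultimately consider "card B = Suc (2 * card A)" | "card A = Suc (2 * card B)"
    | "card A + 2 \<le> 2 * card B" "card B + 2 \<le> 2 * card A"
    by metis
  then show ?case
  proof cases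
    case 1
    then show ?thesis
      using less.prems by (intro top) auto
  next
    case 2
    then have "\<exists>\<phi>. near_sign_functional (\<not> b) B A s \<phi>"
      using less.prems by (intro top) auto
    then show ?thesis
      using near_sign_functional_transpose less.prems by blast
  next
    case 3
    then have "A \<noteq> {}" "B \<noteq> {}"
      by auto
    then obtain i0 j0 where ij: "i0 \<in> A" "j0 \<in> B"
      by blast
    obtain n where n: "s = Suc n"
      using 3 less.prems by (cases s) auto
    show ?thesis
      unfolding n
    proof (rule near_sign_functional_step [OF less.prems(1,2) _ 3 ij])
      show "card A + card B = 3 * Suc n + 1"
        using less.prems n by simp
    next
      fix j assume "j \<in> B - {j0}"
      then show "\<exists>\<phi>. near_sign_functional b (A - {i0}) (B - {j0, j}) n \<phi>"
        using less.prems 3 ij n card_Diff2 [of B j0 j] by (intro less.IH) auto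
    next
      fix i assume "i \<in> A - {i0}"
      then show "\<exists>\<phi>. near_sign_functional b (A - {i0, i}) (B - {j0}) n \<phi>"
        using less.prems 3 ij n card_Diff2 [of A i0 i] by (intro less.IH) auto
    qed
  qed
qed

theorem sign_functional_exists:
  assumes fin: "finite A" "finite B" and card: "card A + card B = 3 * s" "card A \<le> 2 * card B" "card B \<le> 2 * card A"
  shows "\<exists>\<phi>. sign_functional b A B s \<phi>"
proof (cases s)
  case 0
  then show ?thesis
    using sign_functional_empty fin card by simp
next
  case (Suc n)
  then have "A \<noteq> {}"
    using card fin by auto
  then obtain i where i: "i \<in> A"
    by blast
  have "\<exists>\<phi>. near_sign_functional b (A - {i}) (B - {j}) n \<phi>" if j: "j \<in> B" for j
    using i j fin card Suc by (intro near_sign_functional_exists) auto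
  then show ?thesis
    unfolding Suc using card Suc by (intro sign_functional_of_near [OF fin i]) auto
qed

lemma ssph_exists:
  "finite A \<Longrightarrow> finite B \<Longrightarrow> card A = p + 2 * q \<Longrightarrow> card B = 2 * p + q \<Longrightarrow> \<exists>x v. ssph b p q A B x v"
proof (induction p arbitrary: A B)
  case 0
  then show ?case
  proof (induction q arbitrary: A B)
    case 0
    then show ?case
      using ssph.unit by auto
  next
    case (Suc q)
    then have cA: "card A = Suc (Suc (2 * q))" and cB: "card B = Suc q"
      by auto
    from card_eq_SucD [OF cA] obtain i A1 where A1: "A = insert i A1" "i \<notin> A1" and cA1: "card A1 = Suc (2 * q)"
      by blast
    from card_eq_SucD [OF cA1] obtain i' A0 where A0: "A1 = insert i' A0" "i' \<notin> A0" "card A0 = 2 * q"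
      by blast
    from card_eq_SucD [OF cB] obtain j B0 where B: "B = insert j B0" "j \<notin> B0" "card B0 = q"
      by blast
    note A = A1 A0
    note A0(3) B(3)
    moreover have "finite A0" "finite B0"
      using Suc.prems A B by auto
    ultimately obtain x v where "ssph b 0 q A0 B0 x v"
      using Suc.IH by fastforce
    then have "ssph b 0 (Suc q) (insert i (insert i' A0)) (insert j B0) (pair (\<not> b) j i i' x)
        (psign j B0 * psign2 i i' A0 * v)"
      using A B by (intro ssph.col) auto
    then show ?case
      using A B by blast
  qed
next
  case (Suc p)
  then have cA: "card A = Suc (p + 2 * q)" and cB: "card B = Suc (Suc (2 * p + q))"
    by auto
  from card_eq_SucD [OF cA] obtain i A0 where A: "A = insert i A0" "i \<notin> A0" "card A0 = p + 2 * q"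
    by blast
  from card_eq_SucD [OF cB] obtain j B1 where B1: "B = insert j B1" "j \<notin> B1" and cB1: "card B1 = Suc (2 * p + q)"
    by blast
  from card_eq_SucD [OF cB1] obtain k B0 where B0: "B1 = insert k B0" "k \<notin> B0" "card B0 = 2 * p + q"
    by blast
  note B = B1 B0
  note A(3) B0(3)
  moreover have "finite A0" "finite B0"
    using Suc.prems A B by auto
  ultimately obtain x v where "ssph b p q A0 B0 x v"
    using Suc.IH by fastforce
  then have "ssph b (Suc p) q (insert i A0) (insert j (insert k B0)) (pair b i j k x)
      (psign i A0 * psign2 j k B0 * (-1) ^ q * v)"
    using A B by (intro ssph.row) auto
  then show ?case
    using A B by blast
qed

text \<open>
  A join of 0-spheres exists on the board, and its image under the sign functional is invertible
  modulo 3.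
\<close>

theorem exponent_divisible_by_3:
  assumes fin: "finite A" "finite B" and card: "card A + card B = 3 * s" "card A \<le> 2 * card B" "card B \<le> 2 * card A"
    and N: "\<And>z. z \<in> Zc b A B s \<Longrightarrow> frag_cmul N z \<in> Bd b A B s"
  shows "3 dvd N"
proof -
  obtain \<phi> where \<phi>: "sign_functional b A B s \<phi>"
    using sign_functional_exists [OF fin card] by blast
  obtain p q where pq: "card A = p + 2 * q" "card B = 2 * p + q" "p + q = s"
  proof (rule that)
    show "card A = (card B - s) + 2 * (card A - s)" "card B = 2 * (card B - s) + (card A - s)"
      "(card B - s) + (card A - s) = s"
      using card by linarith+
  qed
  obtain x v where s: "ssph b p q A B x v"
    using ssph_exists [OF fin pq(1,2)] by blast
  then have xZ: "x \<in> Zc b A B s"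
    using ssph_Zc pq(3) by blast
  have cf: "homology_functional b A B s \<phi>"
    using \<phi> by (simp add: sign_functional_def)
  have nat_mult: "\<phi> (frag_cmul (int n) x) = of_nat n * \<phi> x" for n
  proof (induction n)
    case 0
    then show ?case
      using homology_functional_zero [OF cf] by simp
  next
    case (Suc n)
    then show ?case
      using homology_functional_add [OF cf Zc_cmul [OF xZ, of "int n"] xZ]
      by (simp add: frag_cmul_distrib algebra_simps)
  qed
  have mult: "\<phi> (frag_cmul k x) = of_int k * \<phi> x" for k
  proof (cases k)
    case (nonneg n)
    then show ?thesis
      using nat_mult by simp
  next
    case (neg n)
    have "\<phi> (- frag_cmul (int (Suc n)) x) = - (of_nat (Suc n) * \<phi> x)"
      using homology_functional_minus [OF cf Zc_cmul [OF xZ]] nat_mult by metis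
    moreover have "frag_cmul k x = - frag_cmul (int (Suc n)) x"
      unfolding neg by (simp del: of_nat_Suc)
    ultimately show ?thesis
      by (simp add: neg del: of_nat_Suc)
  qed
  have "\<phi> x = of_int v"
    using \<phi> s unfolding sign_functional_def by blast
  then have "of_int (N * v) = (0::3)"
    using mult [of N] homology_functional_Bd [OF cf N [OF xZ]] by simp
  then have "3 dvd N * v"
    by (simp only: of_int_eq_0_iff_3)
  then have "3 dvd N * v * v"
    by (rule dvd_mult2)
  then show ?thesis
    using ssph_sign_square [OF s] by (simp add: mult.assoc)
qed

section \<open>Homology groups and their exponents\<close>

lemma chessboard_faces:
  "{\<sigma> \<in> chessboard_complex m n. finite \<sigma> \<and> int (card \<sigma>) = int s} = rooks False {1..m} {1..n} s"
  by (auto simp: chessboard_complex_def rooks_def pt_def)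

lemma chain_group_carrier:
  "carrier (simplicial_chain_group (chessboard_complex m n) (int s - 1)) = Ch False {1..m} {1..n} s"
proof -
  have "{\<sigma> \<in> chessboard_complex m n. finite \<sigma> \<and> int (card \<sigma>) = int s - 1 + 1} = rooks False {1..m} {1..n} s"
    using chessboard_faces [of m n s] by simp
  then show ?thesis
    unfolding simplicial_chain_group_def Ch_def by (simp add: set_eq_iff)
qed

lemma cycles_eq:
  "simplicial_cycles lexord_pairs (chessboard_complex m n) (int s - 1) = Zc False {1..m} {1..n} s"
proof -
  have "\<one>\<^bsub>simplicial_chain_group (chessboard_complex m n) p\<^esub> = 0" for p
    by (simp add: simplicial_chain_group_def)
  then show ?thesis
    by (auto simp: simplicial_cycles_def kernel_def chain_group_carrier Zc_def)
qed

lemma boundaries_eq: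
  "simplicial_boundaries lexord_pairs (chessboard_complex m n) (int s - 1) = Bd False {1..m} {1..n} s"
  using chain_group_carrier [of m n "Suc s"] by (simp add: simplicial_boundaries_def Bd_def add.commute)

lemma group_exponent_dvd:
  assumes "group G"
    and "e > 0" "\<And>x. x \<in> carrier G \<Longrightarrow> x [^]\<^bsub>G\<^esub> (e::nat) = \<one>\<^bsub>G\<^esub>"
  shows "group_exponent G dvd e"
proof -
  interpret group G by fact
  let ?P = "\<lambda>e::nat. e > 0 \<and> (\<forall>x\<in>carrier G. x [^]\<^bsub>G\<^esub> e = \<one>\<^bsub>G\<^esub>)"
  have Pe: "?P e"
    using assms by blast
  define d where "d = (LEAST e. ?P e)"
  have Pd: "?P d"
    unfolding d_def using Pe by (rule LeastI)
  have rem: "x [^]\<^bsub>G\<^esub> (e mod d) = \<one>\<^bsub>G\<^esub>" if x: "x \<in> carrier G" for x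
  proof -
    have "x [^]\<^bsub>G\<^esub> e = x [^]\<^bsub>G\<^esub> (d * (e div d)) \<otimes>\<^bsub>G\<^esub> x [^]\<^bsub>G\<^esub> (e mod d)"
      using x by (simp add: nat_pow_mult)
    moreover have "x [^]\<^bsub>G\<^esub> (d * (e div d)) = \<one>\<^bsub>G\<^esub>"
    proof -
      have "x [^]\<^bsub>G\<^esub> (d * (e div d)) = (x [^]\<^bsub>G\<^esub> d) [^]\<^bsub>G\<^esub> (e div d)"
        using x by (simp add: nat_pow_pow)
      also have "\<dots> = \<one>\<^bsub>G\<^esub>"
        using Pd x by simp
      finally show ?thesis .
    qed
    moreover have "x [^]\<^bsub>G\<^esub> e = \<one>\<^bsub>G\<^esub>"
      using assms(3) x by blast
    ultimately show ?thesis
      using x by simp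
  qed
  have not_P: "\<not> ?P (e mod d)"
  proof -
    have "e mod d < d"
      using Pd by simp
    then show ?thesis
      unfolding d_def by (rule not_less_Least)
  qed
  have "e mod d = 0"
  proof (rule ccontr)
    assume "e mod d \<noteq> 0"
    then have "?P (e mod d)"
      using rem by simp
    with not_P show False
      by contradiction
  qed
  moreover have "group_exponent G = d"
    unfolding group_exponent_def d_def by (rule if_P, rule exI, rule Pe)
  ultimately show ?thesis
    by (simp add: mod_eq_0_iff_dvd)
qed

lemma group_exponent_pow:
  assumes "group_exponent G > 0" "x \<in> carrier G"
  shows "x [^]\<^bsub>G\<^esub> group_exponent G = \<one>\<^bsub>G\<^esub>"
proof -
  let ?P = "\<lambda>e::nat. e > 0 \<and> (\<forall>x\<in>carrier G. x [^]\<^bsub>G\<^esub> e = \<one>\<^bsub>G\<^esub>)"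
  have ex: "\<exists>e. ?P e"
    using assms(1) unfolding group_exponent_def by (rule contrapos_pp) (simp only: if_False not_gr_zero)
  have "group_exponent G = (LEAST e. ?P e)"
    unfolding group_exponent_def by (rule if_P, rule ex)
  moreover have "?P (LEAST e. ?P e)"
    by (rule LeastI_ex, rule ex)
  ultimately show ?thesis
    using assms(2) by simp
qed

context
  fixes m n s :: nat
begin

abbreviation (input) "Ck \<equiv> Ch False {1..m} {1..n} s"
abbreviation (input) "Zk \<equiv> Zc False {1..m} {1..n} s"
abbreviation (input) "Bk \<equiv> Bd False {1..m} {1..n} s"

definition cycle_group :: "chain monoid"
  where "cycle_group = subgroup_generated (simplicial_chain_group (chessboard_complex m n) (int s - 1)) Zk"

lemma homology_eq: "chessboard_homology m n (int s - 1) = cycle_group Mod Bk"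
  by (simp add: chessboard_homology_def reduced_simplicial_homology_def cycles_eq boundaries_eq cycle_group_def)

lemma cycles_subgroup: "subgroup Zk (simplicial_chain_group (chessboard_complex m n) (int s - 1))"
proof -
  let ?G = "simplicial_chain_group (chessboard_complex m n) (int s - 1)"
  have inv: "inv\<^bsub>?G\<^esub> x = - x" if "x \<in> Ck" for x
    using that chain_group_carrier [of m n s, symmetric]
    unfolding simplicial_chain_group_def by (intro inv_free_Abelian_group) simp
  show ?thesis
  proof
    show "Zk \<subseteq> carrier ?G"
      unfolding chain_group_carrier by (auto simp: Zc_def)
  next
    fix x y assume "x \<in> Zk" "y \<in> Zk"
    then show "x \<otimes>\<^bsub>?G\<^esub> y \<in> Zk"
      by (simp add: simplicial_chain_group_def Zc_add)
  next
    show "\<one>\<^bsub>?G\<^esub> \<in> Zk"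
      by (simp add: simplicial_chain_group_def)
  next
    fix x assume "x \<in> Zk"
    then show "inv\<^bsub>?G\<^esub> x \<in> Zk"
      using inv Zc_minus Zc_Ch by metis
  qed
qed

lemma carrier_cycle_group: "carrier cycle_group = Zk"
  unfolding cycle_group_def by (rule subgroup.carrier_subgroup_generated_subgroup [OF cycles_subgroup])

lemma mult_cycle_group [simp]: "x \<otimes>\<^bsub>cycle_group\<^esub> y = x + y"
  and one_cycle_group [simp]: "\<one>\<^bsub>cycle_group\<^esub> = 0"
  by (simp_all add: cycle_group_def simplicial_chain_group_def)

lemma comm_group_cycle_group: "comm_group cycle_group"
  unfolding cycle_group_def simplicial_chain_group_def
  by (intro group.abelian_subgroup_generated abelian_free_Abelian_group group_free_Abelian_group)

lemma boundaries_normal: "Bk \<lhd> cycle_group"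
proof -
  interpret comm_group cycle_group
    by (rule comm_group_cycle_group)
  have "inv\<^bsub>cycle_group\<^esub> x = - x" if "x \<in> Bk" for x
    using that by (intro inv_equality) (auto simp: carrier_cycle_group intro: Bd_subset_Zc Zc_minus)
  then have "subgroup Bk cycle_group"
    by unfold_locales (auto simp: carrier_cycle_group intro: Bd_subset_Zc Bd_add Bd_minus)
  then show ?thesis
    by (rule subgroup_imp_normal)
qed

lemma comm_group_homology: "comm_group (chessboard_homology m n (int s - 1))"
  unfolding homology_eq
  using comm_group.abelian_FactGroup [OF comm_group_cycle_group] boundaries_normal normal_imp_subgroup by blast

lemma pow_cycle_group: "x [^]\<^bsub>cycle_group\<^esub> (e::nat) = frag_cmul (int e) x"
proof (induction e)
  case (Suc e)
  interpret comm_group cycle_group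
    by (rule comm_group_cycle_group)
  show ?case
    using Suc by (simp add: frag_cmul_distrib add.commute)
qed (simp add: nat_pow_def)

lemma homology_exponent:
  "(\<forall>X\<in>carrier (chessboard_homology m n (int s - 1)). X [^]\<^bsub>chessboard_homology m n (int s - 1)\<^esub> (e::nat)
      = \<one>\<^bsub>chessboard_homology m n (int s - 1)\<^esub>) \<longleftrightarrow> (\<forall>z\<in>Zk. frag_cmul (int e) z \<in> Bk)"
proof -
  interpret comm_group cycle_group
    by (rule comm_group_cycle_group)
  interpret N: normal Bk cycle_group
    by (rule boundaries_normal)
  have pow: "(Bk #>\<^bsub>cycle_group\<^esub> z) [^]\<^bsub>cycle_group Mod Bk\<^esub> e = Bk #>\<^bsub>cycle_group\<^esub> frag_cmul (int e) z"
    if z: "z \<in> Zk" for z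
  proof -
    have "(Bk #>\<^bsub>cycle_group\<^esub> z) [^]\<^bsub>cycle_group Mod Bk\<^esub> e = Bk #>\<^bsub>cycle_group\<^esub> (z [^]\<^bsub>cycle_group\<^esub> e)"
      using N.FactGroup_pow carrier_cycle_group z by auto
    then show ?thesis
      by (simp only: pow_cycle_group)
  qed
  have coset: "Bk #>\<^bsub>cycle_group\<^esub> z = Bk \<longleftrightarrow> z \<in> Bk" if "z \<in> Zk" for z
    using that N.subset N.subgroup_axioms coset_join2 coset_join1 unfolding carrier_cycle_group by metis
  have "carrier (cycle_group Mod Bk) = (\<lambda>z. Bk #>\<^bsub>cycle_group\<^esub> z) ` Zk"
    by (auto simp: FactGroup_def RCOSETS_def carrier_cycle_group)
  moreover have "\<one>\<^bsub>cycle_group Mod Bk\<^esub> = Bk"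
    by (simp add: FactGroup_def)
  ultimately show ?thesis
    unfolding homology_eq using pow coset Zc_cmul by auto
qed

end

section \<open>Relabelling the lines of a board\<close>

text \<open>
  Only strictly monotone relabellings will be used. They preserve the order of the vertices and
  hence the incidence signs.
\<close>

definition relabel :: "(nat \<Rightarrow> nat) \<Rightarrow> (nat \<Rightarrow> nat) \<Rightarrow> chain \<Rightarrow> chain"
  where "relabel f g = frag_extend (\<lambda>\<sigma>. frag_of (map_prod f g ` \<sigma>))"

lemma relabel_linear [simp]:
  "relabel f g 0 = 0" "relabel f g (x + y) = relabel f g x + relabel f g y"
  "relabel f g (x - y) = relabel f g x - relabel f g y"
  "relabel f g (frag_cmul k x) = frag_cmul k (relabel f g x)"
  by (simp_all add: relabel_def frag_extend_add frag_extend_diff frag_extend_cmul)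

lemmas relabel_sum = additive_sum [of "relabel f g" for f g, OF relabel_linear(2)]

lemma image_filter: "{y \<in> h ` S. P y} = h ` {x \<in> S. P (h x)}"
  by blast

lemma rooks_False:
  "\<sigma> \<in> rooks False A B s \<longleftrightarrow> finite \<sigma> \<and> card \<sigma> = s \<and> \<sigma> \<subseteq> A \<times> B \<and>
    (\<forall>v\<in>\<sigma>. \<forall>w\<in>\<sigma>. v \<noteq> w \<longrightarrow> fst v \<noteq> fst w \<and> snd v \<noteq> snd w)"
  by (auto simp: rooks_def pt_def)

context
  fixes f g :: "nat \<Rightarrow> nat" and A B :: "nat set"
  assumes mono: "strict_mono_on A f" "strict_mono_on B g"
begin

lemma relabel_inj: "inj_on (map_prod f g) (A \<times> B)"
  using map_prod_inj_on [OF strict_mono_on_imp_inj_on strict_mono_on_imp_inj_on] mono by blast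

lemma relabel_lexord:
  "v \<in> A \<times> B \<Longrightarrow> w \<in> A \<times> B \<Longrightarrow> (map_prod f g v, map_prod f g w) \<in> lexord_pairs \<longleftrightarrow> (v, w) \<in> lexord_pairs"
  using mono by (auto simp: strict_mono_on_less strict_mono_on_eq)

lemma relabel_in_Ch:
  assumes "c \<in> Ch False A B s"
  shows "relabel f g c \<in> Ch False (f ` A) (g ` B) s"
proof (rule frag_image_in_Ch [OF assms, where f = "relabel f g"])
  fix \<sigma> assume s: "\<sigma> \<in> rooks False A B s"
  then have sub: "\<sigma> \<subseteq> A \<times> B" and c: "card \<sigma> = s" and fin: "finite \<sigma>"
    by (simp_all add: rooks_False)
  have "card (map_prod f g ` \<sigma>) = s"
    using card_image [OF inj_on_subset [OF relabel_inj sub]] c by simp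
  moreover have "map_prod f g ` \<sigma> \<subseteq> f ` A \<times> g ` B"
    using sub by auto
  moreover have "fst v' \<noteq> fst w' \<and> snd v' \<noteq> snd w'"
    if v': "v' \<in> map_prod f g ` \<sigma>" and w': "w' \<in> map_prod f g ` \<sigma>" and ne: "v' \<noteq> w'" for v' w'
  proof -
    from v' obtain v where v: "v' = map_prod f g v" "v \<in> \<sigma>"
      by (rule imageE)
    from w' obtain w where w: "w' = map_prod f g w" "w \<in> \<sigma>"
      by (rule imageE)
    note vw = v w
    then have "fst v \<noteq> fst w" "snd v \<noteq> snd w"
      using ne s unfolding rooks_False by metis+
    moreover have "fst v \<in> A" "fst w \<in> A" "snd v \<in> B" "snd w \<in> B"
      using vw sub by auto
    ultimately show ?thesis
      using vw mono by (simp add: strict_mono_on_eq)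
  qed
  ultimately have "map_prod f g ` \<sigma> \<in> rooks False (f ` A) (g ` B) s"
    using fin unfolding rooks_False by blast
  then show "relabel f g (frag_of \<sigma>) \<in> Ch False (f ` A) (g ` B) s"
    by (simp add: relabel_def Ch_def)
qed auto

lemma bd_relabel:
  assumes "c \<in> Ch False A B s"
  shows "bd (relabel f g c) = relabel f g (bd c)"
proof -
  have "Poly_Mapping.keys c \<subseteq> rooks False A B s"
    using assms by (simp add: Ch_def)
  then show ?thesis
  proof (induction c rule: frag_induction)
    case (one \<sigma>)
    then have sub: "\<sigma> \<subseteq> A \<times> B" and fin: "finite \<sigma>"
      by (simp_all add: rooks_False)
    let ?h = "map_prod f g"
    have inj: "inj_on ?h \<sigma>"
      using relabel_inj sub by (rule inj_on_subset)
    have con: "contract (?h v) (frag_of (?h ` \<sigma>)) = relabel f g (contract v (frag_of \<sigma>))" if v: "v \<in> \<sigma>" for v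
    proof -
      have "{w \<in> \<sigma>. (?h w, ?h v) \<in> lexord_pairs} = {w \<in> \<sigma>. (w, v) \<in> lexord_pairs}"
        using relabel_lexord [of _ v] sub v by (intro Collect_cong conj_cong refl) (metis subsetD)
      then have "{w' \<in> ?h ` \<sigma>. (w', ?h v) \<in> lexord_pairs} = ?h ` {w \<in> \<sigma>. (w, v) \<in> lexord_pairs}"
        by (simp only: image_filter)
      then have "insertion_sign (?h ` \<sigma>) (?h v) = insertion_sign \<sigma> v"
        unfolding insertion_sign_def using card_image [OF inj_on_subset [OF inj, of "{w \<in> \<sigma>. (w, v) \<in> lexord_pairs}"]]
        by simp
      moreover have "?h ` \<sigma> - {?h v} = ?h ` (\<sigma> - {v})"
        using inj_on_image_set_diff [OF inj, of \<sigma> "{v}"] v by simp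
      ultimately show ?thesis
        using v fin by (simp add: contract_frag_of relabel_def frag_extend_cmul)
    qed
    have "bd (relabel f g (frag_of \<sigma>)) = (\<Sum>v'\<in>?h ` \<sigma>. contract v' (frag_of (?h ` \<sigma>)))"
      using fin by (simp add: relabel_def bd_frag_of_eq_sum_contract [of "?h ` \<sigma>"])
    also have "\<dots> = (\<Sum>v\<in>\<sigma>. relabel f g (contract v (frag_of \<sigma>)))"
      using con by (simp add: sum.reindex [OF inj])
    also have "\<dots> = relabel f g (bd (frag_of \<sigma>))"
      using fin by (simp add: relabel_sum bd_frag_of_eq_sum_contract [of \<sigma>])
    finally show ?case .
  qed auto
qed

lemma relabel_inverse:
  assumes "c \<in> Ch False A B s" "\<And>a. a \<in> A \<Longrightarrow> f' (f a) = a" "\<And>b. b \<in> B \<Longrightarrow> g' (g b) = b"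
  shows "relabel f' g' (relabel f g c) = c"
proof -
  have "Poly_Mapping.keys c \<subseteq> rooks False A B s"
    using assms by (simp add: Ch_def)
  then show ?thesis
  proof (induction c rule: frag_induction)
    case (one \<sigma>)
    then have "\<sigma> \<subseteq> A \<times> B"
      by (simp add: rooks_False)
    then have "map_prod f' g' (map_prod f g v) = v" if "v \<in> \<sigma>" for v
      using that assms by (cases v) auto
    then have "map_prod f' g' ` map_prod f g ` \<sigma> = \<sigma>"
      by (simp add: image_image)
    then show ?case
      by (simp add: relabel_def)
  qed auto
qed

end

lemma order_isomorphism_to_initial_segment:
  assumes "finite A" "card A = n"
  obtains f f' :: "nat \<Rightarrow> nat" where "strict_mono_on A f" "f ` A = {1..n}"
    "strict_mono_on {1..n} f'" "f' ` {1..n} = A" "\<And>a. a \<in> A \<Longrightarrow> f' (f a) = a"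
proof -
  obtain h where h: "bij_betw h {..<n} A" "strict_mono_on {..<n} h"
    using ex_bij_betw_strict_mono_card [OF assms(1)] assms(2) by metis
  \<comment> \<open>\<open>h\<close> enumerates from 0, whereas the lines of the standard board are numbered from 1\<close>
  define k where "k = inv_into {..<n} h"
  have k: "h (k a) = a" "k a < n" if "a \<in> A" for a
    using that h(1) unfolding k_def bij_betw_def by (auto simp: f_inv_into_f dest: inv_into_into)
  have kh: "k (h x) = x" if "x < n" for x
    using that h(1) unfolding k_def bij_betw_def by (simp add: inv_into_f_f)
  have hA: "h x \<in> A" if "x < n" for x
    using that h(1) unfolding bij_betw_def by auto
  show ?thesis
  proof
    show "strict_mono_on A (\<lambda>a. Suc (k a))"
    proof (rule strict_mono_onI)
      fix a a' assume "a \<in> A" "a' \<in> A" "a < a'"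
      then have "h (k a) < h (k a')"
        by (simp add: k)
      then show "Suc (k a) < Suc (k a')"
        using strict_mono_on_less [OF h(2), of "k a" "k a'"] k \<open>a \<in> A\<close> \<open>a' \<in> A\<close> by simp
    qed
    show "(\<lambda>a. Suc (k a)) ` A = {1..n}"
    proof
      show "(\<lambda>a. Suc (k a)) ` A \<subseteq> {1..n}"
        using k by (auto simp: Suc_le_eq)
      show "{1..n} \<subseteq> (\<lambda>a. Suc (k a)) ` A"
      proof
        fix x assume "x \<in> {1..n}"
        then have "x - 1 < n" "x = Suc (k (h (x - 1)))"
          by (auto simp: kh)
        then show "x \<in> (\<lambda>a. Suc (k a)) ` A"
          using hA by blast
      qed
    qed
    show "strict_mono_on {1..n} (\<lambda>x. h (x - 1))"
    proof (rule strict_mono_onI)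
      fix x y assume "x \<in> {1..n}" "y \<in> {1..n}" "x < y"
      then show "h (x - 1) < h (y - 1)"
        using strict_mono_on_less [OF h(2), of "x - 1" "y - 1"] by auto
    qed
    show "(\<lambda>x. h (x - 1)) ` {1..n} = A"
    proof
      show "(\<lambda>x. h (x - 1)) ` {1..n} \<subseteq> A"
        using hA by auto
      show "A \<subseteq> (\<lambda>x. h (x - 1)) ` {1..n}"
      proof
        fix a assume "a \<in> A"
        then have "a = h (Suc (k a) - 1)" "Suc (k a) \<in> {1..n}"
          using k by (auto simp: Suc_le_eq)
        then show "a \<in> (\<lambda>x. h (x - 1)) ` {1..n}"
          by blast
      qed
    qed
    show "h (Suc (k a) - 1) = a" if "a \<in> A" for a
      using k that by simp
  qed
qed

lemma kills_relabelled:
  assumes fin: "finite A" "finite B" and card: "card A = m" "card B = n"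
    and N: "\<And>z. z \<in> Zc False {1..m} {1..n} s \<Longrightarrow> frag_cmul N z \<in> Bd False {1..m} {1..n} s"
    and z: "z \<in> Zc False A B s"
  shows "frag_cmul N z \<in> Bd False A B s"
proof -
  obtain f f' where f: "strict_mono_on A f" "f ` A = {1..m}" "strict_mono_on {1..m} f'" "f' ` {1..m} = A"
    "\<And>a. a \<in> A \<Longrightarrow> f' (f a) = a"
    using order_isomorphism_to_initial_segment [OF fin(1) card(1)] by metis
  obtain g g' where g: "strict_mono_on B g" "g ` B = {1..n}" "strict_mono_on {1..n} g'" "g' ` {1..n} = B"
    "\<And>a. a \<in> B \<Longrightarrow> g' (g a) = a"
    using order_isomorphism_to_initial_segment [OF fin(2) card(2)] by metis
  have "relabel f g z \<in> Zc False {1..m} {1..n} s"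
    using relabel_in_Ch [OF f(1) g(1) Zc_Ch [OF z]] bd_relabel [OF f(1) g(1) Zc_Ch [OF z]] Zc_bd [OF z]
    by (simp add: Zc_def f(2) g(2))
  from N [OF this] obtain c where c: "c \<in> Ch False {1..m} {1..n} (Suc s)" "frag_cmul N (relabel f g z) = bd c"
    by (auto simp: Bd_def)
  have "frag_cmul N z = relabel f' g' (relabel f g (frag_cmul N z))"
    using relabel_inverse [OF f(1) g(1) Ch_cmul [OF Zc_Ch [OF z]] f(5) g(5)] by simp
  also have "\<dots> = bd (relabel f' g' c)"
    unfolding bd_relabel [OF f(3) g(3) c(1)] by (simp add: c(2))
  also have "\<dots> \<in> Bd False A B s"
    using BdI [OF relabel_in_Ch [OF f(3) g(3) c(1)]] unfolding f(4) g(4) .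
  finally show ?thesis .
qed

text \<open>
  In case (a) it is the divisibility of \<open>N\<close> by 3 that is used, in the other two cases the
  annihilation of the joins of 3 + 3 spheres.
\<close>

lemma admissible_kills:
  assumes N: "\<And>z. z \<in> Zc False {1..9} {1..9} 6 \<Longrightarrow> frag_cmul N z \<in> Bd False {1..9} {1..9} 6"
    and adm: "admissible m n"
  shows "\<exists>s. chessboard_nu m n = int s - 1 \<and>
    (\<forall>z\<in>Zc False {1..m} {1..n} s. frag_cmul N z \<in> Bd False {1..m} {1..n} s)"
proof -
  have sph: "frag_cmul N x \<in> Bd False A B 6" if x: "x \<in> sph False 3 3 A B" for A B x
    by (rule kills_relabelled [OF sph_card(1,2) [OF x] _ _ N])
      (use sph_card(3,4) [OF x] sph_Zc [OF x] in simp_all)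
  have nu: "chessboard_nu m n = int s - 1" if "(m + n + 1) div 3 = s" "s \<le> m" "s \<le> n" for s
  proof -
    have "(int m + int n + 1) div 3 = int s"
      using that(1) by (metis of_nat_1 of_nat_add of_nat_numeral zdiv_int)
    then show ?thesis
      using that(2,3) by (simp add: chessboard_nu_def)
  qed
  have mn: "m \<le> n"
    using adm by (simp add: admissible_def)
  consider "(m + n) mod 3 = 1" "n + 5 \<le> 2 * m" | "(m + n) mod 3 = 0" "n + 9 \<le> 2 * m"
    | "(m + n) mod 3 = 2" "n + 13 \<le> 2 * m"
    using adm unfolding admissible_def by linarith
  then show ?thesis
  proof cases
    case 1
    then obtain s where s: "m + n = 3 * s + 1"
      by (metis mod_mult_div_eq add.commute)
    have "3 dvd N"
      by (rule exponent_divisible_by_3 [where A = "{1..9}" and B = "{1..9}" and s = 6, OF _ _ _ _ _ N]) auto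
    then obtain k where k: "N = k * 3"
      by (metis dvdE mult.commute)
    have "frag_cmul N z \<in> Bd False {1..m} {1..n} s" if "z \<in> Zc False {1..m} {1..n} s" for z
    proof -
      have "frag_cmul 3 z \<in> Bd False {1..m} {1..n} s"
        using that s 1 mn by (intro three_kills) auto
      from Bd_cmul [OF this, of k] show ?thesis
        by (simp add: k)
    qed
    moreover have "chessboard_nu m n = int s - 1"
      using s 1 mn by (intro nu) auto
    ultimately show ?thesis
      by blast
  next
    case 2
    then obtain s where s: "m + n = 3 * s"
      by auto
    have "frag_cmul N z \<in> Bd False {1..m} {1..n} s" if "z \<in> Zc False {1..m} {1..n} s" for z
      using that s 2 mn by (intro kills_product_range [OF sph]) auto
    moreover have "chessboard_nu m n = int s - 1"
      using s 2 mn by (intro nu) auto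
    ultimately show ?thesis
      by blast
  next
    case 3
    then have "m + n + 1 = 3 * ((m + n + 1) div 3)"
      by presburger
    then obtain s where s: "m + n + 1 = 3 * s"
      by blast
    have "frag_cmul N z \<in> Bd False {1..m} {1..n} s" if "z \<in> Zc False {1..m} {1..n} s" for z
      using that s 3 mn by (intro kills_op_product_range [OF sph]) auto
    moreover have "chessboard_nu m n = int s - 1"
      using s 3 mn by (intro nu) auto
    ultimately show ?thesis
      by blast
  qed
qed

theorem theorem5p13:
  "(\<forall>m n. admissible m n \<longrightarrow>
       group_exponent (chessboard_homology m n (chessboard_nu m n)) dvd
       group_exponent (chessboard_homology 9 9 (chessboard_nu 9 9))) \<and>
   (elementary_3_group (chessboard_homology 9 9 (chessboard_nu 9 9)) \<longrightarrow>
       (\<forall>m n. admissible m n \<longrightarrow>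
         elementary_3_group (chessboard_homology m n (chessboard_nu m n))))"
proof -
  let ?H = "\<lambda>m n. chessboard_homology m n (chessboard_nu m n)"
  have nu9: "chessboard_nu 9 9 = int 6 - 1"
    by (simp add: chessboard_nu_def)
  \<comment> \<open>the annihilation statement is transferred for every \<open>e\<close>: with the exponent of the group, and with \<open>3\<close>\<close>
  have transfer: "comm_group (?H m n) \<and> (\<forall>X\<in>carrier (?H m n). X [^]\<^bsub>?H m n\<^esub> e = \<one>\<^bsub>?H m n\<^esub>)"
    if e: "\<forall>X\<in>carrier (?H 9 9). X [^]\<^bsub>?H 9 9\<^esub> e = \<one>\<^bsub>?H 9 9\<^esub>" and adm: "admissible m n" for m n and e :: nat
  proof -
    have "\<forall>z\<in>Zc False {1..9} {1..9} 6. frag_cmul (int e) z \<in> Bd False {1..9} {1..9} 6"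
      using e unfolding nu9 by (subst (asm) homology_exponent) simp_all
    then obtain s where s: "chessboard_nu m n = int s - 1"
      "\<forall>z\<in>Zc False {1..m} {1..n} s. frag_cmul (int e) z \<in> Bd False {1..m} {1..n} s"
      using admissible_kills [OF _ adm, of "int e"] by blast
    show ?thesis
      unfolding s(1) using comm_group_homology iffD2 [OF homology_exponent s(2)] by (rule conjI)
  qed
  have "group_exponent (?H m n) dvd group_exponent (?H 9 9)" if adm: "admissible m n" for m n
  proof (cases "group_exponent (?H 9 9) = 0")
    case True
    then show ?thesis
      by simp
  next
    case False
    then have "\<forall>X\<in>carrier (?H 9 9). X [^]\<^bsub>?H 9 9\<^esub> group_exponent (?H 9 9) = \<one>\<^bsub>?H 9 9\<^esub>"
      using group_exponent_pow [of "?H 9 9"] by (intro ballI) simp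
    from transfer [OF this adm] show ?thesis
      using False comm_group.axioms(2) by (intro group_exponent_dvd) auto
  qed
  moreover have "elementary_3_group (?H m n)" if "elementary_3_group (?H 9 9)" "admissible m n" for m n
  proof -
    from that(1) have "\<forall>X\<in>carrier (?H 9 9). X [^]\<^bsub>?H 9 9\<^esub> (3::nat) = \<one>\<^bsub>?H 9 9\<^esub>"
      unfolding elementary_3_group_def by (rule conjunct2)
    from transfer [OF this that(2)] show ?thesis
      unfolding elementary_3_group_def .
  qed
  ultimately show ?thesis
    by blast
qed

end
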